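(* For each integer $n\ge 1$, there exists on $\mathbb{C}^n$ a complete rotationally symmetric gradient Kähler-Ricci soliton of positive sectional curvature. Moreover, such a soliton is unique up to scaling (multiplying the metric by a positive constant) and dilation (pulling the metric back by a map $z\mapsto \lambda z$ with $\lambda>0$).
   Context: A Kähler metric $g=(g_{i\bar j})$ on a complex manifold $M$ is called a gradient Kähler-Ricci soliton (for the Kähler-Ricci flow $\partial_t g_{i\bar j}=-R_{i\bar j}$) if there is a smooth real-valued function $f$ on $M$ with $R_{i\bar j}=f_{,i\bar j}$ and $f_{,ij}=0$, where $R_{i\bar j}=-\partial_i\partial_{\bar j}\log\det(g_{k\bar l})$ is the Ricci tensor and commas denote covariant derivatives with respect to $g$. The condition $f_{,ij}=0$ says that the gradient vector field $V^i=g^{i\bar j}f_{,\bar j}$ is holomorphic. A Kähler metric on $\mathbb{C}^n$ is rotationally symmetric if it is invariant under the standard action of the unitary group $U(n)$; $\mathbb{C}^n$ carries its standard complex structure. For $n=1$, sectional curvature means Gaussian curvature. *)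

theory Defs
  imports "HOL-Analysis.Analysis"
begin

section \<open>Smooth functions and Riemannian geometry on a Euclidean space\<close>

abbreviation dir_deriv :: "('a::real_normed_vector \<Rightarrow> 'b::real_normed_vector) \<Rightarrow> 'a \<Rightarrow> 'a \<Rightarrow> 'b"
  where "dir_deriv F x u \<equiv> frechet_derivative F (at x) u"

primrec C_k :: "nat \<Rightarrow> ('a::euclidean_space \<Rightarrow> 'b::real_normed_vector) \<Rightarrow> bool" where
  "C_k 0 F \<longleftrightarrow> continuous_on UNIV F"
| "C_k (Suc k) F \<longleftrightarrow> (\<forall>x. F differentiable (at x)) \<and> (\<forall>v. C_k k (\<lambda>x. dir_deriv F x v))"

definition smooth :: "('a::euclidean_space \<Rightarrow> 'b::real_normed_vector) \<Rightarrow> bool"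
  where "smooth F \<longleftrightarrow> (\<forall>k. C_k k F)"

text \<open>
  A Riemannian metric on the manifold \<open>'a\<close> is a function \<open>h\<close> such that \<open>h x\<close> is an inner product
  on \<open>'a\<close>, which is also the tangent space at \<open>x\<close>.  Vectors are identified with constant vector
  fields, so that all brackets vanish.
\<close>

text \<open>
  The Levi-Civita covariant derivative at \<open>x\<close> of the constant field \<open>v\<close> in direction \<open>u\<close>,
  given by the Koszul formula.
\<close>

definition levi_civita :: "('a::euclidean_space \<Rightarrow> 'a \<Rightarrow> 'a \<Rightarrow> real) \<Rightarrow> 'a \<Rightarrow> 'a \<Rightarrow> 'a \<Rightarrow> 'a" where
  "levi_civita h x u v =
     (THE y. \<forall>w. 2 * h x y w =
        dir_deriv (\<lambda>p. h p v w) x u + dir_deriv (\<lambda>p. h p u w) x v - dir_deriv (\<lambda>p. h p u v) x w)"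

text \<open>\<open>R(u,v)w = \<nabla>\<^sub>u\<nabla>\<^sub>v w - \<nabla>\<^sub>v\<nabla>\<^sub>u w\<close>, where
  \<open>\<nabla>\<^sub>u Y = D\<^sub>u Y + levi_civita h x u Y\<close> for a vector field \<open>Y\<close>.\<close>

definition riemann_curv :: "('a::euclidean_space \<Rightarrow> 'a \<Rightarrow> 'a \<Rightarrow> real) \<Rightarrow> 'a \<Rightarrow> 'a \<Rightarrow> 'a \<Rightarrow> 'a \<Rightarrow> 'a" where
  "riemann_curv h x u v w =
     (dir_deriv (\<lambda>p. levi_civita h p v w) x u + levi_civita h x u (levi_civita h x v w))
   - (dir_deriv (\<lambda>p. levi_civita h p u w) x v + levi_civita h x v (levi_civita h x u w))"

definition sectional_curv :: "('a::euclidean_space \<Rightarrow> 'a \<Rightarrow> 'a \<Rightarrow> real) \<Rightarrow> 'a \<Rightarrow> 'a \<Rightarrow> 'a \<Rightarrow> real" where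
  "sectional_curv h x u v =
     h x (riemann_curv h x u v v) u / (h x u u * h x v v - (h x u v)\<^sup>2)"

definition positive_sectional_curv :: "('a::euclidean_space \<Rightarrow> 'a \<Rightarrow> 'a \<Rightarrow> real) \<Rightarrow> bool" where
  "positive_sectional_curv h \<longleftrightarrow>
     (\<forall>x u v. u \<noteq> v \<and> independent {u, v} \<longrightarrow> sectional_curv h x u v > 0)"

text \<open>
  The infimum of the lengths of the piecewise \<open>C\<^sup>1\<close> paths from \<open>x\<close> to \<open>y\<close>.  A \<open>valid_path\<close> may
  have an unbounded derivative near its finitely many exceptional points and hence infinite length;
  \<open>has_integral\<close> excludes such paths, whereas the total function \<open>integral\<close> would give them length 0.
\<close>

definition riem_dist :: "('a::euclidean_space \<Rightarrow> 'a \<Rightarrow> 'a \<Rightarrow> real) \<Rightarrow> 'a \<Rightarrow> 'a \<Rightarrow> real" where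
  "riem_dist h x y = Inf {L. \<exists>\<gamma>. valid_path \<gamma> \<and> pathstart \<gamma> = x \<and> pathfinish \<gamma> = y \<and>
     ((\<lambda>t. sqrt (h (\<gamma> t) (vector_derivative \<gamma> (at t)) (vector_derivative \<gamma> (at t))))
        has_integral L) {0..1}}"

definition complete_metric :: "('a::euclidean_space \<Rightarrow> 'a \<Rightarrow> 'a \<Rightarrow> real) \<Rightarrow> bool" where
  "complete_metric h \<longleftrightarrow> Metric_space.mcomplete UNIV (riem_dist h)"

section \<open>Kaehler metrics on complex Euclidean space\<close>

text \<open>
  A Hermitian metric is given by its matrix in the standard holomorphic coordinates:
  \<open>g z $ i $ j\<close> is the component of index \<open>i\<close>, \<open>j\<close>-bar.  Its Riemannian metric is normalised such
  that the identity matrix gives the Euclidean inner product.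
\<close>

type_synonym 'n herm_field = "complex^'n \<Rightarrow> complex^'n^'n"

definition riem_of :: "'n::finite herm_field \<Rightarrow> complex^'n \<Rightarrow> complex^'n \<Rightarrow> complex^'n \<Rightarrow> real" where
  "riem_of g z u v = Re (\<Sum>i\<in>UNIV. \<Sum>j\<in>UNIV. g z $ i $ j * u $ i * cnj (v $ j))"

definition kaehler_form :: "'n::finite herm_field \<Rightarrow> complex^'n \<Rightarrow> complex^'n \<Rightarrow> complex^'n \<Rightarrow> real" where
  "kaehler_form g z u v = riem_of g z (\<i> *s u) v"

text \<open>The last conjunct says that the exterior derivative of the Kaehler form, evaluated on
  constant vector fields, vanishes.\<close>

definition kaehler_metric :: "'n::finite herm_field \<Rightarrow> bool" where
  "kaehler_metric g \<longleftrightarrow>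
     smooth g \<and>
     (\<forall>z i j. g z $ j $ i = cnj (g z $ i $ j)) \<and>
     (\<forall>z v. v \<noteq> 0 \<longrightarrow> riem_of g z v v > 0) \<and>
     (\<forall>z u v w. dir_deriv (\<lambda>p. kaehler_form g p v w) z u
               + dir_deriv (\<lambda>p. kaehler_form g p w u) z v
               + dir_deriv (\<lambda>p. kaehler_form g p u v) z w = 0)"

text \<open>The Wirtinger derivatives with respect to the \<open>i\<close>-th coordinate and its conjugate.\<close>

definition wirt :: "'n::finite \<Rightarrow> (complex^'n \<Rightarrow> complex) \<Rightarrow> complex^'n \<Rightarrow> complex" where
  "wirt i F z = (dir_deriv F z (axis i 1) - \<i> * dir_deriv F z (axis i \<i>)) / 2"

definition wirt_bar :: "'n::finite \<Rightarrow> (complex^'n \<Rightarrow> complex) \<Rightarrow> complex^'n \<Rightarrow> complex" where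
  "wirt_bar i F z = (dir_deriv F z (axis i 1) + \<i> * dir_deriv F z (axis i \<i>)) / 2"

definition ricci :: "'n::finite herm_field \<Rightarrow> complex^'n \<Rightarrow> 'n \<Rightarrow> 'n \<Rightarrow> complex" where
  "ricci g z i j = - wirt i (wirt_bar j (\<lambda>p. ln (det (g p)))) z"

text \<open>
  The only Christoffel symbols of a Kaehler metric that may be nonzero are those with all three
  indices unbarred, given below, and their conjugates.  The entry \<open>g\<^sup>k\<^sup>l\<close> of the inverse metric,
  \<open>l\<close> barred, is \<open>matrix_inv (g z) $ l $ k\<close>.
\<close>

definition christoffel :: "'n::finite herm_field \<Rightarrow> complex^'n \<Rightarrow> 'n \<Rightarrow> 'n \<Rightarrow> 'n \<Rightarrow> complex" where
  "christoffel g z k i j =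
     (\<Sum>l\<in>UNIV. matrix_inv (g z) $ l $ k * wirt i (\<lambda>p. g p $ j $ l) z)"

definition hess_20 :: "'n::finite herm_field \<Rightarrow> (complex^'n \<Rightarrow> real) \<Rightarrow> complex^'n \<Rightarrow> 'n \<Rightarrow> 'n \<Rightarrow> complex" where
  "hess_20 g f z i j =
     wirt i (wirt j (\<lambda>p. of_real (f p))) z
     - (\<Sum>k\<in>UNIV. christoffel g z k i j * wirt k (\<lambda>p. of_real (f p)) z)"

text \<open>The mixed Christoffel symbols vanish, so the mixed Hessian does not involve the metric.\<close>

definition hess_11 :: "(complex^'n::finite \<Rightarrow> real) \<Rightarrow> complex^'n \<Rightarrow> 'n \<Rightarrow> 'n \<Rightarrow> complex" where
  "hess_11 f z i j = wirt i (wirt_bar j (\<lambda>p. of_real (f p))) z"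

definition gradient_kr_soliton :: "'n::finite herm_field \<Rightarrow> bool" where
  "gradient_kr_soliton g \<longleftrightarrow> kaehler_metric g \<and>
     (\<exists>f :: complex^'n \<Rightarrow> real. smooth f \<and>
        (\<forall>z i j. ricci g z i j = hess_11 f z i j) \<and>
        (\<forall>z i j. hess_20 g f z i j = 0))"

text \<open>The pullback of a Hermitian metric along the linear map \<open>z \<mapsto> A *v z\<close>.\<close>

definition pullback :: "complex^'n^'n \<Rightarrow> 'n::finite herm_field \<Rightarrow> 'n herm_field" where
  "pullback A g z = transpose A ** g (A *v z) ** map_matrix cnj A"

definition unitary :: "complex^'n^'n::finite \<Rightarrow> bool" where
  "unitary U \<longleftrightarrow> transpose (map_matrix cnj U) ** U = mat 1"

definition rotationally_symmetric :: "'n::finite herm_field \<Rightarrow> bool" where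
  "rotationally_symmetric g \<longleftrightarrow> (\<forall>U. unitary U \<longrightarrow> pullback U g = g)"

definition complete_rot_sym_positive_soliton :: "'n::finite herm_field \<Rightarrow> bool" where
  "complete_rot_sym_positive_soliton g \<longleftrightarrow>
     gradient_kr_soliton g \<and> rotationally_symmetric g \<and>
     complete_metric (riem_of g) \<and> positive_sectional_curv (riem_of g)"

end

theory Submission
  imports Defs "HOL-Complex_Analysis.Cauchy_Integral_Formula"
begin

text \<open>
  A \<open>U(n)\<close>-invariant Kaehler metric is \<open>g\<^sub>i\<^sub>j = A(x) \<delta>\<^sub>i\<^sub>j + A'(x) cnj z\<^sub>i z\<^sub>j\<close> with \<open>x = |z|\<^sup>2\<close>.  Put
  \<open>t(x) = x A(x)\<close> and \<open>B = t'\<close>, so that \<open>det g = A\<^bsup>n-1\<^esup> B\<close>.  The function \<open>t(|z|\<^sup>2)\<close> is a soliton potential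
  as soon as \<open>A\<^bsup>n-1\<^esup> B e\<^bsup>t\<^esup> = 1\<close>, that is, \<open>n \<integral>\<^sub>0\<^bsup>t\<^esup> s\<^bsup>n-1\<^esup> e\<^bsup>s\<^esup> ds = x\<^bsup>n\<^esup>\<close>.  The curvature components of this
  metric are Laplace transforms in \<open>t\<close> of positive measures on \<open>[0, 1]\<close>, and positivity of all sectional
  curvatures amounts to a strict Cauchy-Schwarz inequality between them.  Completeness holds since
  \<open>g\<close> dominates \<open>k |dz|\<^sup>2 / (1 + |z|\<^sup>2)\<close>.

  For uniqueness, the potential \<open>f\<close> of an arbitrary soliton need not be invariant, but it can be dealt with on a
  single coordinate axis, where \<open>g\<close> is diagonal and radial.  There the gradient field \<open>V\<close> of \<open>f\<close> is
  holomorphic in one variable, and so is the conjugate of \<open>\<partial>\<close>-bar of \<open>log det g + f\<close>.  Averaging over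
  circles gives \<open>(log det g)' = - v B\<close> with \<open>v = V'(0)\<close>, an equation for the radial profile alone.  If
  \<open>v < 0\<close>, then its solutions do not exist for all \<open>x\<close>; if \<open>v = 0\<close>, then \<open>g\<close> is flat; if \<open>v > 0\<close>, then scaling and
  dilation lead to the solution above.
\<close>

section \<open>Differential calculus and the Hermitian product\<close>

text \<open>With f = t(|z|^2) the derivative f_jbar is B z_j, and z spans the eigenspace of g on
  which the eigenvalue is B. So the gradient of f is the Euler field z, holomorphic for every A, and
  only the Ricci equation remains; log det g = -f solves it. This is why a single scalar equation
  suffices. Its solution is studied with t as the independent variable: after rescaling the integral
  to [0, 1], derivatives in t and integration by parts turn moments into moments, so that signs can
  be read off and nothing is divided by t or x at the origin.

  In the uniqueness part a potential may be altered by a pluriharmonic function whose gradient is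
  holomorphic, so symmetry of g does not pass to f. The circle integral on one axis takes the place
  of an average over U(n). To avoid expansions in x = |z|^2 at the origin, the unknown profiles are
  functions of r = |z| > 0, and continuity at 0 fixes the constants of integration.\<close>

lemma dir_deriv_eq: "(F has_derivative F') (at x) \<Longrightarrow> dir_deriv F x v = F' v"
  using frechet_derivative_at by metis

lemma has_derivative_dir_deriv:
  "F differentiable (at x) \<Longrightarrow> (F has_derivative (\<lambda>v. dir_deriv F x v)) (at x)"
  using frechet_derivative_works by blast

lemma dir_deriv_along_curve:
  assumes "F differentiable (at (c t))" "(c has_vector_derivative w) (at t)"
  shows "((\<lambda>s. F (c s)) has_vector_derivative dir_deriv F (c t) w) (at t)"
  using diff_chain_at[OF assms(2)[unfolded has_vector_derivative_def] has_derivative_dir_deriv[OF assms(1)]]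
  unfolding has_vector_derivative_def
  by (simp add: o_def linear_cmul[OF has_derivative_linear[OF has_derivative_dir_deriv[OF assms(1)]]])

section \<open>Closure properties of the classes \<open>C_k\<close>\<close>

lemma C_k_SucI:
  assumes "\<And>x. (F has_derivative F' x) (at x)" "\<And>v. C_k k (\<lambda>x. F' x v)"
  shows "C_k (Suc k) F"
  using assms by (auto simp: dir_deriv_eq[OF assms(1)] differentiable_def)

lemma C_k_Suc_D: "C_k (Suc k) F \<Longrightarrow> C_k k F"
proof (induction k arbitrary: F)
  case 0
  then show ?case
    by (auto intro!: continuous_at_imp_continuous_on differentiable_imp_continuous_within)
next
  case (Suc k)
  then show ?case
    using C_k.simps(2) by blast
qed

lemma C_k_const: "C_k k (\<lambda>x. c)"
  by (induction k arbitrary: c) (auto simp: dir_deriv_eq[OF has_derivative_const])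

lemma C_k_compose_linear: "bounded_linear T \<Longrightarrow> C_k k F \<Longrightarrow> C_k k (\<lambda>x. T (F x))"
proof (induction k arbitrary: F)
  case 0
  then show ?case
    by (simp add: bounded_linear.continuous_on)
next
  case (Suc k)
  have "((\<lambda>x. T (F x)) has_derivative (\<lambda>v. T (dir_deriv F x v))) (at x)" for x
    using Suc.prems by (simp add: bounded_linear.has_derivative has_derivative_dir_deriv)
  then show ?case
    by (rule C_k_SucI) (use Suc.prems in \<open>intro Suc.IH; simp\<close>)
qed

lemma C_k_linear: "bounded_linear T \<Longrightarrow> C_k k T"
proof (induction k)
  case 0
  then show ?case by (auto simp: linear_continuous_on)
next
  case (Suc k)
  show ?case
    by (rule C_k_SucI[OF bounded_linear_imp_has_derivative[OF Suc.prems]]) (rule C_k_const)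
qed

lemma C_k_add: "C_k k F \<Longrightarrow> C_k k G \<Longrightarrow> C_k k (\<lambda>x. F x + G x)"
proof (induction k arbitrary: F G)
  case 0
  then show ?case by (auto intro: continuous_intros)
next
  case (Suc k)
  have "((\<lambda>x. F x + G x) has_derivative (\<lambda>v. dir_deriv F x v + dir_deriv G x v)) (at x)" for x
    using Suc.prems by (auto intro!: has_derivative_add has_derivative_dir_deriv)
  then show ?case
    by (rule C_k_SucI) (use Suc.prems in \<open>intro Suc.IH; simp\<close>)
qed

lemma C_k_sum: "(\<And>i. i \<in> I \<Longrightarrow> C_k k (F i)) \<Longrightarrow> C_k k (\<lambda>x. \<Sum>i\<in>I. F i x)"
  by (induction I rule: infinite_finite_induct) (auto intro: C_k_const C_k_add)

lemma C_k_mult: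
  fixes F G :: "'a::euclidean_space \<Rightarrow> 'b::real_normed_algebra"
  shows "C_k k F \<Longrightarrow> C_k k G \<Longrightarrow> C_k k (\<lambda>x. F x * G x)"
proof (induction k arbitrary: F G)
  case 0
  then show ?case by (auto intro: continuous_intros)
next
  case (Suc k)
  have "((\<lambda>x. F x * G x) has_derivative (\<lambda>v. F x * dir_deriv G x v + dir_deriv F x v * G x)) (at x)" for x
    using Suc.prems by (auto intro!: has_derivative_mult has_derivative_dir_deriv)
  moreover have "C_k k (\<lambda>x. F x * dir_deriv G x v + dir_deriv F x v * G x)" for v
    using Suc.prems by (intro C_k_add Suc.IH C_k_Suc_D[of k F] C_k_Suc_D[of k G]) auto
  ultimately show ?case
    by (rule C_k_SucI)
qed

lemma C_k_prod:
  fixes F :: "'i \<Rightarrow> 'a::euclidean_space \<Rightarrow> 'b::real_normed_field"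
  shows "(\<And>i. i \<in> I \<Longrightarrow> C_k k (F i)) \<Longrightarrow> C_k k (\<lambda>x. \<Prod>i\<in>I. F i x)"
  by (induction I rule: infinite_finite_induct) (auto intro: C_k_const C_k_mult)

lemma smooth_differentiable: "smooth F \<Longrightarrow> F differentiable (at x)"
  using C_k.simps(2) smooth_def by blast

lemma smooth_dir_deriv: "smooth F \<Longrightarrow> smooth (\<lambda>x. dir_deriv F x v)"
  using C_k.simps(2) smooth_def by blast

lemma bounded_linear_entry: "bounded_linear (\<lambda>M::'b::euclidean_space^'n^'m. M $ i $ j)"
  by (intro bounded_linear_compose[OF bounded_linear_vec_nth] bounded_linear_vec_nth)

lemma bounded_linear_axis: "bounded_linear (axis m :: 'b::euclidean_space \<Rightarrow> 'b^'n)"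
  by (rule linear_conv_bounded_linear[THEN iffD1]) (auto intro!: linearI simp: vec_eq_iff axis_def)

lemma C_k_vec:
  fixes f :: "'a::euclidean_space \<Rightarrow> 'b::euclidean_space^'n"
  assumes "\<And>i. C_k k (\<lambda>x. f x $ i)"
  shows "C_k k f"
proof -
  have "f = (\<lambda>x. \<Sum>i\<in>UNIV. axis i (f x $ i))"
    by (auto simp: fun_eq_iff vec_eq_iff axis_def)
  moreover have "C_k k (\<lambda>x. \<Sum>i\<in>UNIV. axis i (f x $ i))"
    by (intro C_k_sum C_k_compose_linear[OF bounded_linear_axis] assms)
  ultimately show ?thesis
    by simp
qed

lemma smooth_entry:
  fixes M :: "'a::euclidean_space \<Rightarrow> 'b::euclidean_space^'n^'m"
  shows "smooth M \<Longrightarrow> smooth (\<lambda>x. M x $ i $ j)"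
  unfolding smooth_def by (auto intro: C_k_compose_linear[OF bounded_linear_entry])

section \<open>The Hermitian product\<close>

definition cdot :: "complex^'n \<Rightarrow> complex^'n \<Rightarrow> complex" where
  "cdot u v = (\<Sum>i\<in>UNIV. u $ i * cnj (v $ i))"

lemma cdot_add_left: "cdot (u + v) w = cdot u w + cdot v w"
  by (simp add: cdot_def ring_distribs sum.distrib)
lemma cdot_add_right: "cdot w (u + v) = cdot w u + cdot w v"
  by (simp add: cdot_def ring_distribs sum.distrib)
lemma cdot_diff_left: "cdot (u - v) w = cdot u w - cdot v w"
  by (simp add: cdot_def ring_distribs sum_subtractf)
lemma cdot_diff_right: "cdot w (u - v) = cdot w u - cdot w v"
  by (simp add: cdot_def ring_distribs sum_subtractf)
lemma cdot_smult_left: "cdot (k *s u) w = k * cdot u w"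
  by (simp add: cdot_def sum_distrib_left mult_ac)
lemma cdot_smult_right: "cdot w (k *s u) = cnj k * cdot w u"
  by (simp add: cdot_def sum_distrib_left mult_ac)
lemma cdot_zero [simp]: "cdot 0 w = 0" "cdot w 0 = 0"
  by (simp_all add: cdot_def)
lemmas cdot_simps = cdot_add_left cdot_add_right cdot_diff_left cdot_diff_right
  cdot_smult_left cdot_smult_right

lemma cdot_commute: "cdot v u = cnj (cdot u v)"
  by (simp add: cdot_def mult.commute)

lemma Re_cdot: "Re (cdot u v) = u \<bullet> v"
  by (simp add: cdot_def inner_vec_def inner_complex_def)

lemma cdot_self: "cdot u u = complex_of_real ((norm u)\<^sup>2)"
proof (rule complex_eqI)
  show "Re (cdot u u) = Re (complex_of_real ((norm u)\<^sup>2))"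
    by (simp add: Re_cdot power2_norm_eq_inner)
  show "Im (cdot u u) = Im (complex_of_real ((norm u)\<^sup>2))"
    by (simp add: cdot_def)
qed

lemma scaleR_conv_smult: "r *\<^sub>R (u :: complex^'n) = complex_of_real r *s u"
  by (simp add: vec_eq_iff scaleR_conv_of_real[where 'a=complex])

lemma norm_smult: "norm (c *s (v :: complex^'n)) = norm c * norm v"
  by (simp add: norm_vec_def norm_mult L2_set_right_distrib)

lemma bounded_bilinear_cdot: "bounded_bilinear (cdot :: complex^'n \<Rightarrow> complex^'n \<Rightarrow> complex)"
proof
  show "cdot (r *\<^sub>R a) b = r *\<^sub>R cdot a b" for r and a b :: "complex^'n"
    by (simp add: scaleR_conv_smult cdot_simps scaleR_conv_of_real)
  show "cdot a (r *\<^sub>R b) = r *\<^sub>R cdot a b" for r and a b :: "complex^'n"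
    by (simp add: scaleR_conv_smult cdot_simps scaleR_conv_of_real)
  have "norm (cdot a b) \<le> norm a * norm b * CARD('n)" for a b :: "complex^'n"
  proof -
    have "norm (cdot a b) \<le> (\<Sum>i\<in>(UNIV::'n set). norm a * norm b)"
      unfolding cdot_def
      by (intro order_trans[OF norm_sum] sum_mono)
        (auto simp: norm_mult intro!: mult_mono Finite_Cartesian_Product.norm_nth_le)
    then show ?thesis by (simp add: mult_ac)
  qed
  then show "\<exists>K. \<forall>a b. norm (cdot a b :: complex) \<le> norm (a::complex^'n) * norm b * K"
    by blast
qed (auto simp: cdot_simps)

lemma cdot_Cauchy_Schwarz: "cmod (cdot u v) \<le> norm u * norm v"
proof (cases "cdot u v = 0")
  case False
  \<comment> \<open>A unimodular factor that rotates \<open>cdot u v\<close> onto the positive real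
    axis, where the real Cauchy-Schwarz inequality applies.\<close>
  define k where "k = cnj (cdot u v) / cmod (cdot u v)"
  have "norm k = 1" using False by (simp add: k_def norm_divide)
  have "k * cdot u v = cmod (cdot u v)"
    using False by (simp add: k_def complex_norm_square[symmetric] mult.commute power2_eq_square)
  then have "cmod (cdot u v) = Re (cdot (k *s u) v)"
    by (simp add: cdot_simps)
  also have "\<dots> \<le> norm (k *s u) * norm v"
    by (simp add: Re_cdot norm_cauchy_schwarz)
  also have "norm (k *s u) = norm u"
    using \<open>norm k = 1\<close> by (simp add: norm_smult)
  finally show ?thesis .
qed auto

lemmas cdot_has_derivative [derivative_intros] = bounded_bilinear.FDERIV[OF bounded_bilinear_cdot]

lemma smult_has_derivative [derivative_intros]:
  assumes "(f has_derivative f') (at x within s)" "(g has_derivative g') (at x within s)"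
  shows "((\<lambda>x. f x *s (g x :: complex^'n)) has_derivative (\<lambda>h. f x *s g' h + f' h *s g x)) (at x within s)"
proof -
  have "bounded_bilinear (\<lambda>c (v::complex^'n). c *s v)"
  proof
    have "norm (c *s (v::complex^'n)) \<le> norm c * norm v * 1" for c v
      by (simp add: norm_smult)
    then show "\<exists>K. \<forall>a b. norm (a *s b :: complex^'n) \<le> norm a * norm b * K" by blast
  qed (simp_all add: vec_eq_iff algebra_simps)
  from bounded_bilinear.FDERIV[OF this assms] show ?thesis .
qed

section \<open>The profile function\<close>

text \<open>Laplace transform in \<open>t\<close> of the density \<open>s ^ j * (1 - s) ^ l\<close>
  on [0, 1]. Substituting t (1 - s) for the variable of the integral of s^(n-1) e^s from 0 to t
  gives t^n e^t times \<open>mom 0 (n - 1) t\<close>.\<close>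

definition mom :: "nat \<Rightarrow> nat \<Rightarrow> real \<Rightarrow> real" where
  "mom j l t = integral {0..1} (\<lambda>s. s ^ j * (1 - s) ^ l * exp (- (t * s)))"

lemma mom_integrable: "(\<lambda>s::real. s ^ j * (1 - s) ^ l * exp (- (t * s))) integrable_on {0..1}"
  by (intro integrable_continuous_real continuous_intros)

lemma integral_01_pos:
  fixes f :: "real \<Rightarrow> real"
  assumes "continuous_on {0..1} f" "\<And>s. s \<in> {0..1} \<Longrightarrow> f s \<ge> 0" "s \<in> {0..1}" "f s \<noteq> 0"
  shows "integral {0..1} f > 0"
proof -
  have int: "f integrable_on {0..1}"
    by (intro integrable_continuous_real assms)
  then have "integral {0..1} f \<ge> 0"
    by (intro integral_nonneg assms)
  moreover have "integral {0..1} f \<noteq> 0"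
    using has_integral_0_cbox_imp_0[of 0 1 f s] assms int by (auto simp: has_integral_iff)
  ultimately show ?thesis by simp
qed

lemma mom_pos: "mom j l t > 0"
  unfolding mom_def by (rule integral_01_pos[of _ "1/2"]) (auto intro!: continuous_intros)

text \<open>Insert \<open>1 = s + (1 - s)\<close> under the integral.\<close>

lemma mom_split: "mom j l t = mom (Suc j) l t + mom j (Suc l) t"
  unfolding mom_def
  by (subst integral_add[symmetric])
    (auto intro!: mom_integrable integral_cong simp del: power_Suc, auto simp: algebra_simps)

lemma mom_deriv: "(mom j l has_real_derivative - mom (Suc j) l t) (at t)"
proof -
  have "((\<lambda>t. integral (cbox 0 1) (\<lambda>s::real. s ^ j * (1 - s) ^ l * exp (- (t * s))))
      has_field_derivative integral (cbox 0 1) (\<lambda>s. - (s ^ Suc j * (1 - s) ^ l * exp (- (t * s)))))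
      (at t within UNIV)"
  proof (rule leibniz_rule_field_derivative)
    show "((\<lambda>x. t ^ j * (1 - t) ^ l * exp (- (x * t))) has_field_derivative
             - (t ^ Suc j * (1 - t) ^ l * exp (- (x * t)))) (at x within UNIV)" for x t :: real
      by (auto intro!: derivative_eq_intros)
    show "continuous_on (UNIV \<times> cbox 0 1)
      (\<lambda>(x::real, t::real). - (t ^ Suc j * (1 - t) ^ l * exp (- (x * t))))"
      by (auto intro!: continuous_intros simp: case_prod_beta)
  qed (auto intro!: integrable_continuous_real continuous_intros)
  then show ?thesis
    by (simp add: mom_def[abs_def])
qed

text \<open>Integration by parts, as the fundamental theorem of calculus for the integrand itself.
  The powers of 0 are its boundary values, present only for \<open>l = 0\<close> or
  \<open>j = 0\<close>; where \<open>j - 1\<close> or \<open>l - 1\<close> truncates, the factor in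
  front is 0.\<close>

lemma mom_parts:
  "t * mom j l t = 0 ^ j - 0 ^ l * exp (- t) + real j * mom (j - 1) l t - real l * mom j (l - 1) t"
proof -
  let ?F = "\<lambda>s::real. s ^ j * (1 - s) ^ l * exp (- (t * s))"
  let ?f = "\<lambda>s. real j * (s ^ (j - 1) * (1 - s) ^ l * exp (- (t * s)))
      - real l * (s ^ j * (1 - s) ^ (l - 1) * exp (- (t * s))) - t * ?F s"
  have "(?f has_integral ?F 1 - ?F 0) {0..1}"
  proof (rule fundamental_theorem_of_calculus)
    show "(?F has_vector_derivative ?f x) (at x within {0..1})" for x
      unfolding has_real_derivative_iff_has_vector_derivative[symmetric]
      by (auto intro!: derivative_eq_intros simp: algebra_simps)
  qed simp
  moreover have "(?f has_integral real j * mom (j - 1) l t - real l * mom j (l - 1) t - t * mom j l t) {0..1}"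
    unfolding mom_def by (intro has_integral_diff has_integral_mult_right integrable_integral mom_integrable)
  ultimately have "real j * mom (j - 1) l t - real l * mom j (l - 1) t - t * mom j l t = ?F 1 - ?F 0"
    by (rule has_integral_unique[rotated])
  then show ?thesis
    by (simp add: power_0_left)
qed

text \<open>Cauchy-Schwarz for the functions s and 1 - s with weight
  \<open>(1 - s) ^ l * exp (- (t * s))\<close>; it is strict since the two functions are linearly
  independent. The \<open>k\<close> in the proof minimises the square norm of
  \<open>k * s - (1 - s)\<close>.\<close>

lemma mom_Cauchy_Schwarz: "(mom 1 (Suc l) t)\<^sup>2 < mom 2 l t * mom 0 (Suc (Suc l)) t"
proof -
  define k where "k = mom 1 (Suc l) t / mom 2 l t"
  let ?g = "\<lambda>s. (k * s - (1 - s))\<^sup>2 * (1 - s) ^ l * exp (- (t * s))"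
  have "0 < integral {0..1} ?g"
  \<comment> \<open>The only zero of \<open>k * s - (1 - s)\<close> that could be hit at the point
    1/2 occurs for \<open>k = 1\<close>; then the point 1/4 serves.\<close>
  proof (cases "k = 1")
    case False
    then show ?thesis
      by (intro integral_01_pos[of _ "1/2"]) (auto intro!: continuous_intros)
  next
    case True
    then show ?thesis
      by (intro integral_01_pos[of _ "1/4"]) (auto intro!: continuous_intros)
  qed
  also have "integral {0..1} ?g = k\<^sup>2 * mom 2 l t - 2 * k * mom 1 (Suc l) t + mom 0 (Suc (Suc l)) t"
  proof (rule integral_unique)
    have "?g = (\<lambda>s. k\<^sup>2 * (s ^ 2 * (1 - s) ^ l * exp (- (t * s)))
        - 2 * k * (s ^ 1 * (1 - s) ^ Suc l * exp (- (t * s))) + s ^ 0 * (1 - s) ^ Suc (Suc l) * exp (- (t * s)))"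
      by (auto simp: fun_eq_iff power2_eq_square algebra_simps)
    then show "(?g has_integral k\<^sup>2 * mom 2 l t - 2 * k * mom 1 (Suc l) t + mom 0 (Suc (Suc l)) t) {0..1}"
      unfolding mom_def
      by (simp only:) (intro has_integral_diff has_integral_add has_integral_mult_right integrable_integral mom_integrable)
  qed
  also have "\<dots> = mom 0 (Suc (Suc l)) t - (mom 1 (Suc l) t)\<^sup>2 / mom 2 l t"
    using mom_pos[of 2 l t] by (simp add: k_def field_simps power2_eq_square)
  finally show ?thesis
    using mom_pos[of 2 l t] by (simp add: field_simps)
qed

section \<open>The implicitly defined profile t and its derivatives\<close>

text \<open>
  Here \<open>t\<^bsup>n\<^esup> e\<^bsup>t\<^esup> mom_quot n t = n \<integral>\<^sub>0\<^bsup>t\<^esup> s\<^bsup>n-1\<^esup> e\<^bsup>s\<^esup> ds\<close>.  The equation for \<open>t\<close> is solved in the form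
  \<open>t * prof_factor n t = x\<close>, its \<open>n\<close>-th root, which stays regular at \<open>t = 0\<close>.
\<close>

definition mom_quot :: "nat \<Rightarrow> real \<Rightarrow> real" where
  "mom_quot n t = real n * mom 0 (n - 1) t"

definition prof_factor :: "nat \<Rightarrow> real \<Rightarrow> real" where
  "prof_factor n t = exp ((t + ln (mom_quot n t)) / real n)"

definition prof :: "nat \<Rightarrow> real \<Rightarrow> real" where
  "prof n x = (THE t. t * prof_factor n t = x)"

text \<open>The function A = t / x, in a form that makes sense at x = 0.\<close>

definition prof_coeff :: "nat \<Rightarrow> real \<Rightarrow> real" where
  "prof_coeff n x = 1 / prof_factor n (prof n x)"

context
  fixes n :: nat
  assumes n: "0 < n"
begin

lemma mom_quot_pos: "mom_quot n t > 0"
  using n by (simp add: mom_quot_def mom_pos)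

lemma prof_factor_pos: "prof_factor n t > 0"
  by (simp add: prof_factor_def)

text \<open>For t = t(x), \<open>mom_quot n t\<close> will turn out to be B / A, the ratio of the
  radial to the tangential eigenvalue, so this evaluates 1 - B / A.\<close>

lemma mom_rec0: "t * mom 0 n t = 1 - mom_quot n t"
  using mom_parts[of t 0 n] n by (simp add: mom_quot_def power_0_left)

lemma mom_rec1: "t * mom 1 n t = mom 0 n t - real n * mom 1 (n - 1) t"
  using mom_parts[of t 1 n] n by (simp add: power_0_left)

lemma mom_rec2: "t * mom 2 n t = 2 * mom 1 n t - real n * mom 2 (n - 1) t"
  using mom_parts[of t 2 n] n by (simp add: power_0_left numeral_2_eq_2)

lemma mom_quot_split: "mom_quot n t = real n * mom 1 (n - 1) t + real n * mom 0 n t"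
  using mom_split[of 0 "n - 1" t] n by (simp add: mom_quot_def algebra_simps)

lemma mom_quot_deriv: "(mom_quot n has_real_derivative - (real n * mom 1 (n - 1) t)) (at t)"
  unfolding mom_quot_def[abs_def] by (auto intro!: derivative_eq_intros mom_deriv)

lemma prof_factor_pow: "prof_factor n t ^ n = exp t * mom_quot n t"
  using n mom_quot_pos[of t] by (simp add: prof_factor_def exp_of_nat_mult[symmetric] exp_add)

lemma prof_factor_deriv:
  "(prof_factor n has_real_derivative prof_factor n t * mom 0 n t / mom_quot n t) (at t)"
proof -
  have "(prof_factor n has_real_derivative
      prof_factor n t * ((1 + - (real n * mom 1 (n - 1) t) / mom_quot n t) / real n)) (at t)"
    unfolding prof_factor_def[abs_def] using mom_quot_pos[of t] n
    by (auto intro!: derivative_eq_intros mom_quot_deriv)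
  also have "(1 + - (real n * mom 1 (n - 1) t) / mom_quot n t) / real n = mom 0 n t / mom_quot n t"
    using n mom_quot_pos[of t] by (simp add: field_simps) (simp add: mom_quot_split algebra_simps)
  finally show ?thesis by simp
qed

text \<open>The product rule leaves \<open>mom_quot n t + t * mom 0 n t\<close> in the numerator,
  which is 1 by \<open>mom_rec0\<close>. The derivative is thus positive on the whole line, on both
  sides of 0.\<close>

lemma prof_inv_deriv:
  "((\<lambda>t. t * prof_factor n t) has_real_derivative prof_factor n t / mom_quot n t) (at t)"
proof -
  have "((\<lambda>t. t * prof_factor n t) has_real_derivative
      prof_factor n t + t * (prof_factor n t * mom 0 n t / mom_quot n t)) (at t)"
    by (auto intro!: derivative_eq_intros prof_factor_deriv)
  also have "prof_factor n t + t * (prof_factor n t * mom 0 n t / mom_quot n t)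
      = prof_factor n t * (mom_quot n t + t * mom 0 n t) / mom_quot n t"
    using mom_quot_pos[of t] by (simp add: field_simps)
  also have "\<dots> = prof_factor n t / mom_quot n t"
    by (simp add: mom_rec0)
  finally show ?thesis .
qed

lemma prof_factor_mono: "s \<le> t \<Longrightarrow> prof_factor n s \<le> prof_factor n t"
  by (rule DERIV_nonneg_imp_nondecreasing[where f = "prof_factor n"]) (assumption, intro exI conjI, rule prof_factor_deriv,
      simp add: less_imp_le prof_factor_pos mom_quot_pos mom_pos)

lemma mom_quot_antimono: "s \<le> t \<Longrightarrow> mom_quot n t \<le> mom_quot n s"
  by (rule DERIV_nonpos_imp_nonincreasing[where f = "mom_quot n"]) (assumption, intro exI conjI, rule mom_quot_deriv,
      simp add: less_imp_le mom_pos)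

lemma mom_quot_0: "mom_quot n 0 = 1"
  using mom_rec0[of 0] by simp

lemma prof_factor_0: "prof_factor n 0 = 1"
  by (simp add: prof_factor_def mom_quot_0)

lemma prof_inv_strict_mono: "s < t \<Longrightarrow> s * prof_factor n s < t * prof_factor n t"
  by (rule DERIV_pos_imp_increasing[where f = "\<lambda>t. t * prof_factor n t"]) (assumption, intro exI conjI, rule prof_inv_deriv,
      simp add: prof_factor_pos mom_quot_pos)

lemma prof_inv_inj: "s * prof_factor n s = t * prof_factor n t \<Longrightarrow> s = t"
  using prof_inv_strict_mono[of s t] prof_inv_strict_mono[of t s] by linarith

lemma prof_eqI: "t * prof_factor n t = x \<Longrightarrow> prof n x = t"
  unfolding prof_def by (rule the_equality) (auto intro: prof_inv_inj)

lemma prof_inv_cont: "isCont (\<lambda>t. t * prof_factor n t) t"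
  using prof_inv_deriv DERIV_isCont by blast

text \<open>The lower limit is the value of \<open>t * prof_factor n t\<close> at -1. Solvability a
  little to the left of 0 gives \<open>prof n\<close> a two-sided derivative at 0, the image of the
  origin under the squared norm.\<close>

lemma prof_eq:
  assumes "x > - prof_factor n (-1)"
  shows "prof n x * prof_factor n (prof n x) = x"
proof -
  have "\<exists>t\<ge>-1. t \<le> max 0 x \<and> t * prof_factor n t = x"
  proof (rule IVT)
    have "max 0 x * 1 \<le> max 0 x * prof_factor n (max 0 x)"
      using prof_factor_mono[of 0 "max 0 x"] prof_factor_0 by (intro mult_left_mono) auto
    then show "x \<le> max 0 x * prof_factor n (max 0 x)"
      by simp
    show "-1 * prof_factor n (-1) \<le> x"
      using assms by simp
    show "\<forall>t. -1 \<le> t \<and> t \<le> max 0 x \<longrightarrow> isCont (\<lambda>t. t * prof_factor n t) t"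
      using prof_inv_cont by blast
  qed simp
  then obtain t where t: "t * prof_factor n t = x"
    by auto
  show ?thesis
    unfolding prof_eqI[OF t] by (rule t)
qed

lemma prof_eq': "x \<ge> 0 \<Longrightarrow> prof n x * prof_factor n (prof n x) = x"
  using prof_eq[of x] prof_factor_pos[of "-1"] by simp

lemma prof_nonneg: "x \<ge> 0 \<Longrightarrow> prof n x \<ge> 0"
  using prof_inv_strict_mono[of "prof n x" 0] prof_eq'[of x] by fastforce

lemma prof_coeff_pos: "prof_coeff n x > 0"
  by (simp add: prof_coeff_def prof_factor_pos)

lemma prof_eq_coeff: "x \<ge> 0 \<Longrightarrow> prof n x = x * prof_coeff n x"
  using prof_eq'[of x] prof_factor_pos[of "prof n x"] by (simp add: prof_coeff_def field_simps)

text \<open>The inverse function rule; it identifies B as \<open>prof_coeff\<close> times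
  \<open>mom_quot\<close>.\<close>

lemma prof_deriv:
  assumes "x \<ge> 0"
  shows "(prof n has_real_derivative prof_coeff n x * mom_quot n (prof n x)) (at x)"
proof -
  have "(prof n has_real_derivative inverse (prof_factor n (prof n x) / mom_quot n (prof n x))) (at x)"
  proof (rule DERIV_inverse_function[where f = "\<lambda>t. t * prof_factor n t" and a = "- prof_factor n (-1)" and b = "x + 1"])
    show "((\<lambda>t. t * prof_factor n t) has_real_derivative prof_factor n (prof n x) / mom_quot n (prof n x)) (at (prof n x))"
      by (rule prof_inv_deriv)
    show "- prof_factor n (- 1) < x" using assms prof_factor_pos[of "-1"] by simp
    have "isCont (prof n) (prof n x * prof_factor n (prof n x))"
      by (rule isCont_inverse_function[where d = 1]) (auto intro: prof_eqI prof_inv_cont)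
    then show "isCont (prof n) x"
      using prof_eq'[OF assms] by simp
  qed (use prof_eq prof_factor_pos mom_quot_pos in \<open>auto simp: less_imp_neq[symmetric]\<close>)
  then show ?thesis
    by (simp add: prof_coeff_def)
qed

lemma prof_coeff_deriv:
  assumes "x \<ge> 0"
  shows "(prof_coeff n has_real_derivative - ((prof_coeff n x)\<^sup>2 * mom 0 n (prof n x))) (at x)"
proof -
  have "(prof_coeff n has_real_derivative - (prof_factor n (prof n x) * mom 0 n (prof n x) / mom_quot n (prof n x)
     * (prof_coeff n x * mom_quot n (prof n x))) / (prof_factor n (prof n x))\<^sup>2) (at x)"
    unfolding prof_coeff_def[abs_def]
    using prof_factor_pos
    by (auto intro!: derivative_eq_intros DERIV_chain2[OF prof_factor_deriv prof_deriv[OF assms]]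
      simp: prof_coeff_def less_imp_neq[symmetric] power2_eq_square)
  also have "- (prof_factor n (prof n x) * mom 0 n (prof n x) / mom_quot n (prof n x)
     * (prof_coeff n x * mom_quot n (prof n x))) / (prof_factor n (prof n x))\<^sup>2
     = - ((prof_coeff n x)\<^sup>2 * mom 0 n (prof n x))"
    using prof_factor_pos[of "prof n x"] mom_quot_pos[of "prof n x"]
    by (simp add: prof_coeff_def field_simps power2_eq_square)
  finally show ?thesis .
qed

text \<open>The soliton equation A^(n-1) B e^t = 1, with B = A times
  \<open>mom_quot\<close>.\<close>

lemma prof_volume: "x \<ge> 0 \<Longrightarrow> prof_coeff n x ^ n * mom_quot n (prof n x) = exp (- prof n x)"
  using prof_factor_pow[of "prof n x"] mom_quot_pos[of "prof n x"]
  by (simp add: prof_coeff_def power_divide exp_minus field_simps)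

text \<open>For large \<open>x\<close> this rests on \<open>t * y \<ge> n * (1 - y)\<close>, where \<open>t = prof n x\<close> and \<open>y = mom_quot n t\<close>.\<close>

lemma prof_deriv_lower_bound:
  obtains k where "k > 0" "\<And>x. x \<ge> 0 \<Longrightarrow> k / (1 + x) \<le> prof_coeff n x * mom_quot n (prof n x)"
proof
  define y1 where "y1 = mom_quot n 1"
  \<comment> \<open>The two entries are lower bounds of (1 + x) B in the ranges t <= 1 and t >
    1.\<close>
  define k where "k = min (y1 / prof_factor n 1) (real n * (1 - y1))"
  have y1: "0 < y1" "y1 < 1"
    using mom_quot_pos mom_rec0[of 1] mom_pos[of 0 n 1] by (auto simp: y1_def)
  then show "k > 0"
    using n prof_factor_pos[of 1] by (simp add: k_def)
  fix x :: real assume x: "x \<ge> 0"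
  define t where "t = prof n x"
  have t: "t \<ge> 0" using prof_nonneg[OF x] by (simp add: t_def)
  have A: "prof_coeff n x = 1 / prof_factor n t"
    by (simp add: prof_coeff_def t_def)
  have pos: "prof_coeff n x * mom_quot n t > 0"
    using prof_coeff_pos mom_quot_pos by simp
  have "k \<le> (1 + x) * (prof_coeff n x * mom_quot n t)"
  proof (cases "t \<le> 1")
    case True
    have "y1 / prof_factor n 1 \<le> mom_quot n t / prof_factor n t"
      using prof_factor_mono[OF True] mom_quot_antimono[OF True] y1 prof_factor_pos[of t]
      by (intro frac_le) (auto simp: y1_def)
    also have "\<dots> = 1 * (prof_coeff n x * mom_quot n t)"
      by (simp add: A)
    also have "\<dots> \<le> (1 + x) * (prof_coeff n x * mom_quot n t)"
      using x pos by (intro mult_right_mono) auto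
    finally show ?thesis by (simp add: k_def)
  next
    case False
    have "t * mom_quot n t = real n * t * mom 1 (n - 1) t + real n * (1 - mom_quot n t)"
      unfolding mom_rec0[of t, symmetric] by (subst mom_quot_split) (simp add: algebra_simps)
    then have "real n * (1 - mom_quot n t) \<le> t * mom_quot n t"
      using t mom_pos[of 1 "n - 1" t] by simp
    moreover have "real n * (1 - y1) \<le> real n * (1 - mom_quot n t)"
      using mom_quot_antimono[of 1 t] False by (intro mult_left_mono) (auto simp: y1_def)
    moreover have "t * mom_quot n t = x * (prof_coeff n x * mom_quot n t)"
      using prof_eq_coeff[OF x] by (simp add: t_def)
    moreover have "x * (prof_coeff n x * mom_quot n t) \<le> (1 + x) * (prof_coeff n x * mom_quot n t)"
      using pos by (intro mult_right_mono) auto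
    ultimately show ?thesis
      by (simp add: k_def)
  qed
  then show "k / (1 + x) \<le> prof_coeff n x * mom_quot n (prof n x)"
    using x by (simp add: field_simps t_def)
qed

text \<open>By parts, the expression is the boundary term \<open>exp (- t)\<close> if n = 1 and n (n
  - 1) \<open>mom 2 (n - 2) t\<close> otherwise. Up to a positive factor it is the curvature
  numerator of the complex line through z.\<close>

lemma mom_second_pos: "0 < 2 * real n * mom 1 (n - 1) t - t * real n * mom 2 (n - 1) t"
proof (cases "n = 1")
  case True
  then show ?thesis
    using mom_parts[of t 2 0] by (simp add: power_0_left numeral_2_eq_2)
next
  case False
  have "t * mom 2 (n - 1) t = 2 * mom 1 (n - 1) t - real (n - 1) * mom 2 (n - 1 - 1) t"
    using mom_parts[of t 2 "n - 1"] n False by (simp add: power_0_left numeral_2_eq_2)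
  then have "2 * real n * mom 1 (n - 1) t - t * real n * mom 2 (n - 1) t = real n * (real (n - 1) * mom 2 (n - 1 - 1) t)"
    by algebra
  then show ?thesis
    using n False mom_pos[of 2 "n - 1 - 1" t] by simp
qed

text \<open>After the same integration by parts this is \<open>mom_Cauchy_Schwarz\<close> with l = n
  - 2, together with n^2 <= 2 n (n - 1), which holds from n = 2 on.\<close>

lemma mom_discriminant:
  assumes "n \<noteq> 1"
  shows "(real n * mom 1 (n - 1) t)\<^sup>2 < 2 * (2 * real n * mom 1 (n - 1) t - t * real n * mom 2 (n - 1) t) * mom 0 n t"
proof -
  obtain m where m: "n = Suc (Suc m)"
    using n assms by (cases n; cases "n - 1") auto
  have "t * mom 2 (Suc m) t = 2 * mom 1 (Suc m) t - real (Suc m) * mom 2 m t"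
    using mom_parts[of t 2 "Suc m"] by (simp add: power_0_left numeral_2_eq_2)
  then have eq: "2 * real n * mom 1 (n - 1) t - t * real n * mom 2 (n - 1) t = real n * (real (Suc m) * mom 2 m t)"
    unfolding m diff_Suc_1 by algebra
  have "(real n * mom 1 (n - 1) t)\<^sup>2 < real n * real n * (mom 2 m t * mom 0 n t)"
    using mult_strict_left_mono[OF mom_Cauchy_Schwarz[of m t], of "real n * real n"] n
    by (simp add: m power2_eq_square mult_ac)
  also have "\<dots> \<le> real n * (2 * real (Suc m)) * (mom 2 m t * mom 0 n t)"
    using mom_pos[of 2 m t] mom_pos[of 0 n t]
    by (intro mult_right_mono mult_left_mono) (auto simp: m)
  finally show ?thesis
    unfolding eq by (simp add: algebra_simps)
qed

end

section \<open>Curvature of radial metrics\<close>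

text \<open>Eigenvalue \<open>a\<close> on the orthogonal complement of z and
  \<open>a + |z|^2 * b\<close> on its span. The profiles are independent arguments: for existence
  \<open>b\<close> is the derivative of \<open>a\<close>, for uniqueness both are constants
  belonging to one sphere.\<close>

definition radial_herm :: "(real \<Rightarrow> real) \<Rightarrow> (real \<Rightarrow> real) \<Rightarrow> 'n::finite herm_field" where
  "radial_herm a b z = (\<chi> i j. (if i = j then of_real (a ((norm z)\<^sup>2)) else 0)
     + of_real (b ((norm z)\<^sup>2)) * cnj (z $ i) * z $ j)"

lemma riem_of_radial: "riem_of (radial_herm a b) z u v
   = Re (of_real (a ((norm z)\<^sup>2)) * cdot u v + of_real (b ((norm z)\<^sup>2)) * cdot u z * cdot z v)"
proof -
  have "(\<Sum>i\<in>UNIV. \<Sum>j\<in>UNIV. radial_herm a b z $ i $ j * u $ i * cnj (v $ j))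
     = (\<Sum>i\<in>UNIV. \<Sum>j\<in>UNIV. (if i = j then of_real (a ((norm z)\<^sup>2)) * u $ i * cnj (v $ j) else 0))
     + (\<Sum>i\<in>UNIV. \<Sum>j\<in>UNIV. of_real (b ((norm z)\<^sup>2)) * ((u $ i * cnj (z $ i)) * (z $ j * cnj (v $ j))))"
    unfolding sum.distrib[symmetric]
    by (intro sum.cong) (auto simp: radial_herm_def algebra_simps)
  also have "\<dots> = of_real (a ((norm z)\<^sup>2)) * cdot u v + of_real (b ((norm z)\<^sup>2)) * (cdot u z * cdot z v)"
    unfolding cdot_def sum_product by (simp add: sum_distrib_left mult.assoc)
  finally show ?thesis
    by (simp add: riem_of_def mult.assoc)
qed

lemma radial_fun_has_derivative:
  fixes z :: "'a::real_inner"
  assumes "(f has_real_derivative D) (at ((norm z)\<^sup>2))"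
  shows "((\<lambda>p. f ((norm p)\<^sup>2)) has_derivative (\<lambda>u. 2 * (z \<bullet> u) * D)) (at z)"
proof -
  have "((\<lambda>p. (norm p)\<^sup>2) has_derivative (\<lambda>u. 2 * (z \<bullet> u))) (at z)"
    unfolding power2_norm_eq_inner by (auto intro!: derivative_eq_intros simp: inner_commute)
  from has_derivative_compose[OF this, of f "\<lambda>h. h * D"] assms
  show ?thesis
    by (simp add: has_field_derivative_def mult_commute_abs)
qed

text \<open>Here \<open>p\<close> is the logarithmic derivative of \<open>a\<close>, so that
  \<open>a * p\<close> is A', and \<open>1 + x * p x\<close> is B / A. \<open>q\<close> is the
  purely radial coefficient of the Christoffel symbols; \<open>p'_eq\<close> is q = (p' - p^2) / (1
  + x p) with the denominator cleared, which is what the Koszul formula demands.\<close>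

locale radial_metric =
  fixes a p q p' q' :: "real \<Rightarrow> real"
  assumes a_deriv: "x \<ge> 0 \<Longrightarrow> (a has_real_derivative a x * p x) (at x)"
    and p_deriv: "x \<ge> 0 \<Longrightarrow> (p has_real_derivative p' x) (at x)"
    and q_deriv: "x \<ge> 0 \<Longrightarrow> (q has_real_derivative q' x) (at x)"
    and p'_eq: "x \<ge> 0 \<Longrightarrow> p' x = q x + (p x)\<^sup>2 + x * p x * q x"
    and a_pos: "x \<ge> 0 \<Longrightarrow> a x > 0"
    and p_bound: "x \<ge> 0 \<Longrightarrow> 1 + x * p x > 0"
begin

definition g :: "'n::finite herm_field" where
  "g = radial_herm a (\<lambda>x. a x * p x)"

definition chris :: "complex^'n \<Rightarrow> complex^'n \<Rightarrow> complex^'n \<Rightarrow> complex^'n::finite" where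
  "chris z u v = complex_of_real (p ((norm z)\<^sup>2)) *s (cdot u z *s v + cdot v z *s u)
     + (complex_of_real (q ((norm z)\<^sup>2)) * (cdot u z * cdot v z)) *s z"

lemma riem_of_g: "riem_of g z u v = a ((norm z)\<^sup>2) * Re (cdot u v + of_real (p ((norm z)\<^sup>2)) * (cdot u z * cdot z v))"
  by (simp add: g_def riem_of_radial algebra_simps)

text \<open>Only negative \<open>p\<close> needs an argument: then Cauchy-Schwarz bounds the form
  below by its radial eigenvalue, and \<open>p_bound\<close> applies.\<close>

lemma riem_of_g_pos:
  assumes "v \<noteq> 0"
  shows "riem_of g z v v > 0"
proof -
  let ?x = "(norm z)\<^sup>2"
  have "cdot v z * cdot z v = of_real ((cmod (cdot v z))\<^sup>2)"
    by (simp only: cdot_commute[of v z] complex_norm_square) simp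
  then have eq: "riem_of g z v v = a ?x * ((norm v)\<^sup>2 + p ?x * (cmod (cdot v z))\<^sup>2)"
    by (simp add: riem_of_g cdot_self)
  have "(cmod (cdot v z))\<^sup>2 \<le> (norm v)\<^sup>2 * ?x"
    using power_mono[OF cdot_Cauchy_Schwarz[of v z], of 2] by (simp add: power_mult_distrib)
  moreover have "(norm v)\<^sup>2 > 0"
    using assms by simp
  moreover have "(norm v)\<^sup>2 * (1 + ?x * p ?x) > 0"
    using p_bound[of ?x] assms by simp
  ultimately have "(norm v)\<^sup>2 + p ?x * (cmod (cdot v z))\<^sup>2 > 0"
  proof (cases "p ?x \<ge> 0")
    case True
    then show ?thesis using assms by (intro add_pos_nonneg) auto
  next
    case False
    then have "p ?x * ((norm v)\<^sup>2 * ?x) \<le> p ?x * (cmod (cdot v z))\<^sup>2"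
      using \<open>(cmod (cdot v z))\<^sup>2 \<le> (norm v)\<^sup>2 * ?x\<close> by (intro mult_left_mono_neg) auto
    then show ?thesis
      using \<open>(norm v)\<^sup>2 * (1 + ?x * p ?x) > 0\<close> by (simp add: algebra_simps)
  qed
  then show ?thesis
    using a_pos[of ?x] by (simp add: eq)
qed

lemma riem_of_g_bilinear:
  "riem_of g z (u + v) w = riem_of g z u w + riem_of g z v w"
  "riem_of g z (u - v) w = riem_of g z u w - riem_of g z v w"
  "riem_of g z (r *\<^sub>R u) w = r * riem_of g z u w"
  "riem_of g z w (u + v) = riem_of g z w u + riem_of g z w v"
  "riem_of g z w (u - v) = riem_of g z w u - riem_of g z w v"
  "riem_of g z w (r *\<^sub>R u) = r * riem_of g z w u"
  by (simp_all add: riem_of_g cdot_simps scaleR_conv_smult algebra_simps)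

lemma riem_of_g_sym: "riem_of g z u v = riem_of g z v u"
proof -
  have "Re (cdot u v) = Re (cdot v u)" "Re (cdot u z * cdot z v) = Re (cdot v z * cdot z u)"
    by (simp_all add: cdot_commute[of u v] cdot_commute[of z v] cdot_commute[of z u])
  then show ?thesis
    by (simp add: riem_of_g)
qed

lemma riem_of_g_deriv:
  "((\<lambda>z. riem_of g z v w) has_derivative (\<lambda>u.
     a ((norm z)\<^sup>2) * Re (of_real (2 * Re (cdot u z)) * (of_real (p ((norm z)\<^sup>2)) * cdot v w
       + of_real ((p ((norm z)\<^sup>2))\<^sup>2 + p' ((norm z)\<^sup>2)) * (cdot v z * cdot z w))
       + of_real (p ((norm z)\<^sup>2)) * (cdot v u * cdot z w + cdot v z * cdot u w)))) (at z)"
  unfolding riem_of_g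
  by (rule has_derivative_eq_rhs, (rule derivative_intros radial_fun_has_derivative[OF a_deriv]
      radial_fun_has_derivative[OF p_deriv] zero_le_power2)+)
    (simp add: fun_eq_iff Re_cdot[symmetric] algebra_simps power2_eq_square cdot_commute[of z])

text \<open>Once \<open>p'\<close> is eliminated by \<open>p'_eq\<close>, the Koszul identity for
  \<open>chris\<close> is a polynomial identity in Hermitian products. Definiteness of the metric
  makes the solution unique, as the definite description requires.\<close>

lemma levi_civita_g: "levi_civita (riem_of g) z u v = chris z u v"
proof -
  let ?x = "(norm z)\<^sup>2"
  have koszul: "2 * riem_of g z (chris z u v) w =
        dir_deriv (\<lambda>p. riem_of g p v w) z u + dir_deriv (\<lambda>p. riem_of g p u w) z v
        - dir_deriv (\<lambda>p. riem_of g p u v) z w" for w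
  proof -
    have cs: "cdot z z = of_real ?x" "cdot z w = cnj (cdot w z)" "cdot z u = cnj (cdot u z)"
       "cdot z v = cnj (cdot v z)" "cdot w u = cnj (cdot u w)" "cdot w v = cnj (cdot v w)" "cdot v u = cnj (cdot u v)"
      by (rule cdot_self cdot_commute)+
    show ?thesis
      unfolding dir_deriv_eq[OF riem_of_g_deriv]
      unfolding riem_of_g chris_def p'_eq[of ?x, simplified]
      by (simp only: cdot_simps cs) (simp add: algebra_simps power2_eq_square)
  qed
  show ?thesis
    unfolding levi_civita_def
  proof (rule the_equality)
    show "\<forall>w. 2 * riem_of g z (chris z u v) w =
        dir_deriv (\<lambda>p. riem_of g p v w) z u + dir_deriv (\<lambda>p. riem_of g p u w) z v
        - dir_deriv (\<lambda>p. riem_of g p u v) z w"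
      using koszul by blast
    fix y assume y: "\<forall>w. 2 * riem_of g z y w =
        dir_deriv (\<lambda>p. riem_of g p v w) z u + dir_deriv (\<lambda>p. riem_of g p u w) z v
        - dir_deriv (\<lambda>p. riem_of g p u v) z w"
    have "riem_of g z (y - chris z u v) (y - chris z u v) = 0"
      using y[rule_format, of "y - chris z u v"] koszul[of "y - chris z u v"] by (simp add: riem_of_g_bilinear)
    then show "y = chris z u v"
      using riem_of_g_pos[of "y - chris z u v" z] by fastforce
  qed
qed

lemma chris_deriv:
  "((\<lambda>z. chris z v w) has_derivative (\<lambda>u.
     complex_of_real (2 * Re (cdot u z) * p' ((norm z)\<^sup>2)) *s (cdot v z *s w + cdot w z *s v)
     + complex_of_real (p ((norm z)\<^sup>2)) *s (cdot v u *s w + cdot w u *s v)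
     + (complex_of_real (2 * Re (cdot u z) * q' ((norm z)\<^sup>2)) * (cdot v z * cdot w z)) *s z
     + (complex_of_real (q ((norm z)\<^sup>2)) * (cdot v u * cdot w z + cdot v z * cdot w u)) *s z
     + (complex_of_real (q ((norm z)\<^sup>2)) * (cdot v z * cdot w z)) *s u)) (at z)"
  unfolding chris_def
  by (rule has_derivative_eq_rhs, (rule derivative_intros radial_fun_has_derivative[OF q_deriv]
      radial_fun_has_derivative[OF p_deriv] zero_le_power2)+)
    (simp add: fun_eq_iff Re_cdot[symmetric] cdot_commute[of z] vec_eq_iff algebra_simps)

text \<open>The coefficients of the curvature tensor with respect to the invariant tensors built from
  \<open>cdot\<close> and the radial covector.\<close>

definition "k0 x = - (a x * p x)"
definition "k1 x = - (a x * p' x)"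
definition "k2 x = - (a x * (q' x + 2 * p x * p' x + x * p x * q' x))"

text \<open>A direct expansion: every Hermitian product of u, v, z becomes a letter,
  \<open>p'\<close> is eliminated, and polynomials in real and imaginary parts are compared.\<close>

lemma curvature_numerator:
  fixes u v z :: "complex^'n::finite"
  defines "x \<equiv> (norm z)\<^sup>2" and "\<alpha> \<equiv> cdot u z" and "\<beta> \<equiv> cdot v z" and "\<gamma> \<equiv> cdot v u"
  shows "riem_of g z (riemann_curv (riem_of g) z u v v) u =
     k0 x * ((norm u)\<^sup>2 * (norm v)\<^sup>2 + (cmod \<gamma>)\<^sup>2 - 2 * Re (\<gamma>\<^sup>2))
     + k1 x * ((cmod \<alpha>)\<^sup>2 * (norm v)\<^sup>2 + (cmod \<beta>)\<^sup>2 * (norm u)\<^sup>2 + 2 * Re (\<alpha> * cnj \<beta> * \<gamma>) - 4 * Re (\<beta> * cnj \<alpha> * \<gamma>))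
     + k2 x * ((cmod \<alpha>)\<^sup>2 * (cmod \<beta>)\<^sup>2 - Re ((\<beta> * cnj \<alpha>)\<^sup>2))"
proof -
  have cs: "cdot z z = of_real x" "cdot u u = of_real ((norm u)\<^sup>2)" "cdot v v = of_real ((norm v)\<^sup>2)"
    "cdot u z = \<alpha>" "cdot v z = \<beta>" "cdot v u = \<gamma>" "cdot z u = cnj \<alpha>" "cdot z v = cnj \<beta>" "cdot u v = cnj \<gamma>"
    unfolding assms by (simp_all only: cdot_self cdot_commute[of u z] cdot_commute[of v z] cdot_commute[of v u] complex_cnj_cnj)
  have p': "p' x = q x + (p x)\<^sup>2 + x * p x * q x"
    by (simp add: p'_eq x_def)
  show ?thesis
    unfolding riemann_curv_def levi_civita_g dir_deriv_eq[OF chris_deriv]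
    unfolding riem_of_g chris_def x_def[symmetric]
    apply (simp only: cdot_simps cs)
    apply (simp only: k0_def k1_def k2_def p' cmod_power2)
    apply (simp add: power2_eq_square)
    apply (simp add: algebra_simps)
    done
qed

end

lemma quadratic_form_pos:
  fixes a b c X Y :: real
  assumes "a > 0" "c > 0" "b\<^sup>2 < a * c" "X \<noteq> 0 \<or> Y \<noteq> 0"
  shows "a * X\<^sup>2 + 2 * b * X * Y + c * Y\<^sup>2 > 0"
proof -
  have "a * (a * X\<^sup>2 + 2 * b * X * Y + c * Y\<^sup>2) = (a * X + b * Y)\<^sup>2 + (a * c - b\<^sup>2) * Y\<^sup>2"
    by (simp add: power2_eq_square algebra_simps)
  also have "\<dots> > 0"
  proof (cases "Y = 0")
    case True
    then show ?thesis using assms by simp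
  next
    case False
    then show ?thesis using assms by (intro add_nonneg_pos) auto
  qed
  finally show ?thesis
    using assms by (simp add: zero_less_mult_iff)
qed

context radial_metric
begin

text \<open>
  Write \<open>u = u' + s z\<close> and \<open>v = v' + t z\<close> with \<open>u', v'\<close> orthogonal to \<open>z\<close>.  In terms of \<open>\<eta> = cdot v' u'\<close> and
  \<open>\<theta> = t * cnj s\<close>, the numerator is a Gram determinant of \<open>u', v'\<close> plus a square norm plus a quadratic form
  in \<open>Im \<eta>\<close> and \<open>x * Im \<theta>\<close>, whose discriminant is the one assumed to be negative.
\<close>

lemma curvature_numerator_pos:
  fixes u v z :: "complex^'n::finite"
  defines "x \<equiv> (norm z)\<^sup>2"
  assumes c: "k0 x > 0" and b: "k0 x + x * k1 x > 0" and a: "2 * k0 x + 4 * x * k1 x + x\<^sup>2 * k2 x > 0"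
    and disc: "CARD('n) = 1 \<or> (k0 x + x * k1 x)\<^sup>2 < 2 * (2 * k0 x + 4 * x * k1 x + x\<^sup>2 * k2 x) * k0 x"
    and v: "v \<noteq> 0" and indep: "\<And>l::real. u \<noteq> l *\<^sub>R v"
  shows "riem_of g z (riemann_curv (riem_of g) z u v v) u > 0"
proof -
  define s t where "s = (if z = 0 then 0 else cdot u z / of_real x)"
    and "t = (if z = 0 then 0 else cdot v z / of_real x)"
  define u' v' where "u' = u - s *s z" and "v' = v - t *s z"
  define \<eta> \<theta> where "\<eta> = cdot v' u'" and "\<theta> = t * cnj s"
  define b where "b = k0 x + x * k1 x"
  define a where "a = 2 * k0 x + 4 * x * k1 x + x\<^sup>2 * k2 x"
  \<comment> \<open>The square norm of \<open>w\<close> collects the terms that mix the radial and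
    orthogonal parts. If \<open>t\<close> is nonzero and \<open>Im \<theta> = 0\<close>, then
    \<open>w = 0\<close> would make u a real multiple of v.\<close>
  define w where "w = cnj t *s u' - cnj s *s v'"
  have zz: "cdot z z = of_real x"
    by (simp add: cdot_self x_def)
  have x0: "x \<ge> 0" and xz: "z \<noteq> 0 \<Longrightarrow> x > 0"
    by (auto simp: x_def)
  have perp: "cdot u' z = 0" "cdot v' z = 0"
    using xz by (auto simp: u'_def v'_def s_def t_def cdot_simps zz)
  have perp': "cdot z u' = 0" "cdot z v' = 0"
    using perp cdot_commute[of z] by auto
  have uv: "u = u' + s *s z" "v = v' + t *s z"
    by (simp_all add: u'_def v'_def)
  have norms: "cdot u' u' = of_real ((norm u')\<^sup>2)" "cdot v' v' = of_real ((norm v')\<^sup>2)" "cdot v' u' = \<eta>" "cdot u' v' = cnj \<eta>"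
    by (simp_all only: cdot_self \<eta>_def cdot_commute[of u' v'])
  have al: "cdot u z = of_real x * s" "cdot v z = of_real x * t" and ga: "cdot v u = \<eta> + of_real x * \<theta>"
    unfolding uv by (simp_all add: cdot_simps perp perp' zz \<theta>_def norms)
  have "complex_of_real ((norm u)\<^sup>2) = of_real ((norm u')\<^sup>2 + x * (cmod s)\<^sup>2)"
    unfolding cdot_self[symmetric] unfolding uv
    by (simp add: cdot_simps perp perp' zz norms complex_norm_square mult_ac del: of_real_power)
  then have nu: "(norm u)\<^sup>2 = (norm u')\<^sup>2 + x * (cmod s)\<^sup>2"
    by (simp only: of_real_eq_iff)
  have "complex_of_real ((norm v)\<^sup>2) = of_real ((norm v')\<^sup>2 + x * (cmod t)\<^sup>2)"
    unfolding cdot_self[symmetric] unfolding uv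
    by (simp add: cdot_simps perp perp' zz norms complex_norm_square mult_ac del: of_real_power)
  then have nv: "(norm v)\<^sup>2 = (norm v')\<^sup>2 + x * (cmod t)\<^sup>2"
    by (simp only: of_real_eq_iff)
  have "complex_of_real ((norm w)\<^sup>2)
     = of_real ((cmod t)\<^sup>2 * (norm u')\<^sup>2 + (cmod s)\<^sup>2 * (norm v')\<^sup>2 - 2 * Re (\<theta> * \<eta>))"
    unfolding cdot_self[symmetric] unfolding w_def cdot_simps norms \<theta>_def cmod_power2
    by (rule complex_eqI) (simp_all add: power2_eq_square algebra_simps)
  then have nw: "(norm w)\<^sup>2 = (cmod t)\<^sup>2 * (norm u')\<^sup>2 + (cmod s)\<^sup>2 * (norm v')\<^sup>2 - 2 * Re (\<theta> * \<eta>)"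
    by (simp only: of_real_eq_iff)
  define T1 T2 T3 where "T1 = k0 x * ((norm u')\<^sup>2 * (norm v')\<^sup>2 - (cmod \<eta>)\<^sup>2)"
    and "T2 = x * b * (norm w)\<^sup>2"
    and "T3 = 4 * k0 x * (Im \<eta>)\<^sup>2 + 2 * (2 * b) * Im \<eta> * (x * Im \<theta>) + 2 * a * (x * Im \<theta>)\<^sup>2"
  have N: "riem_of g z (riemann_curv (riem_of g) z u v v) u = T1 + T2 + T3"
    unfolding curvature_numerator T1_def T2_def T3_def x_def[symmetric] nu nv nw al ga a_def b_def
    unfolding \<theta>_def cmod_power2
    by (simp add: power2_eq_square) (simp add: algebra_simps)
  have "(cmod \<eta>)\<^sup>2 \<le> (norm u')\<^sup>2 * (norm v')\<^sup>2"
    using power_mono[OF cdot_Cauchy_Schwarz[of v' u'], of 2] by (simp add: \<eta>_def power_mult_distrib mult.commute)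
  then have T1: "T1 \<ge> 0"
    using c by (simp add: T1_def)
  have T2: "T2 \<ge> 0"
    using b x0 by (simp add: T2_def b_def)
  have T1': "T1 > 0" if "s = 0" "t = 0" "Im \<eta> = 0"
  proof -
    have uv': "u = u'" "v = v'" using that uv by auto
    have e: "\<eta> = of_real (Re \<eta>)" using that by (simp add: complex_eq_iff)
    define l where "l = Re \<eta> / (norm v)\<^sup>2"
    have nv0: "(norm v)\<^sup>2 > 0" using v by simp
    have "0 < (norm (u - l *\<^sub>R v))\<^sup>2" using indep[of l] by simp
    also have "(norm (u - l *\<^sub>R v))\<^sup>2 = (norm u)\<^sup>2 - 2 * l * Re \<eta> + l\<^sup>2 * (norm v)\<^sup>2"
      unfolding power2_norm_eq_inner
      by (simp add: \<eta>_def uv'[symmetric] Re_cdot inner_diff inner_commute power2_eq_square algebra_simps)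
    also have "\<dots> = (norm u)\<^sup>2 - (Re \<eta>)\<^sup>2 / (norm v)\<^sup>2"
      using nv0 by (simp add: l_def field_simps power2_eq_square)
    finally have "(Re \<eta>)\<^sup>2 < (norm u)\<^sup>2 * (norm v)\<^sup>2"
      using nv0 by (simp add: field_simps)
    moreover have "(cmod \<eta>)\<^sup>2 = (Re \<eta>)\<^sup>2"
      using that by (simp add: cmod_power2)
    ultimately show ?thesis
      using c by (simp add: T1_def uv')
  qed
  have par: "s = of_real (Re (s * cnj t) / (cmod t)\<^sup>2) * t" if "Im \<theta> = 0" "t \<noteq> 0"
  proof -
    have "s * cnj t = of_real (Re (s * cnj t))"
      using that by (simp add: \<theta>_def complex_eq_iff mult.commute)
    then have "s * (t * cnj t) = of_real (Re (s * cnj t)) * t"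
      by (metis mult.assoc mult.commute)
    moreover have "t * cnj t = of_real ((cmod t)\<^sup>2)"
      by (simp only: complex_norm_square)
    ultimately show ?thesis
      using that by (simp add: field_simps del: of_real_power)
  qed
  \<comment> \<open>With no radial parts, either \<open>Im \<eta>\<close> is nonzero or the Gram
    determinant is positive. In dimension one the orthogonal parts vanish, and independence forces
    \<open>Im \<theta>\<close> to be nonzero. Otherwise the discriminant makes \<open>T3\<close>
    definite, and where \<open>T3\<close> vanishes \<open>w\<close> does not.\<close>
  consider "s = 0 \<and> t = 0" | "s \<noteq> 0 \<or> t \<noteq> 0" "CARD('n) = 1"
    | "s \<noteq> 0 \<or> t \<noteq> 0" "b\<^sup>2 < 2 * a * k0 x"
    using disc by (auto simp: a_def b_def)
  then show ?thesis
  proof cases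
    case 1
    show ?thesis
    proof (cases "Im \<eta> = 0")
      case True
      then have "T3 = 0" using 1 by (simp add: T3_def \<theta>_def)
      then show ?thesis using T1' T2 1 True by (simp add: N)
    next
      case False
      then have "T3 > 0" using 1 c by (simp add: T3_def \<theta>_def)
      then show ?thesis using T1 T2 by (simp add: N)
    qed
  next
    case 2
    then have z: "z \<noteq> 0" by (auto simp: s_def t_def)
    obtain m :: 'n where m: "UNIV = {m}"
      using 2 card_1_singletonE by blast
    have "z $ m \<noteq> 0"
      using z m by (metis UNIV_I singletonD vec_eq_iff zero_index)
    then have "u' $ m = 0" "v' $ m = 0"
      using perp by (auto simp: cdot_def m)
    then have uv0: "u' = 0" "v' = 0"
      using m by (metis UNIV_I singletonD vec_eq_iff zero_index)+
    have "Im \<theta> \<noteq> 0"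
    proof
      assume im: "Im \<theta> = 0"
      have "t \<noteq> 0" using v uv uv0 by auto
      then have "u = (Re (s * cnj t) / (cmod t)\<^sup>2) *\<^sub>R v"
        using par[OF im] uv uv0 by (metis add_0 scaleR_conv_smult vector_smult_assoc)
      then show False using indep by blast
    qed
    then have "T3 > 0"
      using a xz[OF z] uv0 by (simp add: T3_def \<eta>_def a_def)
    then show ?thesis using T1 T2 by (simp add: N)
  next
    case 3
    then have z: "z \<noteq> 0" by (auto simp: s_def t_def)
    show ?thesis
    proof (cases "Im \<eta> = 0 \<and> Im \<theta> = 0")
      case False
      have "T3 > 0"
        unfolding T3_def
        by (rule quadratic_form_pos) (use a[folded a_def] c 3 False xz[OF z] in \<open>auto simp: power2_eq_square\<close>)
      then show ?thesis using T1 T2 by (simp add: N)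
    next
      case True
      have "w \<noteq> 0"
      proof
        assume w: "w = 0"
        show False
        proof (cases "t = 0")
          case t: True
          then have "v' = 0"
            using w 3 by (auto simp: w_def vec_eq_iff)
          then show False using v uv t by auto
        next
          case t: False
          define l where "l = Re (s * cnj t) / (cmod t)\<^sup>2"
          have s: "s = of_real l * t" using par[OF _ t] True by (simp add: l_def)
          have "cnj t *s (u' - of_real l *s v') = w"
            by (simp add: w_def s vec_eq_iff algebra_simps)
          then have "u' = of_real l *s v'"
            using t w by (auto simp: vec_eq_iff)
          then have "u = l *\<^sub>R v"
            unfolding uv s scaleR_conv_smult by (simp add: vec_eq_iff algebra_simps)
          then show False using indep by blast
        qed
      qed
      then have "T2 > 0"
        using xz[OF z] b by (simp add: T2_def b_def)
      moreover have "T3 = 0" using True by (simp add: T3_def)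
      ultimately show ?thesis using T1 by (simp add: N)
    qed
  qed
qed

lemma riem_of_g_Cauchy_Schwarz:
  assumes "v \<noteq> 0" "\<And>l::real. u \<noteq> l *\<^sub>R v"
  shows "riem_of g z u u * riem_of g z v v - (riem_of g z u v)\<^sup>2 > 0"
proof -
  define l where "l = riem_of g z u v / riem_of g z v v"
  have v: "riem_of g z v v > 0" using assms riem_of_g_pos by blast
  have "0 < riem_of g z (u - l *\<^sub>R v) (u - l *\<^sub>R v)"
    using assms by (intro riem_of_g_pos) auto
  also have "\<dots> = riem_of g z u u - 2 * l * riem_of g z u v + l\<^sup>2 * riem_of g z v v"
    by (simp add: riem_of_g_bilinear riem_of_g_sym[of z v u] power2_eq_square algebra_simps)
  also have "\<dots> = riem_of g z u u - (riem_of g z u v)\<^sup>2 / riem_of g z v v"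
    using v by (simp add: l_def field_simps power2_eq_square)
  finally show ?thesis
    using v by (simp add: field_simps)
qed

lemma positive_sectional_curv_g:
  assumes "\<And>x. x \<ge> 0 \<Longrightarrow> k0 x > 0" "\<And>x. x \<ge> 0 \<Longrightarrow> k0 x + x * k1 x > 0"
    "\<And>x. x \<ge> 0 \<Longrightarrow> 2 * k0 x + 4 * x * k1 x + x\<^sup>2 * k2 x > 0"
    "\<And>x. x \<ge> 0 \<Longrightarrow> CARD('n) = 1 \<or> (k0 x + x * k1 x)\<^sup>2 < 2 * (2 * k0 x + 4 * x * k1 x + x\<^sup>2 * k2 x) * k0 x"
  shows "positive_sectional_curv (riem_of (g :: 'n::finite herm_field))"
  unfolding positive_sectional_curv_def
proof (intro allI impI)
  fix z u v :: "complex^'n"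
  assume uv: "u \<noteq> v \<and> independent {u, v}"
  then have v: "v \<noteq> 0"
    using dependent_zero[of "{u, v}"] by auto
  have "u \<noteq> l *\<^sub>R v" for l :: real
  proof
    assume "u = l *\<^sub>R v"
    then have "u \<in> span ({u, v} - {u})"
      using uv by (auto intro: span_mul span_base)
    then show False
      using uv unfolding dependent_def by blast
  qed
  note indep = this
  show "sectional_curv (riem_of g) z u v > 0"
    unfolding sectional_curv_def
    by (intro divide_pos_pos curvature_numerator_pos riem_of_g_Cauchy_Schwarz v indep assms) auto
qed

end

section \<open>Unitary invariance and the soliton equation\<close>

lemma unitary_sum:
  assumes "unitary U"
  shows "(\<Sum>k\<in>UNIV. cnj (U $ k $ i) * U $ k $ j) = (if i = j then 1 else 0)"
proof -
  have "(\<Sum>k\<in>UNIV. cnj (U $ k $ i) * U $ k $ j) = (transpose (map_matrix cnj U) ** U) $ i $ j"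
    by (simp add: matrix_matrix_mult_def transpose_def map_matrix_def)
  then show ?thesis
    using assms by (simp add: unitary_def mat_def)
qed

lemma unitaryI:
  "(\<And>i j. (\<Sum>k\<in>UNIV. cnj (U $ k $ i) * U $ k $ j) = (if i = j then 1 else 0)) \<Longrightarrow> unitary U"
  by (simp add: unitary_def vec_eq_iff matrix_matrix_mult_def transpose_def map_matrix_def mat_def)

lemma cdot_unitary:
  assumes "unitary U"
  shows "cdot (U *v u) (U *v v) = cdot u v"
proof -
  have "cdot (U *v u) (U *v v) = (\<Sum>k\<in>UNIV. \<Sum>i\<in>UNIV. \<Sum>j\<in>UNIV. U $ k $ i * u $ i * cnj (U $ k $ j * v $ j))"
    by (simp add: cdot_def matrix_vector_mult_def sum_product)
  also have "\<dots> = (\<Sum>i\<in>UNIV. \<Sum>k\<in>UNIV. \<Sum>j\<in>UNIV. U $ k $ i * u $ i * cnj (U $ k $ j * v $ j))"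
    by (rule sum.swap)
  also have "\<dots> = (\<Sum>i\<in>UNIV. \<Sum>j\<in>UNIV. \<Sum>k\<in>UNIV. U $ k $ i * u $ i * cnj (U $ k $ j * v $ j))"
    by (intro sum.cong refl sum.swap)
  also have "\<dots> = (\<Sum>i\<in>UNIV. \<Sum>j\<in>UNIV. (\<Sum>k\<in>UNIV. cnj (U $ k $ j) * U $ k $ i) * (u $ i * cnj (v $ j)))"
    unfolding sum_distrib_right by (intro sum.cong refl) (simp add: mult_ac)
  also have "\<dots> = cdot u v"
    unfolding unitary_sum[OF assms] cdot_def by (simp add: if_distrib[of "\<lambda>x. x * _"] cong: if_cong)
  finally show ?thesis .
qed

lemma norm_unitary: "unitary U \<Longrightarrow> norm (U *v u) = norm u"
  using cdot_unitary[of U u u] by (simp add: cdot_self del: of_real_power)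

lemma det_pullback_unitary:
  assumes "unitary U"
  shows "det (pullback U g z) = det (g (U *v z))"
proof -
  have "det (map_matrix cnj U) * det U = 1"
    using arg_cong[OF assms[unfolded unitary_def], of det] by (simp add: det_mul det_transpose)
  then show ?thesis
    by (simp add: pullback_def det_mul det_transpose mult_ac)
qed

lemma pullback_nth:
  "pullback A g z $ i $ j = (\<Sum>k\<in>UNIV. \<Sum>l\<in>UNIV. A $ k $ i * g (A *v z) $ k $ l * cnj (A $ l $ j))"
proof -
  have "pullback A g z $ i $ j = (\<Sum>l\<in>UNIV. \<Sum>k\<in>UNIV. A $ k $ i * g (A *v z) $ k $ l * cnj (A $ l $ j))"
    by (simp add: pullback_def matrix_matrix_mult_def transpose_def map_matrix_def sum_distrib_right)
  also have "\<dots> = (\<Sum>k\<in>UNIV. \<Sum>l\<in>UNIV. A $ k $ i * g (A *v z) $ k $ l * cnj (A $ l $ j))"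
    by (rule sum.swap)
  finally show ?thesis .
qed

lemma radial_herm_nth: "radial_herm a b z $ i $ j = (if i = j then of_real (a ((norm z)\<^sup>2)) else 0)
     + of_real (b ((norm z)\<^sup>2)) * cnj (z $ i) * z $ j"
  by (simp add: radial_herm_def)

lemma matrix_vector_axis: "((A :: complex^'n^'m) *v axis i c) $ k = A $ k $ i * c"
  by (simp add: matrix_vector_mult_def axis_def if_distrib[of "\<lambda>x. _ * x"] cong: if_cong)

lemma norm_axis_complex: "norm (axis m (c :: complex)) = norm c"
  by (simp add: norm_eq_sqrt_inner[of "axis m c"] inner_axis_axis norm_eq_sqrt_inner[of c])

lemma pullback_radial:
  assumes "unitary U"
  shows "pullback U (radial_herm a b) z = radial_herm a b z"
proof -
  have "pullback U (radial_herm a b) z $ i $ j = radial_herm a b z $ i $ j" for i j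
  proof -
    let ?x = "(norm z)\<^sup>2"
    let ?w = "U *v z"
    \<comment> \<open>The adjoint of \<open>U\<close> takes \<open>U *v z\<close> back to
      \<open>z\<close>.\<close>
    have adj: "(\<Sum>k\<in>UNIV. U $ k $ i * cnj (?w $ k)) = cnj (z $ i)" for i
    proof -
      have "(\<Sum>k\<in>UNIV. U $ k $ i * cnj (?w $ k)) = cdot (U *v axis i 1) (U *v z)"
        by (simp add: cdot_def matrix_vector_axis)
      also have "\<dots> = cdot (axis i 1) z"
        by (rule cdot_unitary[OF assms])
      also have "\<dots> = cnj (z $ i)"
        by (simp add: cdot_def axis_def if_distrib[of "\<lambda>x. x * _"] cong: if_cong)
      finally show ?thesis .
    qed
    have "pullback U (radial_herm a b) z $ i $ j
       = (\<Sum>k\<in>UNIV. \<Sum>l\<in>UNIV. (if k = l then U $ k $ i * of_real (a ?x) * cnj (U $ l $ j) else 0))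
       + (\<Sum>k\<in>UNIV. \<Sum>l\<in>UNIV. of_real (b ?x) * ((U $ k $ i * cnj (?w $ k)) * (?w $ l * cnj (U $ l $ j))))"
      unfolding sum.distrib[symmetric] pullback_nth
      by (intro sum.cong) (auto simp: radial_herm_nth norm_unitary[OF assms] algebra_simps)
    also have "(\<Sum>k\<in>UNIV. \<Sum>l\<in>UNIV. (if k = l then U $ k $ i * of_real (a ?x) * cnj (U $ l $ j) else 0))
       = of_real (a ?x) * (\<Sum>k\<in>UNIV. cnj (U $ k $ j) * U $ k $ i)"
      by (simp add: sum_distrib_left mult_ac)
    also have "(\<Sum>k\<in>UNIV. \<Sum>l\<in>UNIV. of_real (b ?x) * ((U $ k $ i * cnj (?w $ k)) * (?w $ l * cnj (U $ l $ j))))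
       = of_real (b ?x) * ((\<Sum>k\<in>UNIV. U $ k $ i * cnj (?w $ k)) * cnj (\<Sum>k\<in>UNIV. U $ k $ j * cnj (?w $ k)))"
      by (simp add: sum_product sum_distrib_left mult_ac)
    finally show ?thesis
      unfolding adj unitary_sum[OF assms] radial_herm_nth by (simp add: mult.assoc)
  qed
  then show ?thesis by (simp add: vec_eq_iff)
qed

lemma rotationally_symmetric_radial: "rotationally_symmetric (radial_herm a b)"
  by (simp add: rotationally_symmetric_def pullback_radial fun_eq_iff)

text \<open>The unitary map \<open>1 + w w\<^sup>* / s\<close> with \<open>w = z - r e\<close> and \<open>s = \<langle>r e, w\<rangle>\<close>, where \<open>e\<close> is a unit vector and
  \<open>r = norm z\<close>, maps \<open>r e\<close> to \<open>z\<close>.\<close>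

lemma unitary_transitive:
  fixes z :: "complex^'n::finite"
  obtains U where "unitary U" "U *v axis m (of_real (norm z)) = z"
proof (cases "z = axis m (of_real (norm z))")
  case True
  have "unitary (mat 1 :: complex^'n^'n)"
  proof -
    have "map_matrix cnj (mat 1 :: complex^'n^'n) = mat 1"
      by (simp add: vec_eq_iff mat_def map_matrix_def)
    then show ?thesis
      by (simp add: unitary_def transpose_mat)
  qed
  with True show ?thesis
    by (intro that[of "mat 1"]) auto
next
  case False
  define e where "e = axis m (complex_of_real (norm z))"
  define w where "w = z - e"
  define s where "s = cdot e w"
  have ee: "cdot e e = of_real ((norm z)\<^sup>2)"
    by (simp add: e_def cdot_def axis_def if_distrib[of "\<lambda>x. x * _"] power2_eq_square cong: if_cong)
  \<comment> \<open>This uses that \<open>e\<close> and \<open>z\<close> have the same norm. It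
    shows that \<open>s\<close> is nonzero, and it cancels the correction term in the unitarity
    check below.\<close>
  have ww: "cdot w w = - (s + cnj s)"
    by (simp add: w_def s_def cdot_simps ee cdot_self[of z] cdot_commute[of z e])
  have s0: "s \<noteq> 0"
    using ww False by (auto simp: w_def e_def cdot_self)
  define U :: "complex^'n^'n" where "U = (\<chi> i j. (if i = j then 1 else 0) + w $ i * cnj (w $ j) / s)"
  have U_app: "U *v v = v + (cdot v w / s) *s w" for v
    by (simp add: vec_eq_iff U_def matrix_vector_mult_def cdot_def ring_distribs sum.distrib
        if_distrib[of "\<lambda>x. _ * x"] if_distrib[of "\<lambda>x. x * _"] sum_distrib_left sum_divide_distrib mult_ac cong: if_cong)
  have "(\<Sum>k\<in>UNIV. cnj (U $ k $ i) * U $ k $ j) = (if i = j then 1 else 0)" for i j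
  proof -
    have "(\<Sum>k\<in>UNIV. cnj (U $ k $ i) * U $ k $ j) = cdot (U *v axis j 1) (U *v axis i 1)"
      by (simp add: cdot_def matrix_vector_axis mult.commute)
    also have "\<dots> = cdot (axis j 1) (axis i 1)
       + (1 / s + 1 / cnj s + cdot w w / (s * cnj s)) * (cdot (axis j 1) w * cdot w (axis i 1))"
      unfolding U_app by (simp add: cdot_simps cdot_commute[of "axis i 1" w] field_simps s0)
    also have "1 / s + 1 / cnj s + cdot w w / (s * cnj s) = 0"
      using s0 by (simp add: ww field_simps)
    also have "cdot (axis j 1) (axis i 1) = (if i = j then 1 else 0 :: complex)"
      by (auto simp: cdot_def axis_def if_distrib[of "\<lambda>x. x * _"] cong: if_cong)
    finally show ?thesis by simp
  qed
  then have "unitary U"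
    by (rule unitaryI)
  moreover have "U *v e = z"
    using s0 unfolding U_app s_def[symmetric] by (simp add: w_def)
  ultimately show ?thesis
    using that by (simp add: e_def)
qed

lemma prod_one_exception:
  "(\<Prod>i\<in>(UNIV::'n::finite set). if i = m then (a::'a::comm_monoid_mult) else b) = a * b ^ (CARD('n) - 1)"
proof -
  have "(\<Prod>i\<in>(UNIV::'n set). if i = m then a else b) = a * (\<Prod>i\<in>UNIV - {m}. if i = m then a else b)"
    by (subst prod.remove[of UNIV m]) auto
  also have "(\<Prod>i\<in>UNIV - {m}. if i = m then a else b) = (\<Prod>i\<in>UNIV - {m}. b)"
    by (rule prod.cong) auto
  finally show ?thesis
    by (simp add: card_Diff_singleton)
qed

text \<open>Rotate z onto a coordinate axis, where the matrix is diagonal; a unitary pullback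
  multiplies the determinant by |det U|^2 = 1.\<close>

lemma det_radial:
  fixes z :: "complex^'n::finite"
  shows "det (radial_herm a b z) = of_real ((a ((norm z)\<^sup>2) + (norm z)\<^sup>2 * b ((norm z)\<^sup>2)) * a ((norm z)\<^sup>2) ^ (CARD('n) - 1))"
proof -
  define m :: 'n where "m = undefined"
  obtain U where U: "unitary U" "U *v axis m (of_real (norm z)) = z"
    by (rule unitary_transitive)
  let ?e = "axis m (complex_of_real (norm z))"
  have "det (radial_herm a b z) = det (radial_herm a b ?e)"
    using det_pullback_unitary[OF U(1), of "radial_herm a b" ?e] by (simp add: pullback_radial[OF U(1)] U(2))
  also have "\<dots> = (\<Prod>i\<in>UNIV. radial_herm a b ?e $ i $ i)"
    by (rule det_diagonal) (auto simp: radial_herm_nth axis_def)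
  also have "\<dots> = (\<Prod>i\<in>UNIV. if i = m then of_real (a ((norm z)\<^sup>2) + (norm z)\<^sup>2 * b ((norm z)\<^sup>2)) else of_real (a ((norm z)\<^sup>2)))"
    unfolding radial_herm_nth norm_axis_complex
    by (rule prod.cong) (auto simp: axis_def power2_eq_square)
  also have "\<dots> = of_real ((a ((norm z)\<^sup>2) + (norm z)\<^sup>2 * b ((norm z)\<^sup>2)) * a ((norm z)\<^sup>2) ^ (CARD('n) - 1))"
    by (simp only: prod_one_exception) simp
  finally show ?thesis .
qed

section \<open>Wirtinger derivatives\<close>

lemma C_k_uminus: "C_k k F \<Longrightarrow> C_k k (\<lambda>x. - F x)"
  by (rule C_k_compose_linear[OF bounded_linear_minus[OF bounded_linear_ident]])

lemma smooth_wirt: "smooth F \<Longrightarrow> smooth (wirt i F)"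
  unfolding smooth_def
proof
  fix k assume "\<forall>k. C_k k F"
  then have "C_k (Suc k) F" by blast
  then show "C_k k (wirt i F)"
    unfolding wirt_def[abs_def] diff_conv_add_uminus
    by (intro C_k_compose_linear[OF bounded_linear_divide] C_k_add C_k_uminus C_k_mult C_k_const) auto
qed

lemma smooth_wirt_bar: "smooth F \<Longrightarrow> smooth (wirt_bar i F)"
  unfolding smooth_def
proof
  fix k assume "\<forall>k. C_k k F"
  then have "C_k (Suc k) F" by blast
  then show "C_k k (wirt_bar i F)"
    unfolding wirt_bar_def[abs_def]
    by (intro C_k_compose_linear[OF bounded_linear_divide] C_k_add C_k_mult C_k_const) auto
qed

lemma dir_deriv_uminus: "F differentiable (at z) \<Longrightarrow> dir_deriv (\<lambda>z. - F z) z u = - dir_deriv F z u"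
  by (rule dir_deriv_eq) (auto intro: has_derivative_minus has_derivative_dir_deriv)

lemma wirt_uminus: "F differentiable (at z) \<Longrightarrow> wirt i (\<lambda>z. - F z) z = - wirt i F z"
  by (simp add: wirt_def dir_deriv_uminus field_simps)

lemma wirt_bar_uminus: "F differentiable (at z) \<Longrightarrow> wirt_bar i (\<lambda>z. - F z) z = - wirt_bar i F z"
  by (simp add: wirt_bar_def dir_deriv_uminus field_simps)

lemma smooth_of_real: "smooth f \<Longrightarrow> smooth (\<lambda>z. complex_of_real (f z))"
  by (auto simp: smooth_def intro: C_k_compose_linear[OF bounded_linear_of_real])

section \<open>Ricci tensor and Hessian of a radial potential\<close>

context radial_metric
begin

lemma det_g:
  fixes z :: "complex^'n::finite"
  shows "det (g z) = of_real (a ((norm z)\<^sup>2) ^ CARD('n) * (1 + (norm z)\<^sup>2 * p ((norm z)\<^sup>2)))"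
  by (simp add: g_def det_radial field_simps power_eq_if)

lemma kaehler_metric_g:
  assumes "smooth (g :: 'n::finite herm_field)"
  shows "kaehler_metric (g :: 'n herm_field)"
  unfolding kaehler_metric_def
proof (intro conjI allI impI assms riem_of_g_pos)
  fix z u v w :: "complex^'n"
  show "g z $ i $ j = cnj (g z $ j $ i)" for i j
    by (simp add: g_def radial_herm_def mult_ac)
  have "cdot z u = cnj (cdot u z)" "cdot z v = cnj (cdot v z)" "cdot z w = cnj (cdot w z)"
    "cdot v u = cnj (cdot u v)" "cdot w v = cnj (cdot v w)" "cdot w u = cnj (cdot u w)"
    by (rule cdot_commute)+
  note cs = this
  show "dir_deriv (\<lambda>p. kaehler_form g p v w) z u
      + dir_deriv (\<lambda>p. kaehler_form g p w u) z v
      + dir_deriv (\<lambda>p. kaehler_form g p u v) z w = 0"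
    unfolding kaehler_form_def dir_deriv_eq[OF riem_of_g_deriv]
    by (simp only: cdot_simps cs) (simp add: algebra_simps)
qed

lemma g_nth_deriv:
  "((\<lambda>z. g z $ j $ l) has_derivative (\<lambda>u. of_real (a ((norm z)\<^sup>2)) *
     ((if j = l then of_real (2 * (z \<bullet> u) * p ((norm z)\<^sup>2)) else 0)
      + of_real (2 * (z \<bullet> u) * ((p ((norm z)\<^sup>2))\<^sup>2 + p' ((norm z)\<^sup>2))) * cnj (z $ j) * z $ l
      + of_real (p ((norm z)\<^sup>2)) * (cnj (u $ j) * z $ l + cnj (z $ j) * u $ l)))) (at z)"
proof -
  have nth: "((\<lambda>z. z $ i) has_derivative (\<lambda>u. u $ i)) (at z)" for i and z :: "complex^'n"
    by (rule bounded_linear_imp_has_derivative[OF bounded_linear_vec_nth])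
  have ite: "((\<lambda>z. if j = l then complex_of_real (a ((norm z)\<^sup>2)) else 0) has_derivative
     (\<lambda>u. if j = l then of_real (2 * (z \<bullet> u) * (a ((norm z)\<^sup>2) * p ((norm z)\<^sup>2))) else 0)) (at z)"
    for z :: "complex^'n"
    using radial_fun_has_derivative[OF a_deriv, of z] by (cases "j = l") (auto dest: has_derivative_of_real)
  show ?thesis
    unfolding g_def radial_herm_def vec_lambda_beta of_real_mult
    by (rule has_derivative_eq_rhs, (rule ite nth derivative_intros radial_fun_has_derivative[OF a_deriv]
      radial_fun_has_derivative[OF p_deriv] zero_le_power2)+)
     (auto simp: fun_eq_iff algebra_simps power2_eq_square)
qed

lemma wirt_g: "wirt i (\<lambda>z. g z $ j $ l) z = of_real (a ((norm z)\<^sup>2)) *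
     ((if j = l then of_real (p ((norm z)\<^sup>2)) * cnj (z $ i) else 0)
      + of_real ((p ((norm z)\<^sup>2))\<^sup>2 + p' ((norm z)\<^sup>2)) * cnj (z $ i) * cnj (z $ j) * z $ l
      + (if i = l then of_real (p ((norm z)\<^sup>2)) * cnj (z $ j) else 0))"
  unfolding wirt_def dir_deriv_eq[OF g_nth_deriv] inner_axis
  by (simp add: axis_def complex_eq_iff inner_complex_def) (auto simp: field_simps)

text \<open>The inverse matrix is never computed. The claimed symbols \<open>?G\<close> are shown to
  solve the linear system with matrix g whose right-hand side is the derivative of g, and
  contracting with the inverse isolates them.\<close>

lemma christoffel_g:
  "christoffel g z k i j = (if k = j then of_real (p ((norm z)\<^sup>2)) * cnj (z $ i) else 0)
     + (if k = i then of_real (p ((norm z)\<^sup>2)) * cnj (z $ j) else 0)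
     + of_real (q ((norm z)\<^sup>2)) * cnj (z $ i) * cnj (z $ j) * z $ k" (is "_ = ?G k")
proof -
  let ?x = "(norm z)\<^sup>2"
  have zz: "(\<Sum>m\<in>UNIV. cnj (z $ m) * z $ m) = of_real ?x"
    using cdot_self[of z] by (simp add: cdot_def mult.commute)
  have p': "p' ?x = q ?x + (p ?x)\<^sup>2 + ?x * p ?x * q ?x"
    by (simp add: p'_eq)
  have eq: "wirt i (\<lambda>z. g z $ j $ l) z = (\<Sum>m\<in>UNIV. g z $ m $ l * ?G m)" for l
  proof -
    have "(\<Sum>m\<in>UNIV. g z $ m $ l * ?G m)
       = (\<Sum>m\<in>UNIV. if m = l then of_real (a ?x) * ?G m else 0)
       + (\<Sum>m\<in>UNIV. if m = j then of_real (a ?x * p ?x * p ?x) * cnj (z $ m) * z $ l * cnj (z $ i) else 0)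
       + (\<Sum>m\<in>UNIV. if m = i then of_real (a ?x * p ?x * p ?x) * cnj (z $ m) * z $ l * cnj (z $ j) else 0)
       + (\<Sum>m\<in>UNIV. of_real (a ?x * p ?x * q ?x) * z $ l * cnj (z $ i) * cnj (z $ j) * (cnj (z $ m) * z $ m))"
      unfolding sum.distrib[symmetric] g_def radial_herm_def
      by (intro sum.cong) (auto simp: algebra_simps)
    also have "\<dots> = of_real (a ?x) * ?G l + of_real (2 * a ?x * p ?x * p ?x) * cnj (z $ i) * cnj (z $ j) * z $ l
       + of_real (a ?x * p ?x * q ?x) * z $ l * cnj (z $ i) * cnj (z $ j) * of_real ?x"
      by (simp add: sum_distrib_left[symmetric] zz)
    also have "\<dots> = wirt i (\<lambda>z. g z $ j $ l) z"
      unfolding wirt_g p' by (auto simp: algebra_simps power2_eq_square)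
    finally show ?thesis by simp
  qed
  have "1 + ?x * p ?x > 0" "a ?x > 0"
    using p_bound[of ?x] a_pos[of ?x] by auto
  then have "det (g z) \<noteq> 0"
    unfolding det_g of_real_eq_0_iff by simp
  then have "g z ** matrix_inv (g z) = mat 1"
    unfolding invertible_det_nz[symmetric] invertible_def matrix_inv_def
    by (rule someI2_ex) simp
  then have inv: "(\<Sum>l\<in>UNIV. g z $ m $ l * matrix_inv (g z) $ l $ k) = (if m = k then 1 else 0)" for m
    by (simp add: vec_eq_iff matrix_matrix_mult_def mat_def)
  have "christoffel g z k i j = (\<Sum>l\<in>UNIV. \<Sum>m\<in>UNIV. g z $ m $ l * matrix_inv (g z) $ l $ k * ?G m)"
    unfolding christoffel_def eq sum_distrib_left by (intro sum.cong refl) (simp only: mult_ac)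
  also have "\<dots> = (\<Sum>m\<in>UNIV. \<Sum>l\<in>UNIV. g z $ m $ l * matrix_inv (g z) $ l $ k * ?G m)"
    by (rule sum.swap)
  also have "\<dots> = (\<Sum>m\<in>UNIV. if m = k then ?G m else 0)"
    by (simp only: sum_distrib_right[symmetric] inv) (intro sum.cong refl, simp)
  also have "\<dots> = ?G k"
    by (simp only: sum.delta finite UNIV_I if_True)
  finally show ?thesis .
qed

text \<open>\<open>vol\<close> says that log det g = -f, which is the Ricci equation before
  differentiation. The (2,0) Hessian cancels because B = a (1 + x p) has logarithmic derivative 2 p
  + x q, exactly what the Christoffel symbols contribute when contracted with the gradient.\<close>

lemma gradient_kr_soliton_g:
  fixes f :: "real \<Rightarrow> real"
  assumes "smooth (g :: 'n::finite herm_field)" "smooth (\<lambda>z::complex^'n. f ((norm z)\<^sup>2))"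
    and f: "\<And>x. x \<ge> 0 \<Longrightarrow> (f has_real_derivative a x * (1 + x * p x)) (at x)"
    and vol: "\<And>x. x \<ge> 0 \<Longrightarrow> a x ^ CARD('n) * (1 + x * p x) = exp (- f x)"
  shows "gradient_kr_soliton (g :: 'n herm_field)"
  unfolding gradient_kr_soliton_def
proof (intro conjI exI allI)
  let ?f = "\<lambda>z::complex^'n. f ((norm z)\<^sup>2)"
  let ?F = "\<lambda>z::complex^'n. complex_of_real (?f z)"
  show "kaehler_metric (g :: 'n herm_field)"
    by (rule kaehler_metric_g) fact
  show "smooth ?f" by fact
  have smF: "smooth ?F"
    by (rule smooth_of_real) fact
  fix z :: "complex^'n" and i j
  have "det (g w) = exp (of_real (- ?f w))" for w :: "complex^'n"
    unfolding det_g vol[OF zero_le_power2] by (rule exp_of_real[symmetric])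
  then have "(\<lambda>w::complex^'n. ln (det (g w))) = (\<lambda>w. - ?F w)"
    unfolding exp_of_real by (simp add: fun_eq_iff Ln_of_real)
  moreover have "wirt_bar j (\<lambda>w. - ?F w) = (\<lambda>z. - wirt_bar j ?F z)"
    using smooth_differentiable[OF smF] by (simp add: fun_eq_iff wirt_bar_uminus)
  ultimately show "ricci g z i j = hess_11 ?f z i j"
    using smooth_differentiable[OF smooth_wirt_bar[OF smF]] by (simp add: ricci_def hess_11_def wirt_uminus)
  let ?x = "(norm z)\<^sup>2"
  have wf: "wirt j ?F z = of_real (a ((norm z)\<^sup>2) * (1 + (norm z)\<^sup>2 * p ((norm z)\<^sup>2))) * cnj (z $ j)" for j z
    unfolding wirt_def dir_deriv_eq[OF has_derivative_of_real[OF radial_fun_has_derivative[OF f[OF zero_le_power2]]]]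
    by (simp add: inner_axis inner_complex_def complex_eq_iff field_simps)
  have B_deriv: "((\<lambda>x. a x * (1 + x * p x)) has_real_derivative
      a x * (1 + x * p x) * (2 * p x + x * q x)) (at x)" if "x \<ge> 0" for x
    by (rule derivative_eq_intros a_deriv[OF that] p_deriv[OF that] refl)+
      (simp add: p'_eq[OF that] power2_eq_square algebra_simps)
  have wwf: "wirt i (wirt j ?F) z
     = of_real (a ?x * (1 + ?x * p ?x) * (2 * p ?x + ?x * q ?x)) * cnj (z $ i) * cnj (z $ j)"
  proof -
    have nth: "((\<lambda>z. z $ i) has_derivative (\<lambda>u. u $ i)) (at z)" for i and z :: "complex^'n"
      by (rule bounded_linear_imp_has_derivative[OF bounded_linear_vec_nth])
    have "((\<lambda>z. complex_of_real (a ((norm z)\<^sup>2) * (1 + (norm z)\<^sup>2 * p ((norm z)\<^sup>2))) * cnj (z $ j)) has_derivative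
      (\<lambda>u. of_real (a ?x * (1 + ?x * p ?x)) * cnj (u $ j)
        + of_real (2 * (z \<bullet> u) * (a ?x * (1 + ?x * p ?x) * (2 * p ?x + ?x * q ?x))) * cnj (z $ j))) (at z)"
      by (rule has_derivative_mult[OF has_derivative_of_real[OF radial_fun_has_derivative[OF B_deriv[OF zero_le_power2]]]
        has_derivative_cnj[OF nth]])
    note deriv = dir_deriv_eq[OF this]
    have fold: "wirt j ?F = (\<lambda>z. of_real (a ((norm z)\<^sup>2) * (1 + (norm z)\<^sup>2 * p ((norm z)\<^sup>2))) * cnj (z $ j))"
      using wf by blast
    show ?thesis
      unfolding wirt_def[of i] fold deriv inner_axis
      by (simp add: axis_def inner_complex_def complex_eq_iff)
  qed
  have zz: "(\<Sum>m\<in>UNIV. cnj (z $ m) * z $ m) = of_real ?x"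
    using cdot_self[of z] by (simp add: cdot_def mult.commute)
  let ?B = "of_real (a ?x * (1 + ?x * p ?x)) :: complex"
  have "(\<Sum>k\<in>UNIV. christoffel g z k i j * wirt k ?F z)
     = (\<Sum>k\<in>UNIV. if k = j then of_real (p ?x) * cnj (z $ i) * ?B * cnj (z $ k) else 0)
     + (\<Sum>k\<in>UNIV. if k = i then of_real (p ?x) * cnj (z $ j) * ?B * cnj (z $ k) else 0)
     + (\<Sum>k\<in>UNIV. of_real (q ?x) * cnj (z $ i) * cnj (z $ j) * ?B * (cnj (z $ k) * z $ k))"
    unfolding sum.distrib[symmetric] christoffel_g wf by (intro sum.cong) (auto simp: algebra_simps)
  also have "\<dots> = ?B * of_real (2 * p ?x + ?x * q ?x) * cnj (z $ i) * cnj (z $ j)"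
    unfolding sum_distrib_left[symmetric] zz by simp (simp add: algebra_simps)
  finally show "hess_20 g ?f z i j = 0"
    unfolding hess_20_def wwf by simp
qed

end

section \<open>Completeness\<close>

text \<open>Along the path, ln (1 + |p - x|^2) has derivative at most the square root of 4 |v|^2 /
  (1 + |p - x|^2). Passing from the centre x to the origin costs the factor 2 (1 + |x|^2), and
  \<open>lower\<close> the factor 1 / k, whence the constant.\<close>

lemma path_length_lower_bound:
  fixes h :: "'a::euclidean_space \<Rightarrow> 'a \<Rightarrow> 'a \<Rightarrow> real"
  assumes k: "k > 0" and lower: "\<And>z v. k / (1 + (norm z)\<^sup>2) * (norm v)\<^sup>2 \<le> h z v v"
    and path: "valid_path \<gamma>" "pathstart \<gamma> = x" "pathfinish \<gamma> = y"
    and len: "((\<lambda>t. sqrt (h (\<gamma> t) (vector_derivative \<gamma> (at t)) (vector_derivative \<gamma> (at t)))) has_integral L) {0..1}"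
  shows "ln (1 + (norm (y - x))\<^sup>2) \<le> sqrt (8 * (1 + (norm x)\<^sup>2) / k) * L"
proof -
  let ?K = "8 * (1 + (norm x)\<^sup>2) / k"
  obtain S where S: "finite S" "\<gamma> C1_differentiable_on {0..1} - S" and cont: "continuous_on {0..1} \<gamma>"
    using path(1) unfolding valid_path_def piecewise_C1_differentiable_on_def by blast
  let ?v = "\<lambda>t. vector_derivative \<gamma> (at t)"
  let ?d = "\<lambda>t. 2 * ((\<gamma> t - x) \<bullet> ?v t) / (1 + (norm (\<gamma> t - x))\<^sup>2)"
  let ?F = "\<lambda>p. ln (1 + (norm (p - x))\<^sup>2)"
  have pos: "1 + (norm (p - x))\<^sup>2 > 0" for p
    by (simp add: add_pos_nonneg)
  have "(?d has_integral ?F (\<gamma> 1) - ?F (\<gamma> 0)) {0..1}"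
  proof (rule fundamental_theorem_of_calculus_interior_strong[where f = "\<lambda>t. ?F (\<gamma> t)", OF S(1)])
    fix t assume t: "t \<in> {0<..<1} - S"
    then have v: "(\<gamma> has_vector_derivative ?v t) (at t)"
      using S(2) by (auto simp: C1_differentiable_on_eq vector_derivative_works[symmetric])
    have "((\<lambda>t. ?F (\<gamma> t)) has_real_derivative ?d t) (at t)"
      unfolding power2_norm_eq_inner has_field_derivative_def
      using pos[of "\<gamma> t"] v[unfolded has_vector_derivative_def]
      by (auto intro!: derivative_eq_intros simp: inner_commute power2_norm_eq_inner fun_eq_iff field_simps)
    then show "((\<lambda>t. ?F (\<gamma> t)) has_vector_derivative ?d t) (at t)"
      by (simp add: has_real_derivative_iff_has_vector_derivative)
  next
    show "continuous_on {0..1} (\<lambda>t. ?F (\<gamma> t))"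
      using pos by (intro continuous_intros cont) (auto simp: less_imp_neq[symmetric])
  qed simp
  moreover have "((\<lambda>t. sqrt ?K * sqrt (h (\<gamma> t) (?v t) (?v t))) has_integral sqrt ?K * L) {0..1}"
    by (intro has_integral_mult_right len)
  moreover have "?d t \<le> sqrt ?K * sqrt (h (\<gamma> t) (?v t) (?v t))" for t
  proof -
    define w v where "w = \<gamma> t - x" and "v = ?v t"
    have "(norm (w + x))\<^sup>2 \<le> 2 * (norm w)\<^sup>2 + 2 * (norm x)\<^sup>2"
    proof -
      have "(norm (w + x))\<^sup>2 \<le> (norm w + norm x)\<^sup>2"
        by (intro power_mono norm_triangle_ineq) auto
      also have "\<dots> \<le> 2 * (norm w)\<^sup>2 + 2 * (norm x)\<^sup>2"
        using zero_le_power2[of "norm w - norm x"] by (simp add: power2_eq_square algebra_simps)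
      finally show ?thesis .
    qed
    also have "\<dots> \<le> 2 * (1 + (norm x)\<^sup>2) * (1 + (norm w)\<^sup>2) - 1"
      by (simp add: algebra_simps)
    finally have w: "1 + (norm (\<gamma> t))\<^sup>2 \<le> 2 * (1 + (norm x)\<^sup>2) * (1 + (norm w)\<^sup>2)"
      by (simp add: w_def)
    have "2 * (w \<bullet> v) / (1 + (norm w)\<^sup>2) \<le> sqrt (?K * h (\<gamma> t) v v)"
    proof (rule real_le_rsqrt)
      have "(w \<bullet> v)\<^sup>2 \<le> (norm w)\<^sup>2 * (norm v)\<^sup>2"
        using power_mono[OF Cauchy_Schwarz_ineq2[of w v], of 2] by (simp add: power_mult_distrib)
      also have "\<dots> \<le> (1 + (norm w)\<^sup>2) * (norm v)\<^sup>2"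
        by (intro mult_right_mono) auto
      finally have "(2 * (w \<bullet> v) / (1 + (norm w)\<^sup>2))\<^sup>2 \<le> 4 * ((1 + (norm w)\<^sup>2) * (norm v)\<^sup>2) / (1 + (norm w)\<^sup>2)\<^sup>2"
        by (simp add: power_divide power_mult_distrib divide_right_mono)
      also have "\<dots> = 4 * (norm v)\<^sup>2 * (1 / (1 + (norm w)\<^sup>2))"
        using pos[of "\<gamma> t"] by (simp add: power2_eq_square w_def)
      also have "\<dots> \<le> 4 * (norm v)\<^sup>2 * (2 * (1 + (norm x)\<^sup>2) / (1 + (norm (\<gamma> t))\<^sup>2))"
        using w pos[of "\<gamma> t"] pos[of "\<gamma> t + x"]
        by (intro mult_left_mono) (auto simp: field_simps w_def)
      also have "\<dots> = ?K * (k / (1 + (norm (\<gamma> t))\<^sup>2) * (norm v)\<^sup>2)"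
        using k pos[of "\<gamma> t + x"] by (simp add: divide_simps)
      also have "\<dots> \<le> ?K * h (\<gamma> t) v v"
        using k by (intro mult_left_mono lower) auto
      finally show "(2 * (w \<bullet> v) / (1 + (norm w)\<^sup>2))\<^sup>2 \<le> ?K * h (\<gamma> t) v v" .
    qed
    then show ?thesis
      unfolding w_def v_def real_sqrt_mult .
  qed
  ultimately have "?F (\<gamma> 1) - ?F (\<gamma> 0) \<le> sqrt ?K * L"
    by (rule has_integral_le)
  then show ?thesis
    using path by (simp add: pathstart_def pathfinish_def)
qed

text \<open>Invariance of length under affine reparametrization, stated to cover both reversal
  (\<open>m = -1\<close>) and the halves of a joined path (\<open>m = 2\<close>). The finitely many
  exceptional parameters are discarded.\<close>

lemma speed_affine_has_integral:
  fixes \<gamma> :: "real \<Rightarrow> 'a::real_normed_vector" and N :: "'a \<Rightarrow> 'a \<Rightarrow> real"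
  assumes hom: "\<And>z c v. N z (c *\<^sub>R v) = \<bar>c\<bar> * N z v"
    and \<gamma>: "\<gamma> C1_differentiable_on {0..1} - S" "finite S"
    and int: "((\<lambda>t. N (\<gamma> t) (vector_derivative \<gamma> (at t))) has_integral L) {0..1}"
    and m: "m \<noteq> 0" "(\<lambda>x. x / m - c / m) ` {0..1} = {a..b}"
  shows "((\<lambda>t. N (\<gamma> (m * t + c)) (vector_derivative (\<lambda>t. \<gamma> (m * t + c)) (at t))) has_integral L) {a..b}"
proof -
  have "((\<lambda>t. N (\<gamma> (m * t + c)) (vector_derivative \<gamma> (at (m * t + c)))) has_integral (1 / \<bar>m\<bar>) *\<^sub>R L) {a..b}"
    using has_integral_affinity01[OF int m(1), of c] by (simp only: m(2) times_divide_eq_left mult_1_left add_uminus_conv_diff)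
  from has_integral_mult_right[OF this, of "\<bar>m\<bar>"]
  have "((\<lambda>t. \<bar>m\<bar> * N (\<gamma> (m * t + c)) (vector_derivative \<gamma> (at (m * t + c)))) has_integral L) {a..b}"
    using m(1) by simp
  then show ?thesis
  proof (rule has_integral_spike_finite[rotated 2])
    show "finite ((\<lambda>t. m * t + c) -` S)"
      using \<gamma>(2) m(1) by (intro finite_vimageI) (auto intro: injI)
    fix t assume t: "t \<in> {a..b} - (\<lambda>t. m * t + c) -` S"
    then obtain x where "x \<in> {0..1}" "t = x / m - c / m"
      unfolding m(2)[symmetric] by blast
    then have "m * t + c \<in> {0..1} - S"
      using t m(1) by (auto simp: field_simps)
    then have "(\<gamma> has_vector_derivative vector_derivative \<gamma> (at (m * t + c))) (at (m * t + c))"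
      using \<gamma>(1) by (auto simp: C1_differentiable_on_eq vector_derivative_works[symmetric])
    moreover have "((\<lambda>t. m * t + c) has_vector_derivative m) (at t)"
      by (auto intro!: derivative_eq_intros simp flip: has_real_derivative_iff_has_vector_derivative)
    ultimately have "((\<lambda>t. \<gamma> (m * t + c)) has_vector_derivative m *\<^sub>R vector_derivative \<gamma> (at (m * t + c))) (at t)"
      using vector_diff_chain_at[of "\<lambda>t. m * t + c" m t \<gamma>] by (simp add: o_def)
    then show "N (\<gamma> (m * t + c)) (vector_derivative (\<lambda>t. \<gamma> (m * t + c)) (at t))
        = \<bar>m\<bar> * N (\<gamma> (m * t + c)) (vector_derivative \<gamma> (at (m * t + c)))"
      by (simp add: vector_derivative_at hom)
  qed
qed

lemma vector_derivative_cong_open: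
  assumes "open U" "t \<in> U" "\<And>s. s \<in> U \<Longrightarrow> f s = g s"
  shows "vector_derivative f (at t) = vector_derivative g (at t)"
proof -
  have "eventually (\<lambda>s. f s = g s) (nhds t)"
    using assms eventually_nhds by blast
  then show ?thesis
    by (intro vector_derivative_cong_eq) (auto simp: assms elim: eventually_mono)
qed

lemma speed_join_has_integral:
  fixes \<gamma>1 \<gamma>2 :: "real \<Rightarrow> 'a::real_normed_vector" and N :: "'a \<Rightarrow> 'a \<Rightarrow> real"
  assumes hom: "\<And>z c v. N z (c *\<^sub>R v) = \<bar>c\<bar> * N z v"
    and "valid_path \<gamma>1" "valid_path \<gamma>2"
    and int: "((\<lambda>t. N (\<gamma>1 t) (vector_derivative \<gamma>1 (at t))) has_integral L1) {0..1}"
      "((\<lambda>t. N (\<gamma>2 t) (vector_derivative \<gamma>2 (at t))) has_integral L2) {0..1}"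
  shows "((\<lambda>t. N ((\<gamma>1 +++ \<gamma>2) t) (vector_derivative (\<gamma>1 +++ \<gamma>2) (at t))) has_integral L1 + L2) {0..1}"
proof -
  obtain S1 S2 where S: "\<gamma>1 C1_differentiable_on {0..1} - S1" "finite S1"
    "\<gamma>2 C1_differentiable_on {0..1} - S2" "finite S2"
    using assms(2,3) unfolding valid_path_def piecewise_C1_differentiable_on_def by metis
  have "((\<lambda>t. N (\<gamma>1 (2 * t + 0)) (vector_derivative (\<lambda>t. \<gamma>1 (2 * t + 0)) (at t))) has_integral L1) {0..1/2}"
    by (rule speed_affine_has_integral[OF hom S(1,2) int(1)])
      (use image_affinity_atLeastAtMost[of "1/2" 0 0 "1::real"] in auto)
  then have 1: "((\<lambda>t. N ((\<gamma>1 +++ \<gamma>2) t) (vector_derivative (\<gamma>1 +++ \<gamma>2) (at t))) has_integral L1) {0..1/2}"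
  proof (rule has_integral_spike_finite[rotated 2])
    fix t :: real assume t: "t \<in> {0..1/2} - {1/2}"
    then have "vector_derivative (\<gamma>1 +++ \<gamma>2) (at t) = vector_derivative (\<lambda>t. \<gamma>1 (2 * t + 0)) (at t)"
      by (intro vector_derivative_cong_open[of "{..<1/2}"]) (auto simp: joinpaths_def)
    then show "N ((\<gamma>1 +++ \<gamma>2) t) (vector_derivative (\<gamma>1 +++ \<gamma>2) (at t))
        = N (\<gamma>1 (2 * t + 0)) (vector_derivative (\<lambda>t. \<gamma>1 (2 * t + 0)) (at t))"
      using t by (simp add: joinpaths_def)
  qed simp
  have "((\<lambda>t. N (\<gamma>2 (2 * t + -1)) (vector_derivative (\<lambda>t. \<gamma>2 (2 * t + -1)) (at t))) has_integral L2) {1/2..1}"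
    by (rule speed_affine_has_integral[OF hom S(3,4) int(2)])
      (use image_affinity_atLeastAtMost[of "1/2" "1/2" 0 "1::real"] in auto)
  then have 2: "((\<lambda>t. N ((\<gamma>1 +++ \<gamma>2) t) (vector_derivative (\<gamma>1 +++ \<gamma>2) (at t))) has_integral L2) {1/2..1}"
  proof (rule has_integral_spike_finite[rotated 2])
    fix t :: real assume t: "t \<in> {1/2..1} - {1/2}"
    then have "vector_derivative (\<gamma>1 +++ \<gamma>2) (at t) = vector_derivative (\<lambda>t. \<gamma>2 (2 * t + -1)) (at t)"
      by (intro vector_derivative_cong_open[of "{1/2<..}"]) (auto simp: joinpaths_def)
    then show "N ((\<gamma>1 +++ \<gamma>2) t) (vector_derivative (\<gamma>1 +++ \<gamma>2) (at t))
        = N (\<gamma>2 (2 * t + -1)) (vector_derivative (\<lambda>t. \<gamma>2 (2 * t + -1)) (at t))"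
      using t by (simp add: joinpaths_def)
  qed simp
  show ?thesis
    by (rule has_integral_combine[OF _ _ 1 2]) auto
qed

text \<open>By the logarithmic lower bound a Cauchy sequence of \<open>riem_dist h\<close> is Cauchy
  in the Euclidean sense; by the upper bound, tested on segments, its Euclidean limit is a limit for
  \<open>riem_dist h\<close>.\<close>

lemma complete_metric_of_bounds:
  fixes h :: "'a::euclidean_space \<Rightarrow> 'a \<Rightarrow> 'a \<Rightarrow> real"
  assumes k: "k > 0" and lower: "\<And>z v. k / (1 + (norm z)\<^sup>2) * (norm v)\<^sup>2 \<le> h z v v"
    and upper: "\<And>z v. h z v v \<le> C * (norm v)\<^sup>2"
    and cont: "\<And>v. continuous_on UNIV (\<lambda>z. h z v v)"
    and hom: "\<And>z c v. h z (c *\<^sub>R v) (c *\<^sub>R v) = c\<^sup>2 * h z v v"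
  shows "complete_metric h"
proof -
  have nonneg: "h z v v \<ge> 0" for z v
    using lower[of z v] k by (smt (verit) divide_nonneg_nonneg mult_nonneg_nonneg zero_le_power2)
  define P where "P x y = {L. \<exists>\<gamma>. valid_path \<gamma> \<and> pathstart \<gamma> = x \<and> pathfinish \<gamma> = y \<and>
     ((\<lambda>t. sqrt (h (\<gamma> t) (vector_derivative \<gamma> (at t)) (vector_derivative \<gamma> (at t)))) has_integral L) {0..1}}" for x y
  have dist_eq: "riem_dist h x y = Inf (P x y)" for x y
    by (simp add: riem_dist_def P_def)
  have P_nonneg: "L \<ge> 0" if "L \<in> P x y" for L x y
    using that nonneg by (auto simp: P_def intro: has_integral_nonneg)
  have line: "\<exists>L \<in> P x y. L \<le> sqrt C * norm (y - x)" for x y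
  proof -
    have "continuous_on {0..1} (\<lambda>t. sqrt (h (linepath x y t) (y - x) (y - x)))"
      by (intro continuous_intros continuous_on_compose2[OF cont]) auto
    then obtain L where L: "((\<lambda>t. sqrt (h (linepath x y t) (y - x) (y - x))) has_integral L) {0..1}"
      using integrable_continuous_real by blast
    then have "L \<in> P x y"
      by (auto simp: P_def intro!: exI[of _ "linepath x y"])
    moreover have "L \<le> sqrt C * norm (y - x)"
    proof (rule has_integral_le[OF L])
      show "((\<lambda>t::real. sqrt C * norm (y - x)) has_integral sqrt C * norm (y - x)) {0..1}"
        using has_integral_const_real[of "sqrt C * norm (y - x)" "0::real" 1] by simp
      show "sqrt (h (linepath x y t) (y - x) (y - x)) \<le> sqrt C * norm (y - x)" for t
        using real_sqrt_le_mono[OF upper[of "linepath x y t" "y - x"]] by (simp add: real_sqrt_mult)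
    qed
    ultimately show ?thesis by blast
  qed
  have dist_upper: "riem_dist h x y \<le> sqrt C * norm (y - x)" for x y
    using line[of x y] P_nonneg unfolding dist_eq
    by (metis bdd_below.I cInf_lower order_trans)
  have dist_lower: "ln (1 + (norm (y - x))\<^sup>2) \<le> sqrt (8 * (1 + (norm x)\<^sup>2) / k) * riem_dist h x y" for x y
  proof -
    let ?K = "sqrt (8 * (1 + (norm x)\<^sup>2) / k)"
    have K: "?K > 0" using k by (simp add: add_pos_nonneg)
    have "ln (1 + (norm (y - x))\<^sup>2) / ?K \<le> Inf (P x y)"
    proof (rule cInf_greatest)
      show "P x y \<noteq> {}" using line by blast
      fix L assume "L \<in> P x y"
      then have "ln (1 + (norm (y - x))\<^sup>2) \<le> ?K * L"
        unfolding P_def using path_length_lower_bound[of k h, OF k lower] by blast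
      then show "ln (1 + (norm (y - x))\<^sup>2) / ?K \<le> L"
        using K by (simp add: field_simps)
    qed
    then show ?thesis
      using K by (simp add: dist_eq field_simps)
  qed
  have speed_hom: "sqrt (h z (c *\<^sub>R v) (c *\<^sub>R v)) = \<bar>c\<bar> * sqrt (h z v v)" for z c v
    by (simp add: hom real_sqrt_mult)
  have P_sym: "P x y \<subseteq> P y x" for x y
  proof
    fix L assume "L \<in> P x y"
    then obtain \<gamma> where \<gamma>: "valid_path \<gamma>" "pathstart \<gamma> = x" "pathfinish \<gamma> = y"
      "((\<lambda>t. sqrt (h (\<gamma> t) (vector_derivative \<gamma> (at t)) (vector_derivative \<gamma> (at t)))) has_integral L) {0..1}"
      by (auto simp: P_def)
    obtain S where S: "\<gamma> C1_differentiable_on {0..1} - S" "finite S"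
      using \<gamma>(1) unfolding valid_path_def piecewise_C1_differentiable_on_def by metis
    have "((\<lambda>t. sqrt (h (\<gamma> (-1 * t + 1)) (vector_derivative (\<lambda>t. \<gamma> (-1 * t + 1)) (at t))
        (vector_derivative (\<lambda>t. \<gamma> (-1 * t + 1)) (at t)))) has_integral L) {0..1}"
      by (rule speed_affine_has_integral[where N = "\<lambda>z v. sqrt (h z v v)", OF speed_hom S \<gamma>(4)])
        (use image_affinity_atLeastAtMost[of "-1" 1 0 "1::real"] in auto)
    moreover have "(\<lambda>t. \<gamma> (-1 * t + 1)) = reversepath \<gamma>"
      by (auto simp: reversepath_def)
    ultimately show "L \<in> P y x"
      using \<gamma>(1-3) unfolding P_def by (auto intro!: exI[of _ "reversepath \<gamma>"] simp: fun_eq_iff)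
  qed
  interpret M: Metric_space UNIV "riem_dist h"
  proof
    show nonneg': "0 \<le> riem_dist h x y" for x y
      unfolding dist_eq using line[of x y] P_nonneg by (intro cInf_greatest) blast+
    show "riem_dist h x y = riem_dist h y x" for x y
      using P_sym[of x y] P_sym[of y x] by (simp add: dist_eq antisym)
    show "riem_dist h x y = 0 \<longleftrightarrow> x = y" for x y
    proof
      assume "riem_dist h x y = 0"
      then have "ln (1 + (norm (y - x))\<^sup>2) \<le> 0"
        using dist_lower[of y x] by simp
      then show "x = y"
        by (simp add: add_pos_nonneg)
    next
      assume "x = y"
      then show "riem_dist h x y = 0"
        using dist_upper[of x y] nonneg'[of x y] by simp
    qed
    show "riem_dist h x z \<le> riem_dist h x y + riem_dist h y z" for x y z
    proof -
      have "riem_dist h x z \<le> L1 + L2" if L: "L1 \<in> P x y" "L2 \<in> P y z" for L1 L2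
      proof -
        obtain \<gamma>1 where 1: "valid_path \<gamma>1" "pathstart \<gamma>1 = x" "pathfinish \<gamma>1 = y"
          "((\<lambda>t. sqrt (h (\<gamma>1 t) (vector_derivative \<gamma>1 (at t)) (vector_derivative \<gamma>1 (at t)))) has_integral L1) {0..1}"
          using L(1) by (auto simp: P_def)
        obtain \<gamma>2 where 2: "valid_path \<gamma>2" "pathstart \<gamma>2 = y" "pathfinish \<gamma>2 = z"
          "((\<lambda>t. sqrt (h (\<gamma>2 t) (vector_derivative \<gamma>2 (at t)) (vector_derivative \<gamma>2 (at t)))) has_integral L2) {0..1}"
          using L(2) by (auto simp: P_def)
        have "L1 + L2 \<in> P x z"
          unfolding P_def using 1 2
          by (intro CollectI exI[of _ "\<gamma>1 +++ \<gamma>2"] conjI valid_path_join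
              speed_join_has_integral[where N = "\<lambda>z v. sqrt (h z v v)", OF speed_hom]) auto
        then show ?thesis
          unfolding dist_eq using P_nonneg by (metis bdd_below.I cInf_lower)
      qed
      note sum = this
      have "riem_dist h x z - L1 \<le> riem_dist h y z" if L1: "L1 \<in> P x y" for L1
        unfolding dist_eq[of y z]
      proof (rule cInf_greatest)
        show "P y z \<noteq> {}" using line[of y z] by blast
        show "riem_dist h x z - L1 \<le> L2" if "L2 \<in> P y z" for L2
          using sum[OF L1 that] by simp
      qed
      then have le: "riem_dist h x z - riem_dist h y z \<le> L1" if "L1 \<in> P x y" for L1
        using that by fastforce
      have "riem_dist h x z - riem_dist h y z \<le> riem_dist h x y"
        unfolding dist_eq[of x y] by (rule cInf_greatest) (use line[of x y] le in blast)+
      then show ?thesis by simp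
    qed
  qed
  show ?thesis
    unfolding complete_metric_def M.mcomplete_def M.MCauchy_def
  proof (intro allI impI, elim conjE)
    fix \<sigma> :: "nat \<Rightarrow> 'a"
    assume cauchy: "\<forall>\<epsilon>>0. \<exists>N. \<forall>n n'. N \<le> n \<longrightarrow> N \<le> n' \<longrightarrow> riem_dist h (\<sigma> n) (\<sigma> n') < \<epsilon>"
    have close: "(norm (y - x))\<^sup>2 < exp e - 1"
      if "sqrt (8 * (1 + (norm x)\<^sup>2) / k) \<le> K" "K > 0" "riem_dist h x y < e / K" "e > 0" for x y K e
    proof -
      have "ln (1 + (norm (y - x))\<^sup>2) \<le> sqrt (8 * (1 + (norm x)\<^sup>2) / k) * riem_dist h x y"
        by (rule dist_lower)
      also have "\<dots> < e"
      proof (cases "riem_dist h x y \<le> 0")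
        case True
        then have "sqrt (8 * (1 + (norm x)\<^sup>2) / k) * riem_dist h x y \<le> 0"
          using k by (intro mult_nonneg_nonpos) auto
        then show ?thesis using that by linarith
      next
        case False
        then have "sqrt (8 * (1 + (norm x)\<^sup>2) / k) * riem_dist h x y \<le> K * riem_dist h x y"
          using that by (intro mult_right_mono) auto
        also have "\<dots> < e" using that by (simp add: field_simps)
        finally show ?thesis .
      qed
      finally have "exp (ln (1 + (norm (y - x))\<^sup>2)) < exp e"
        by simp
      then show ?thesis by (simp add: add_pos_nonneg)
    qed
    \<comment> \<open>The constant in \<open>dist_lower\<close> depends on the base point.
      Comparison with the single point \<open>\<sigma> N\<close> bounds the tail, after which one
      constant \<open>K\<close> serves for all later base points.\<close>
    obtain N where N: "\<And>n n'. N \<le> n \<Longrightarrow> N \<le> n' \<Longrightarrow> riem_dist h (\<sigma> n) (\<sigma> n') < 1"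
      using cauchy zero_less_one by blast
    define K0 where "K0 = sqrt (8 * (1 + (norm (\<sigma> N))\<^sup>2) / k)"
    have K0: "K0 > 0" using k by (simp add: K0_def add_pos_nonneg)
    have "(norm (\<sigma> n - \<sigma> N))\<^sup>2 < exp K0 - 1" if "n \<ge> N" for n
      using close[of "\<sigma> N" K0 "\<sigma> n" K0, folded K0_def, OF order_refl K0 _ K0] N[of N n] that K0 by simp
    then have "norm (\<sigma> n) \<le> norm (\<sigma> N) + sqrt (exp K0 - 1)" if "n \<ge> N" for n
      using norm_triangle_sub[of "\<sigma> n" "\<sigma> N"] real_le_rsqrt[of "norm (\<sigma> n - \<sigma> N)" "exp K0 - 1"] that
      by fastforce
    then obtain R where R: "\<And>n. n \<ge> N \<Longrightarrow> norm (\<sigma> n) \<le> R"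
      by blast
    define K where "K = sqrt (8 * (1 + R\<^sup>2) / k)"
    have K: "K > 0" using k by (simp add: K_def add_pos_nonneg)
    have KR: "sqrt (8 * (1 + (norm (\<sigma> n))\<^sup>2) / k) \<le> K" if "n \<ge> N" for n
      unfolding K_def using k power_mono[OF R[OF that], of 2] by (simp add: divide_right_mono)
    have "Cauchy \<sigma>"
      unfolding Cauchy_iff
    proof (intro allI impI)
      fix e :: real assume e: "e > 0"
      define d where "d = ln (1 + e\<^sup>2)"
      have d: "d > 0" "exp d - 1 = e\<^sup>2"
        using e by (simp_all add: d_def add_pos_pos)
      obtain M where M: "\<And>n n'. M \<le> n \<Longrightarrow> M \<le> n' \<Longrightarrow> riem_dist h (\<sigma> n) (\<sigma> n') < d / K"
        using cauchy d K by (meson divide_pos_pos)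
      show "\<exists>M. \<forall>m\<ge>M. \<forall>n\<ge>M. norm (\<sigma> m - \<sigma> n) < e"
      proof (intro exI[of _ "max M N"] allI impI)
        fix m n assume "m \<ge> max M N" "n \<ge> max M N"
        then have "(norm (\<sigma> m - \<sigma> n))\<^sup>2 < e\<^sup>2"
          using close[OF KR K M d(1), of n m] d by simp
        then show "norm (\<sigma> m - \<sigma> n) < e"
          using e by (simp add: power2_less_imp_less)
      qed
    qed
    then obtain l where l: "\<sigma> \<longlonglongrightarrow> l"
      using Cauchy_convergent_iff convergent_def by blast
    have "((\<lambda>n. sqrt C * norm (\<sigma> n - l)) \<longlongrightarrow> sqrt C * norm (l - l)) sequentially"
      by (intro tendsto_intros l)
    then have lim: "((\<lambda>n. sqrt C * norm (\<sigma> n - l)) \<longlongrightarrow> 0) sequentially"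
      by simp
    have "limitin M.mtopology \<sigma> l sequentially"
      unfolding M.limitin_metric
    proof (intro conjI allI impI UNIV_I)
      fix e :: real assume "e > 0"
      then have "eventually (\<lambda>n. sqrt C * norm (\<sigma> n - l) < e) sequentially"
        using order_tendstoD(2)[OF lim] by blast
      then show "eventually (\<lambda>n. \<sigma> n \<in> UNIV \<and> riem_dist h (\<sigma> n) l < e) sequentially"
      proof eventually_elim
        case (elim n)
        then show ?case
          using dist_upper[of "\<sigma> n" l] by (simp add: norm_minus_commute)
      qed
    qed
    then show "\<exists>l. limitin M.mtopology \<sigma> l sequentially"
      by blast
  qed
qed

section \<open>Existence\<close>

context
  fixes n :: nat
  assumes n: "0 < n"
begin

lemma prof_coeff_1_minus: "x \<ge> 0 \<Longrightarrow> 1 - x * (prof_coeff n x * mom 0 n (prof n x)) = mom_quot n (prof n x)"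
  using mom_rec0[OF n, of "prof n x"] prof_eq_coeff[OF n, of x] by (simp add: mult_ac)

text \<open>Write c, w, y for \<open>mom 0 n\<close>, \<open>mom 1 n\<close>,
  \<open>mom_quot n\<close> at t. From A' = - A^2 c and t' = A y one gets p = - A c and p' = A^2
  (c^2 + y w). Since 1 + x p = y, the quotient (p' - p^2) / (1 + x p) is q = A^2 w.\<close>

lemma radial_metric_prof:
  "radial_metric (prof_coeff n) (\<lambda>x. - (prof_coeff n x * mom 0 n (prof n x)))
     (\<lambda>x. (prof_coeff n x)\<^sup>2 * mom 1 n (prof n x))
     (\<lambda>x. (prof_coeff n x)\<^sup>2 * ((mom 0 n (prof n x))\<^sup>2 + mom_quot n (prof n x) * mom 1 n (prof n x)))
     (\<lambda>x. - (prof_coeff n x ^ 3 * (2 * mom 0 n (prof n x) * mom 1 n (prof n x) + mom_quot n (prof n x) * mom 2 n (prof n x))))"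
proof
  fix x :: real assume x: "x \<ge> 0"
  have mom: "((\<lambda>x. mom j l (prof n x)) has_real_derivative
      - mom (Suc j) l (prof n x) * (prof_coeff n x * mom_quot n (prof n x))) (at x)" for j l
    by (rule DERIV_chain2[OF mom_deriv prof_deriv[OF n x]])
  note ders = derivative_eq_intros mom prof_coeff_deriv[OF n x]
  show "(prof_coeff n has_real_derivative prof_coeff n x * - (prof_coeff n x * mom 0 n (prof n x))) (at x)"
    using prof_coeff_deriv[OF n x] by (simp add: power2_eq_square mult_ac)
  show "((\<lambda>x. - (prof_coeff n x * mom 0 n (prof n x))) has_real_derivative
      (prof_coeff n x)\<^sup>2 * ((mom 0 n (prof n x))\<^sup>2 + mom_quot n (prof n x) * mom 1 n (prof n x))) (at x)"
    by (rule ders refl)+ (simp add: power2_eq_square algebra_simps)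
  show "((\<lambda>x. (prof_coeff n x)\<^sup>2 * mom 1 n (prof n x)) has_real_derivative
     - (prof_coeff n x ^ 3 * (2 * mom 0 n (prof n x) * mom 1 n (prof n x) + mom_quot n (prof n x) * mom 2 n (prof n x)))) (at x)"
    by (rule ders refl)+ (simp add: power2_eq_square power3_eq_cube numeral_2_eq_2 algebra_simps)
  show "prof_coeff n x > 0"
    by (rule prof_coeff_pos[OF n])
  show "1 + x * - (prof_coeff n x * mom 0 n (prof n x)) > 0"
    using prof_coeff_1_minus[OF x] mom_quot_pos[OF n, of "prof n x"] by simp
  show "(prof_coeff n x)\<^sup>2 * ((mom 0 n (prof n x))\<^sup>2 + mom_quot n (prof n x) * mom 1 n (prof n x)) =
      (prof_coeff n x)\<^sup>2 * mom 1 n (prof n x) + (- (prof_coeff n x * mom 0 n (prof n x)))\<^sup>2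
      + x * - (prof_coeff n x * mom 0 n (prof n x)) * ((prof_coeff n x)\<^sup>2 * mom 1 n (prof n x))"
    unfolding prof_coeff_1_minus[OF x, symmetric] by (simp add: power2_eq_square algebra_simps)
qed

text \<open>Simultaneous induction: the derivatives of these functions are polynomials in the same
  functions and the coordinates. All moments have to be included because differentiation raises the
  index \<open>j\<close>.\<close>

lemma C_k_prof:
  "C_k k (\<lambda>z::'a::euclidean_space. prof_coeff n ((norm z)\<^sup>2)) \<and>
   (\<forall>j l. C_k k (\<lambda>z::'a. mom j l (prof n ((norm z)\<^sup>2))))"
proof (induction k)
  case 0
  have "isCont (\<lambda>z::'a. prof_coeff n ((norm z)\<^sup>2)) z" "isCont (\<lambda>z::'a. mom j l (prof n ((norm z)\<^sup>2))) z" for z j l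
    by (rule has_derivative_continuous[OF radial_fun_has_derivative[OF prof_coeff_deriv[OF n]]], simp)
      (rule has_derivative_continuous[OF radial_fun_has_derivative[OF DERIV_chain2[OF mom_deriv prof_deriv[OF n]]]], simp)
  then show ?case
    by (simp add: continuous_at_imp_continuous_on)
next
  case (Suc k)
  have lin: "C_k k (\<lambda>z::'a. 2 * (z \<bullet> v))" for v
    by (rule C_k_compose_linear[OF bounded_linear_mult_right C_k_linear[OF bounded_linear_inner_left]])
  have mq: "C_k k (\<lambda>z::'a. mom_quot n (prof n ((norm z)\<^sup>2)))"
    unfolding mom_quot_def using Suc.IH by (intro C_k_compose_linear[OF bounded_linear_mult_right]) blast
  show ?case
  proof (intro conjI allI)
    show "C_k (Suc k) (\<lambda>z::'a. prof_coeff n ((norm z)\<^sup>2))"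
    proof (rule C_k_SucI[OF radial_fun_has_derivative[OF prof_coeff_deriv[OF n zero_le_power2]]])
      show "C_k k (\<lambda>z::'a. 2 * (z \<bullet> v) * - ((prof_coeff n ((norm z)\<^sup>2))\<^sup>2 * mom 0 n (prof n ((norm z)\<^sup>2))))" for v
        unfolding power2_eq_square[of "prof_coeff n _"] using Suc.IH by (intro C_k_mult C_k_uminus lin) auto
    qed
    show "C_k (Suc k) (\<lambda>z::'a. mom j l (prof n ((norm z)\<^sup>2)))" for j l
    proof (rule C_k_SucI[OF radial_fun_has_derivative[OF DERIV_chain2[OF mom_deriv prof_deriv[OF n zero_le_power2]]]])
      show "C_k k (\<lambda>z::'a. 2 * (z \<bullet> v) * (- mom (Suc j) l (prof n ((norm z)\<^sup>2)) *
         (prof_coeff n ((norm z)\<^sup>2) * mom_quot n (prof n ((norm z)\<^sup>2)))))" for v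
        using Suc.IH by (intro C_k_mult C_k_uminus lin mq) auto
    qed
  qed
qed

lemma smooth_prof: "smooth (\<lambda>z::'a::euclidean_space. prof n ((norm z)\<^sup>2))"
  unfolding smooth_def
proof
  fix k
  have "C_k (Suc k) (\<lambda>z::'a. prof n ((norm z)\<^sup>2))"
  proof (rule C_k_SucI[OF radial_fun_has_derivative[OF prof_deriv[OF n zero_le_power2]]])
    have lin: "C_k k (\<lambda>z::'a. 2 * (z \<bullet> v))" for v
      by (rule C_k_compose_linear[OF bounded_linear_mult_right C_k_linear[OF bounded_linear_inner_left]])
    show "C_k k (\<lambda>z::'a. 2 * (z \<bullet> v) * (prof_coeff n ((norm z)\<^sup>2) * mom_quot n (prof n ((norm z)\<^sup>2))))" for v
      unfolding mom_quot_def using C_k_prof[of k]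
      by (intro C_k_mult lin C_k_compose_linear[OF bounded_linear_mult_right]) auto
  qed
  then show "C_k k (\<lambda>z::'a. prof n ((norm z)\<^sup>2))"
    by (rule C_k_Suc_D)
qed

interpretation prof: radial_metric "prof_coeff n" "\<lambda>x. - (prof_coeff n x * mom 0 n (prof n x))"
     "\<lambda>x. (prof_coeff n x)\<^sup>2 * mom 1 n (prof n x)"
     "\<lambda>x. (prof_coeff n x)\<^sup>2 * ((mom 0 n (prof n x))\<^sup>2 + mom_quot n (prof n x) * mom 1 n (prof n x))"
     "\<lambda>x. - (prof_coeff n x ^ 3 * (2 * mom 0 n (prof n x) * mom 1 n (prof n x) + mom_quot n (prof n x) * mom 2 n (prof n x)))"
  by (rule radial_metric_prof)

lemma smooth_g_prof: "smooth prof.g"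
  unfolding smooth_def
proof
  fix k
  have lin: "bounded_linear (\<lambda>z::complex^'n. cnj (z $ i))" for i
    by (intro bounded_linear_compose[OF bounded_linear_cnj] bounded_linear_vec_nth)
  have ite: "C_k k (\<lambda>z::complex^'n. if i = j then complex_of_real (prof_coeff n ((norm z)\<^sup>2)) else 0)" for i j
    using C_k_compose_linear[OF bounded_linear_of_real conjunct1[OF C_k_prof[of k]]] C_k_const
    by (cases "i = j") simp_all
  show "C_k k (prof.g :: 'n::finite herm_field)"
    unfolding prof.g_def radial_herm_def[abs_def]
    by (intro C_k_vec, unfold vec_lambda_beta)
      (intro C_k_add ite C_k_mult C_k_compose_linear[OF bounded_linear_of_real] C_k_uminus C_k_linear lin
        bounded_linear_vec_nth conjunct1[OF C_k_prof] conjunct2[OF C_k_prof, rule_format])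
qed

text \<open>The recurrences from integration by parts collect the polynomials in A, t and the
  moments of level n into moments of level n - 1, whose signs are known.\<close>

lemma curvature_coeffs:
  assumes "x \<ge> 0"
  defines "A \<equiv> prof_coeff n x" and "t \<equiv> prof n x"
  shows "prof.k0 x = A\<^sup>2 * mom 0 n t"
    and "prof.k0 x + x * prof.k1 x = A\<^sup>2 * mom_quot n t * (real n * mom 1 (n - 1) t)"
    and "2 * prof.k0 x + 4 * x * prof.k1 x + x\<^sup>2 * prof.k2 x
      = (A * mom_quot n t)\<^sup>2 * (2 * real n * mom 1 (n - 1) t - t * real n * mom 2 (n - 1) t)"
proof -
  define y c w1 w2 where "y = mom_quot n t" and "c = mom 0 n t" and "w1 = mom 1 n t" and "w2 = mom 2 n t"
  have t: "t = x * A"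
    using prof_eq_coeff[OF n assms(1)] by (simp add: t_def A_def)
  have y: "y = 1 - t * c"
    using mom_rec0[OF n, of t] by (simp add: y_def c_def)
  have w1: "real n * mom 1 (n - 1) t = c - t * w1"
    using mom_rec1[OF n, of t] unfolding c_def w1_def by linarith
  have w2: "real n * mom 2 (n - 1) t = 2 * w1 - t * w2"
    using mom_rec2[OF n, of t] unfolding w1_def w2_def by linarith
  show "prof.k0 x = A\<^sup>2 * mom 0 n t"
    by (simp add: prof.k0_def A_def t_def power2_eq_square)
  show "prof.k0 x + x * prof.k1 x = A\<^sup>2 * mom_quot n t * (real n * mom 1 (n - 1) t)"
    unfolding w1 prof.k0_def prof.k1_def
    unfolding A_def[symmetric] t_def[symmetric] y_def[symmetric] c_def[symmetric] w1_def[symmetric]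
    unfolding y t by algebra
  have "2 * real n * mom 1 (n - 1) t - t * real n * mom 2 (n - 1) t = 2 * (c - t * w1) - t * (2 * w1 - t * w2)"
    unfolding w1[symmetric] w2[symmetric] by simp
  then show "2 * prof.k0 x + 4 * x * prof.k1 x + x\<^sup>2 * prof.k2 x
      = (A * mom_quot n t)\<^sup>2 * (2 * real n * mom 1 (n - 1) t - t * real n * mom 2 (n - 1) t)"
    unfolding prof.k0_def prof.k1_def prof.k2_def
    unfolding A_def[symmetric] t_def[symmetric] y_def[symmetric] c_def[symmetric] w1_def[symmetric] w2_def[symmetric]
    unfolding y t by algebra
qed

definition cao_metric :: "'n::finite herm_field" where
  "cao_metric = radial_herm (prof_coeff n) (\<lambda>x. - ((prof_coeff n x)\<^sup>2 * mom 0 n (prof n x)))"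

lemma cao_metric_eq: "cao_metric = prof.g"
  by (simp add: cao_metric_def prof.g_def power2_eq_square mult.assoc)

lemma complete_rot_sym_positive_soliton_cao_metric:
  assumes "n = CARD('n)"
  shows "complete_rot_sym_positive_soliton (cao_metric :: 'n::finite herm_field)"
  unfolding complete_rot_sym_positive_soliton_def cao_metric_eq
proof (intro conjI)
  show "gradient_kr_soliton (prof.g :: 'n herm_field)"
  proof (rule prof.gradient_kr_soliton_g[OF smooth_g_prof smooth_prof])
    fix x :: real assume x: "x \<ge> 0"
    show "(prof n has_real_derivative prof_coeff n x * (1 + x * - (prof_coeff n x * mom 0 n (prof n x)))) (at x)"
      using prof_deriv[OF n x] prof_coeff_1_minus[OF x] by simp
    show "prof_coeff n x ^ CARD('n) * (1 + x * - (prof_coeff n x * mom 0 n (prof n x))) = exp (- prof n x)"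
      using prof_volume[OF n x] prof_coeff_1_minus[OF x] by (simp add: assms)
  qed
  show "rotationally_symmetric (prof.g :: 'n herm_field)"
    unfolding prof.g_def by (rule rotationally_symmetric_radial)
  show "positive_sectional_curv (riem_of (prof.g :: 'n herm_field))"
  proof (rule prof.positive_sectional_curv_g)
    fix x :: real assume x: "x \<ge> 0"
    note cc = curvature_coeffs[OF x]
    have A: "prof_coeff n x > 0" and y: "mom_quot n (prof n x) > 0"
      by (rule prof_coeff_pos[OF n] mom_quot_pos[OF n])+
    show "prof.k0 x > 0"
      unfolding cc(1) using A mom_pos by simp
    show "prof.k0 x + x * prof.k1 x > 0"
      unfolding cc(2) using A y n mom_pos by simp
    show "2 * prof.k0 x + 4 * x * prof.k1 x + x\<^sup>2 * prof.k2 x > 0"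
      unfolding cc(3) by (intro mult_pos_pos mom_second_pos[OF n]) (use A y in simp)
    have "(prof.k0 x + x * prof.k1 x)\<^sup>2 < 2 * (2 * prof.k0 x + 4 * x * prof.k1 x + x\<^sup>2 * prof.k2 x) * prof.k0 x"
      if "n \<noteq> 1"
    proof -
      let ?t = "prof n x"
      let ?b = "real n * mom 1 (n - 1) ?t" and ?a = "2 * real n * mom 1 (n - 1) ?t - ?t * real n * mom 2 (n - 1) ?t"
      let ?m = "(prof_coeff n x ^ 2 * mom_quot n ?t)\<^sup>2"
      have "(prof.k0 x + x * prof.k1 x)\<^sup>2 = ?m * ?b\<^sup>2"
        unfolding cc(2) by (simp only: power_mult_distrib)
      also have "\<dots> < ?m * (2 * ?a * mom 0 n ?t)"
        using A y by (intro mult_strict_left_mono mom_discriminant[OF n that]) simp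
      also have "\<dots> = 2 * (2 * prof.k0 x + 4 * x * prof.k1 x + x\<^sup>2 * prof.k2 x) * prof.k0 x"
        unfolding cc(3) unfolding cc(1) by (simp only: power2_eq_square mult_ac)
      finally show ?thesis .
    qed
    then show "CARD('n) = 1 \<or> (prof.k0 x + x * prof.k1 x)\<^sup>2 < 2 * (2 * prof.k0 x + 4 * x * prof.k1 x + x\<^sup>2 * prof.k2 x) * prof.k0 x"
      unfolding assms[symmetric] by blast
  qed
  obtain k where k: "k > 0" "\<And>x. x \<ge> 0 \<Longrightarrow> k / (1 + x) \<le> prof_coeff n x * mom_quot n (prof n x)"
    using prof_deriv_lower_bound[OF n] by blast
  show "complete_metric (riem_of (prof.g :: 'n herm_field))"
  proof (rule complete_metric_of_bounds[OF k(1)])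
    fix z v :: "complex^'n" and c :: real
    let ?x = "(norm z)\<^sup>2"
    have A: "prof_coeff n ?x > 0" and c: "mom 0 n (prof n ?x) > 0"
      by (rule prof_coeff_pos[OF n] mom_pos)+
    have "cdot v z * cdot z v = of_real ((cmod (cdot v z))\<^sup>2)"
      by (simp only: cdot_commute[of v z] complex_norm_square) simp
    then have eq: "riem_of prof.g z v v = prof_coeff n ?x
       * ((norm v)\<^sup>2 - prof_coeff n ?x * mom 0 n (prof n ?x) * (cmod (cdot v z))\<^sup>2)"
      by (simp add: prof.riem_of_g cdot_self)
    have "(cmod (cdot v z))\<^sup>2 \<le> (norm v)\<^sup>2 * ?x"
      using power_mono[OF cdot_Cauchy_Schwarz[of v z], of 2] by (simp add: power_mult_distrib)
    then have "prof_coeff n ?x * mom 0 n (prof n ?x) * (cmod (cdot v z))\<^sup>2 \<le> prof_coeff n ?x * mom 0 n (prof n ?x) * ((norm v)\<^sup>2 * ?x)"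
      using A c by (intro mult_left_mono) auto
    \<comment> \<open>The metric is at least its radial eigenvalue B times the Euclidean one, and
      \<open>k(2)\<close> bounds B.\<close>
    then have "mom_quot n (prof n ?x) * (norm v)\<^sup>2 \<le> (norm v)\<^sup>2 - prof_coeff n ?x * mom 0 n (prof n ?x) * (cmod (cdot v z))\<^sup>2"
      unfolding prof_coeff_1_minus[OF zero_le_power2, symmetric] by (simp add: algebra_simps)
    then have "prof_coeff n ?x * (mom_quot n (prof n ?x) * (norm v)\<^sup>2) \<le> riem_of prof.g z v v"
      unfolding eq using A by (intro mult_left_mono) auto
    moreover have "k / (1 + ?x) * (norm v)\<^sup>2 \<le> prof_coeff n ?x * mom_quot n (prof n ?x) * (norm v)\<^sup>2"
      by (intro mult_right_mono k(2)) auto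
    ultimately show "k / (1 + ?x) * (norm v)\<^sup>2 \<le> riem_of prof.g z v v"
      by (simp add: mult.assoc)
    have "riem_of prof.g z v v \<le> prof_coeff n ?x * (norm v)\<^sup>2"
      unfolding eq using A c by (intro mult_left_mono) auto
    also have "prof_coeff n ?x \<le> 1"
      using prof_factor_mono[OF n prof_nonneg[OF n zero_le_power2[of "norm z"]]] prof_factor_0[OF n]
        prof_factor_pos[OF n, of "prof n ?x"]
      by (simp add: prof_coeff_def divide_le_eq)
    finally show "riem_of prof.g z v v \<le> 1 * (norm v)\<^sup>2"
      by (simp add: mult_right_mono)
    show "continuous_on UNIV (\<lambda>z. riem_of prof.g z v v)"
      by (rule continuous_at_imp_continuous_on) (use has_derivative_continuous[OF prof.riem_of_g_deriv] in blast)
    show "riem_of prof.g z (c *\<^sub>R v) (c *\<^sub>R v) = c\<^sup>2 * riem_of prof.g z v v"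
      by (simp add: prof.riem_of_g_bilinear power2_eq_square)
  qed
qed

end

section \<open>The equation for the profile\<close>

text \<open>The profile equations are available for r > 0 only; continuity carries the constant to r
  = 0.\<close>

lemma const_from_zero_deriv:
  fixes F :: "real \<Rightarrow> real"
  assumes "continuous_on {0..} F" "\<And>r. r > 0 \<Longrightarrow> (F has_real_derivative 0) (at r)" "r \<ge> 0"
  shows "F r = F 0"
proof (cases "r = 0")
  case False
  show ?thesis
    by (rule DERIV_isconst2[of 0 r]) (use False assms in \<open>auto intro: continuous_on_subset\<close>)
qed simp

lemma power_le_exp:
  fixes x :: real
  assumes "x \<ge> 0"
  shows "x ^ k \<le> fact k * exp x"
proof -
  have "(\<Sum>i\<in>{k}. x ^ i /\<^sub>R fact i) \<le> (\<Sum>i. x ^ i /\<^sub>R fact i)"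
    by (rule sum_le_suminf) (use assms summable_exp_generic[of x] in auto)
  then show ?thesis
    by (simp add: exp_def field_simps)
qed

text \<open>On the sphere of radius r, \<open>a\<close> and \<open>b\<close> are the tangential and
  radial eigenvalues of the metric, and \<open>\<phi>\<close> is the function t = x A read at x =
  r^2. \<open>volume\<close> integrates (log det g)' = - v B, with \<open>C\<close> the determinant
  at the origin.\<close>

locale soliton_profile =
  fixes n :: nat and v C :: real and a b \<phi> :: "real \<Rightarrow> real"
  assumes n: "n > 0" and C: "C > 0"
    and \<phi>_cont: "continuous_on {0..} \<phi>" and \<phi>_0: "\<phi> 0 = 0"
    and \<phi>_eq: "r > 0 \<Longrightarrow> \<phi> r = r\<^sup>2 * a r"
    and \<phi>_deriv: "r > 0 \<Longrightarrow> (\<phi> has_real_derivative 2 * r * b r) (at r)"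
    and a_pos: "r > 0 \<Longrightarrow> a r > 0" and b_pos: "r > 0 \<Longrightarrow> b r > 0"
    and volume: "r > 0 \<Longrightarrow> b r * a r ^ (n - 1) * exp (v * \<phi> r) = C"
begin

lemma \<phi>_pos: "r > 0 \<Longrightarrow> \<phi> r > 0"
  using a_pos \<phi>_eq by simp

text \<open>Eliminating \<open>a\<close> from \<open>volume\<close> leaves a separable equation for
  \<open>\<phi>\<close>.\<close>

lemma \<phi>_ode:
  assumes "r > 0"
  shows "\<phi> r ^ (n - 1) * exp (v * \<phi> r) * (2 * r * b r) = 2 * C * r ^ (2 * n - 1)"
proof -
  have e: "2 * n - 1 = Suc (2 * (n - 1))"
    using n by simp
  show ?thesis
    unfolding volume[OF assms, symmetric] \<phi>_eq[OF assms] e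
    by (simp add: power_mult_distrib power_mult)
qed

text \<open>If \<open>v < 0\<close>, then \<open>exp (v / 2 * \<phi> r)\<close> is bounded, but its derivative is bounded away from 0 for \<open>r \<ge> 1\<close>.\<close>

lemma v_nonneg: "v \<ge> 0"
proof (rule ccontr)
  assume "\<not> v \<ge> 0"
  \<comment> \<open>Half of the decay of \<open>exp (v * \<phi> r)\<close> absorbs the power of
    \<open>\<phi>\<close>; the other half remains integrable.\<close>
  define w where "w = - v / 2"
  have w: "w > 0" using \<open>\<not> v \<ge> 0\<close> by (simp add: w_def)
  define K where "K = fact (n - 1) / w ^ (n - 1)"
  have K: "K > 0" using w by (simp add: K_def)
  have bound: "t ^ (n - 1) \<le> K * exp (w * t)" if "t \<ge> 0" for t
    using power_le_exp[of "w * t" "n - 1"] that w by (simp add: K_def field_simps power_mult_distrib)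
  let ?\<Psi> = "\<lambda>r. - (K / w) * exp (- w * \<phi> r)"
  \<comment> \<open>Chosen so that \<open>(?R - 1) * (2 * C)\<close>, the least growth of
    \<open>?\<Psi>\<close> on [1, \<open>?R\<close>], exceeds its greatest possible growth
    \<open>K / w\<close>.\<close>
  let ?R = "2 + K / w / (2 * C)"
  have R: "?R > 1" using K w C by (simp add: add_pos_pos)
  have der: "(?\<Psi> has_real_derivative K * exp (- w * \<phi> r) * (2 * r * b r)) (at r)" if "r > 0" for r
    using w by (auto intro!: derivative_eq_intros \<phi>_deriv[OF that])
  obtain z where z: "z > 1" "z < ?R" "?\<Psi> ?R - ?\<Psi> 1 = (?R - 1) * (K * exp (- w * \<phi> z) * (2 * z * b z))"
    using MVT2[OF R, of ?\<Psi> "\<lambda>r. K * exp (- w * \<phi> r) * (2 * r * b r)"] der by auto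
  have "2 * C * 1 \<le> 2 * C * z ^ (2 * n - 1)"
    using z C by (intro mult_left_mono one_le_power) auto
  also have "\<dots> = \<phi> z ^ (n - 1) * exp (v * \<phi> z) * (2 * z * b z)"
    using \<phi>_ode[of z] z by simp
  also have "\<dots> \<le> (K * exp (w * \<phi> z)) * exp (v * \<phi> z) * (2 * z * b z)"
    using z b_pos[of z] \<phi>_pos[of z] by (intro mult_right_mono bound) auto
  also have "\<dots> = K * exp (- w * \<phi> z) * (2 * z * b z)"
    by (simp add: w_def mult.assoc[symmetric]) (simp add: mult.assoc exp_add[symmetric])
  finally have "(?R - 1) * (2 * C) \<le> ?\<Psi> ?R - ?\<Psi> 1"
    unfolding z(3) using R by (intro mult_left_mono) auto
  also have "\<dots> \<le> K / w"
  proof -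
    have "K / w * exp (- w * \<phi> 1) \<le> K / w * 1"
      using K w \<phi>_pos[of 1] by (intro mult_left_mono) auto
    moreover have "?\<Psi> ?R \<le> 0" using K w by simp
    ultimately show ?thesis by simp
  qed
  finally show False
    using C by (simp add: field_simps)
qed

text \<open>The n-th power of \<open>t * prof_factor n t\<close> is a primitive of n t^(n-1) e^t.
  Hence by \<open>\<phi>_ode\<close> both sides have the same derivative in r, and both vanish at r
  = 0.\<close>

lemma prof_unscaled:
  assumes "r > 0"
  shows "(v * \<phi> r * prof_factor n (v * \<phi> r)) ^ n = v ^ n * C * r ^ (2 * n)"
proof -
  let ?X = "\<lambda>t. t * prof_factor n t"
  let ?F = "\<lambda>r. (?X (v * \<phi> r)) ^ n - v ^ n * C * r ^ (2 * n)"
  have X_deriv: "((\<lambda>t. ?X t ^ n) has_real_derivative real n * t ^ (n - 1) * exp t) (at t)" for t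
  proof -
    have "((\<lambda>t. ?X t ^ n) has_real_derivative real n * ((prof_factor n t / mom_quot n t) * ?X t ^ (n - 1))) (at t)"
      using DERIV_power[OF prof_inv_deriv[OF n], where n = n] by (simp add: mult_ac)
    also have "(prof_factor n t / mom_quot n t) * ?X t ^ (n - 1) = t ^ (n - 1) * prof_factor n t ^ n / mom_quot n t"
      by (simp add: power_mult_distrib power_minus_mult[OF n, symmetric])
    also have "\<dots> = t ^ (n - 1) * exp t"
      using mom_quot_pos[OF n, of t] by (simp add: prof_factor_pow[OF n])
    finally show ?thesis by (simp add: mult.assoc)
  qed
  have "(?F has_real_derivative 0) (at r)" if r: "r > 0" for r
  proof -
    have "((\<lambda>r. (?X (v * \<phi> r)) ^ n) has_real_derivative
        real n * (v * \<phi> r) ^ (n - 1) * exp (v * \<phi> r) * (v * (2 * r * b r))) (at r)"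
      using DERIV_chain2[OF X_deriv DERIV_cmult[OF \<phi>_deriv[OF r]]] by simp
    also have "real n * (v * \<phi> r) ^ (n - 1) * exp (v * \<phi> r) * (v * (2 * r * b r))
       = real n * (v ^ (n - 1) * v) * (\<phi> r ^ (n - 1) * exp (v * \<phi> r) * (2 * r * b r))"
      by (simp add: power_mult_distrib)
    also have "\<dots> = v ^ n * C * (real (2 * n) * r ^ (2 * n - 1))"
      unfolding \<phi>_ode[OF r] power_minus_mult[OF n] by simp
    finally have 1: "((\<lambda>r. (?X (v * \<phi> r)) ^ n) has_real_derivative v ^ n * C * (real (2 * n) * r ^ (2 * n - 1))) (at r)" .
    have 2: "((\<lambda>r. v ^ n * C * r ^ (2 * n)) has_real_derivative v ^ n * C * (real (2 * n) * r ^ (2 * n - 1))) (at r)"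
      by (rule DERIV_cmult) (use DERIV_pow[of "2 * n" r] in simp)
    show ?thesis
      using DERIV_diff[OF 1 2] by simp
  qed
  moreover have "continuous_on {0..} ?F"
  proof -
    have X: "continuous_on UNIV ?X"
      using prof_inv_cont[OF n] by (simp add: continuous_at_imp_continuous_on)
    have "continuous_on {0..} (\<lambda>r. ?X (v * \<phi> r))"
      by (rule continuous_on_compose2[OF X]) (auto intro!: continuous_intros \<phi>_cont)
    from continuous_on_diff[OF continuous_on_power[OF this]] show ?thesis
      by (simp add: continuous_intros)
  qed
  ultimately have "?F r = ?F 0"
    using const_from_zero_deriv[of ?F r] assms by simp
  then show ?thesis
    using n by (simp add: \<phi>_0 zero_power)
qed

text \<open>For \<open>v = 0\<close> the separable equation integrates to
  \<open>\<phi> r ^ n = C * r ^ (2 * n)\<close>, so the two eigenvalues are constant and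
  equal.\<close>

lemma flat_case:
  assumes "v = 0" "r > 0"
  shows "a r ^ n = C" "b r = a r"
proof -
  let ?F = "\<lambda>r. \<phi> r ^ n - C * r ^ (2 * n)"
  have "(?F has_real_derivative 0) (at r)" if r: "r > 0" for r
  proof -
    have 1: "((\<lambda>r. \<phi> r ^ n) has_real_derivative real n * (\<phi> r ^ (n - 1) * (2 * r * b r))) (at r)"
      using DERIV_power[OF \<phi>_deriv[OF r], where n = n] by (simp add: mult_ac)
    have 2: "((\<lambda>r. C * r ^ (2 * n)) has_real_derivative real n * (2 * C * r ^ (2 * n - 1))) (at r)"
      using DERIV_cmult[OF DERIV_pow[of "2 * n" r], of C] by (simp add: mult_ac)
    show ?thesis
      using DERIV_diff[OF 1 2] unfolding \<phi>_ode[OF r, simplified assms(1) mult_zero_left exp_zero mult_1_right] by simp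
  qed
  then have "?F r = ?F 0"
    using const_from_zero_deriv[of ?F r] assms(2) by (simp add: continuous_intros \<phi>_cont)
  moreover have "(r ^ n)\<^sup>2 = (r\<^sup>2) ^ n"
    by (simp only: power_mult[symmetric] mult.commute)
  ultimately have "(r\<^sup>2) ^ n * (a r ^ n - C) = 0"
    using n assms(2) by (simp add: \<phi>_0 \<phi>_eq power_mult_distrib power_mult zero_power algebra_simps)
  then show *: "a r ^ n = C"
    using assms(2) by simp
  have "b r * a r ^ (n - 1) = a r * a r ^ (n - 1)"
    using volume[OF assms(2)] * power_minus_mult[OF n, of "a r"] by (simp add: assms(1) mult.commute)
  then show "b r = a r"
    using a_pos[OF assms(2)] by simp
qed

lemma profile_unique:
  assumes "v > 0"
  obtains \<kappa> where "\<kappa> > 0" "\<And>r. r > 0 \<Longrightarrow> a r = \<kappa> / v * prof_coeff n (\<kappa> * r\<^sup>2)"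
    "\<And>r. r > 0 \<Longrightarrow> b r = \<kappa> / v * (prof_coeff n (\<kappa> * r\<^sup>2) * mom_quot n (prof n (\<kappa> * r\<^sup>2)))"
proof
  \<comment> \<open>The n-th root of the coefficient \<open>v ^ n * C\<close> in
    \<open>prof_unscaled\<close>; thus \<open>v * \<phi> r\<close> is the standard profile at
    \<open>\<kappa> * r\<^sup>2\<close>.\<close>
  define \<kappa> where "\<kappa> = v * root n C"
  show \<kappa>: "\<kappa> > 0"
    using assms n C by (simp add: \<kappa>_def)
  have \<kappa>n: "\<kappa> ^ n = v ^ n * C"
    using n C by (simp add: \<kappa>_def power_mult_distrib)
  have eq: "v * \<phi> r = prof n (\<kappa> * r\<^sup>2)" if r: "r > 0" for r
  proof -
    have "(v * \<phi> r * prof_factor n (v * \<phi> r)) ^ n = (\<kappa> * r\<^sup>2) ^ n"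
      using prof_unscaled[OF r] \<kappa>n by (simp add: power_mult_distrib power_mult)
    moreover have "0 \<le> v * \<phi> r * prof_factor n (v * \<phi> r)"
      using assms \<phi>_pos[OF r] prof_factor_pos[OF n, of "v * \<phi> r"] by simp
    ultimately have "v * \<phi> r * prof_factor n (v * \<phi> r) = \<kappa> * r\<^sup>2"
      using \<kappa> n by (metis power_eq_imp_eq_base mult_nonneg_nonneg less_imp_le zero_le_power2)
    then show ?thesis
      using prof_eqI[OF n] by metis
  qed
  show "a r = \<kappa> / v * prof_coeff n (\<kappa> * r\<^sup>2)" if r: "r > 0" for r
    using eq[OF r] \<phi>_eq[OF r] prof_eq_coeff[OF n, of "\<kappa> * r\<^sup>2"] \<kappa> r assms by (simp add: field_simps)
  show "b r = \<kappa> / v * (prof_coeff n (\<kappa> * r\<^sup>2) * mom_quot n (prof n (\<kappa> * r\<^sup>2)))" if r: "r > 0" for r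
  proof -
    have "((\<lambda>r. \<kappa> * r\<^sup>2) has_real_derivative \<kappa> * (2 * r)) (at r)"
      by (auto intro!: derivative_eq_intros)
    from DERIV_chain2[OF prof_deriv[OF n] this]
    have "((\<lambda>r. prof n (\<kappa> * r\<^sup>2)) has_real_derivative
        prof_coeff n (\<kappa> * r\<^sup>2) * mom_quot n (prof n (\<kappa> * r\<^sup>2)) * (\<kappa> * (2 * r))) (at r)"
      using \<kappa> by simp
    then have "((\<lambda>r. v * \<phi> r) has_real_derivative
        prof_coeff n (\<kappa> * r\<^sup>2) * mom_quot n (prof n (\<kappa> * r\<^sup>2)) * (\<kappa> * (2 * r))) (at r)"
      by (rule has_field_derivative_transform_within_open[of _ _ _ "{0<..}"]) (use r eq in auto)
    from DERIV_unique[OF this DERIV_cmult[OF \<phi>_deriv[OF r]]]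
    show ?thesis
      using assms r by (simp add: field_simps)
  qed
qed

end

section \<open>Restriction to a coordinate axis\<close>

text \<open>Multiply by \<open>cnj \<zeta>\<close> and integrate over the circle: the antiholomorphic right-hand side drops out.\<close>

lemma circle_average:
  fixes V E :: "complex \<Rightarrow> complex"
  assumes "V holomorphic_on UNIV" "E holomorphic_on UNIV" "r > 0"
    and eq: "\<And>\<zeta>. cmod \<zeta> = r \<Longrightarrow> c * \<zeta> + b * V \<zeta> = cnj (E \<zeta>)"
  shows "c + b * deriv V 0 = 0"
proof -
  let ?\<gamma> = "\<lambda>t. complex_of_real r * exp (2 * of_real pi * \<i> * of_real t)"
  have circ: "circlepath 0 r = ?\<gamma>"
    by (simp add: circlepath fun_eq_iff)
  have vd: "vector_derivative (circlepath 0 r) (at t within {0..1}) = 2 * of_real pi * \<i> * ?\<gamma> t" if "t \<in> {0..1}" for t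
    using vector_derivative_circlepath01[of t 0 r] that by (simp add: mult_ac)
  have norm: "cmod (?\<gamma> t) = r" for t
    using assms(3) by (simp add: norm_mult norm_exp_eq_Re)
  have nz: "?\<gamma> t \<noteq> 0" for t
    using assms(3) by simp
  have "((\<lambda>u. V u / (u - 0)\<^sup>2) has_contour_integral (2 * of_real pi * \<i>) * deriv V 0) (circlepath 0 r)"
  proof -
    have "continuous_on (cball 0 r) V" "V holomorphic_on ball 0 r"
      by (auto intro: continuous_on_subset[OF holomorphic_on_imp_continuous_on[OF assms(1)]]
          holomorphic_on_subset[OF assms(1)])
    from Cauchy_has_contour_integral_higher_derivative_circlepath[OF this, of 0 1]
    show ?thesis
      using assms(3) by (simp add: power2_eq_square)
  qed
  then have "((\<lambda>t. V (?\<gamma> t) / (?\<gamma> t)\<^sup>2 * (2 * of_real pi * \<i> * ?\<gamma> t)) has_integral (2 * of_real pi * \<i>) * deriv V 0) {0..1}"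
    unfolding has_contour_integral_def by (rule has_integral_eq[rotated]) (simp only: vd, simp only: circ diff_zero)
  from has_integral_mult_right[OF this, of "1 / (2 * of_real pi * \<i>)"]
  have 1: "((\<lambda>t. V (?\<gamma> t) / ?\<gamma> t) has_integral deriv V 0) {0..1}"
    using nz by (simp add: power2_eq_square divide_simps mult_ac)
  have "(E has_contour_integral 0) (circlepath 0 r)"
    by (rule Cauchy_theorem_convex_simple[OF assms(2)]) (use assms(3) in auto)
  then have "((\<lambda>t. E (?\<gamma> t) * (2 * of_real pi * \<i> * ?\<gamma> t)) has_integral 0) {0..1}"
    unfolding has_contour_integral_def by (rule has_integral_eq[rotated]) (simp only: vd, simp only: circ diff_zero)
  from has_integral_mult_right[OF this, of "1 / (2 * of_real pi * \<i>)"]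
  have "((\<lambda>t. E (?\<gamma> t) * ?\<gamma> t) has_integral 0) {0..1}"
    by (simp add: mult_ac)
  then have "((\<lambda>t. cnj (E (?\<gamma> t) * ?\<gamma> t)) has_integral cnj 0) {0..1}"
    by (rule has_integral_linear[OF _ bounded_linear_cnj, unfolded o_def])
  \<comment> \<open>On the circle \<open>cnj w\<close> is r^2 / w, so the conjugate of
    \<open>E w * w\<close> divided by r^2 is \<open>cnj (E w) / w\<close>.\<close>
  from has_integral_mult_right[OF this, of "1 / of_real (r\<^sup>2)"]
  have "((\<lambda>t. 1 / of_real (r\<^sup>2) * cnj (E (?\<gamma> t) * ?\<gamma> t)) has_integral 0) {0..1}"
    by simp
  then have 2: "((\<lambda>t. c + b * (V (?\<gamma> t) / ?\<gamma> t)) has_integral 0) {0..1}"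
  proof (rule has_integral_eq[rotated])
    fix t :: real
    have "1 / of_real (r\<^sup>2) * cnj (E w * w) = cnj (E w) / w" if "cmod w = r" for w
    proof -
      have "w \<noteq> 0" using that assms(3) by auto
      moreover have "of_real (r\<^sup>2) = w * cnj w"
        using that by (metis complex_norm_square)
      ultimately show ?thesis
        by (simp only: complex_cnj_mult) (simp add: field_simps)
    qed
    from this[OF norm[of t]] have "1 / of_real (r\<^sup>2) * cnj (E (?\<gamma> t) * ?\<gamma> t) = cnj (E (?\<gamma> t)) / ?\<gamma> t" .
    also have "\<dots> = c + b * (V (?\<gamma> t) / ?\<gamma> t)"
      using eq[OF norm[of t]] nz[of t] by (simp add: field_simps)
    finally show "1 / of_real (r\<^sup>2) * cnj (E (?\<gamma> t) * ?\<gamma> t) = c + b * (V (?\<gamma> t) / ?\<gamma> t)" .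
  qed
  have "((\<lambda>t. c + b * (V (?\<gamma> t) / ?\<gamma> t)) has_integral c + b * deriv V 0) {0..1}"
    using has_integral_add[OF has_integral_const_real[of c "0::real" 1] has_integral_mult_right[OF 1, of b]] by simp
  from has_integral_unique[OF this 2] show ?thesis .
qed

lemma line_has_derivative:
  assumes "H differentiable (at (axis m \<zeta>))"
  shows "((\<lambda>\<zeta>. H (axis m \<zeta>)) has_derivative (\<lambda>h. dir_deriv H (axis m \<zeta>) (axis m h))) (at (\<zeta>::complex))"
  using has_derivative_compose[OF bounded_linear_imp_has_derivative[OF bounded_linear_axis] has_derivative_dir_deriv[OF assms]]
  by simp

text \<open>A vanishing Wirtinger derivative of \<open>H\<close> is the Cauchy-Riemann equation for
  its conjugate; in the axis variable, derivatives along that axis are all that enters.\<close>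

lemma cnj_line_holomorphic:
  fixes H :: "complex^'n::finite \<Rightarrow> complex"
  assumes "\<And>z. H differentiable (at z)" "\<And>\<zeta>. wirt m H (axis m \<zeta>) = 0"
  shows "(\<lambda>\<zeta>. cnj (H (axis m \<zeta>))) holomorphic_on UNIV"
  unfolding holomorphic_on_def
proof
  fix \<zeta>
  let ?D = "\<lambda>h. dir_deriv H (axis m \<zeta>) (axis m h)"
  have der: "((\<lambda>\<zeta>. H (axis m \<zeta>)) has_derivative ?D) (at \<zeta>)"
    by (rule line_has_derivative[OF assms(1)])
  have lin: "linear ?D"
    by (rule has_derivative_linear[OF der])
  have "?D 1 = \<i> * ?D \<i>"
    using assms(2)[of \<zeta>] by (simp add: wirt_def)
  then have Di: "?D \<i> = - \<i> * ?D 1"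
    by simp
  have "cnj (?D h) = cnj (?D 1) * h" for h
  proof -
    have "h = Re h *\<^sub>R 1 + Im h *\<^sub>R \<i>"
      by (simp add: complex_eq_iff)
    then have "?D h = Re h *\<^sub>R ?D 1 + Im h *\<^sub>R ?D \<i>"
      using linear_add[OF lin, of "Re h *\<^sub>R 1" "Im h *\<^sub>R \<i>"] linear_cmul[OF lin, of "Re h" 1]
        linear_cmul[OF lin, of "Im h" \<i>] by metis
    then show ?thesis
      unfolding Di by (simp add: complex_eq_iff)
  qed
  then have "(\<lambda>h. cnj (?D h)) = (*) (cnj (?D 1))"
    by (rule ext)
  then have "((\<lambda>\<zeta>. cnj (H (axis m \<zeta>))) has_field_derivative cnj (?D 1)) (at \<zeta>)"
    unfolding has_field_derivative_def using has_derivative_cnj[OF der] by metis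
  then show "(\<lambda>\<zeta>. cnj (H (axis m \<zeta>))) field_differentiable at \<zeta> within UNIV"
    using field_differentiable_def by auto
qed

section \<open>Consequences of unitary invariance on a coordinate axis\<close>

lemma unitary_diagonal:
  assumes "\<And>i. cmod (d i) = 1"
  shows "unitary (\<chi> i j. if i = j then d i else 0)"
proof (rule unitaryI)
  fix i j
  have "cnj (d k) * d k = 1" for k
    using assms[of k] complex_norm_square[of "d k"] by (simp add: mult.commute)
  then show "(\<Sum>k\<in>UNIV. cnj ((\<chi> i j. if i = j then d i else 0) $ k $ i) * (\<chi> i j. if i = j then d i else 0) $ k $ j)
      = (if i = j then 1 else 0)"
    by (simp add: if_distrib[of "\<lambda>x. x * _"] if_distrib[of cnj] cong: if_cong)
qed

lemma unitary_permutation: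
  assumes "bij \<sigma>"
  shows "unitary (\<chi> i j. if i = \<sigma> j then 1 else 0)"
proof (rule unitaryI)
  fix i j
  have "\<sigma> i = \<sigma> j \<longleftrightarrow> i = j"
    using assms by (auto dest: bij_is_inj injD)
  then show "(\<Sum>k\<in>UNIV. cnj ((\<chi> i j. if i = \<sigma> j then 1 else 0) $ k $ i) * (\<chi> i j. if i = \<sigma> j then 1 else 0) $ k $ j)
      = (if i = j then 1 else 0)"
    by (auto simp: if_distrib[of "\<lambda>x. x * _"] if_distrib[of cnj] cong: if_cong)
qed

lemma sum_if_zero: "(\<Sum>l\<in>A. if P then F l else 0) = (if P then sum F A else (0::'a::comm_monoid_add))"
  by simp

lemma pullback_cancel:
  assumes "unitary U" "pullback U g z = pullback U h z"
  shows "g (U *v z) = h (U *v z)"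
proof -
  have U1: "transpose (map_matrix cnj U) ** U = mat 1"
    using assms(1) by (simp add: unitary_def)
  then have U2: "U ** transpose (map_matrix cnj U) = mat 1"
    using matrix_left_right_inverse by blast
  have c1: "map_matrix cnj U ** transpose U = mat 1"
    using arg_cong[OF U2, of transpose] by (simp add: matrix_transpose_mul transpose_mat)
  have "map_matrix cnj U ** pullback U F z ** transpose U = F (U *v z)" for F
  proof -
    have "map_matrix cnj U ** pullback U F z ** transpose U
      = (map_matrix cnj U ** transpose U) ** F (U *v z) ** (map_matrix cnj U ** transpose U)"
      by (simp only: pullback_def matrix_mul_assoc)
    then show ?thesis by (simp add: c1)
  qed
  then show ?thesis
    using assms(2) by metis
qed

lemma riem_of_axis: "riem_of g z (axis k c) (axis l d) = Re (g z $ k $ l * c * cnj d)"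
  by (simp add: riem_of_def axis_def if_distrib[of "\<lambda>x. _ * x"] if_distrib[of "\<lambda>x. x * _"] if_distrib[of cnj] cong: if_cong)

locale rot_sym_soliton =
  fixes g :: "'n::finite herm_field" and f :: "complex^'n \<Rightarrow> real" and m :: 'n
  assumes kaehler: "kaehler_metric g" and rot: "rotationally_symmetric g"
    and smooth_f: "smooth f"
    and ricci_eq: "ricci g z i j = hess_11 f z i j"
    and hess_20_eq: "hess_20 g f z i j = 0"
begin

lemma smooth_g: "smooth g" and herm: "g z $ j $ i = cnj (g z $ i $ j)"
  and pos: "v \<noteq> 0 \<Longrightarrow> riem_of g z v v > 0"
  using kaehler unfolding kaehler_metric_def by blast+

lemma pullback_g: "unitary U \<Longrightarrow> pullback U g z = g z"
  using rot unfolding rotationally_symmetric_def by metis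

lemma differentiable_g_nth: "(\<lambda>z. g z $ i $ j) differentiable (at z)"
  by (rule smooth_differentiable[OF smooth_entry[OF smooth_g]])

abbreviation e :: "complex \<Rightarrow> complex^'n" where "e \<zeta> \<equiv> axis m \<zeta>"

definition b :: "real \<Rightarrow> real" where "b r = Re (g (e (of_real r)) $ m $ m)"

lemma g_diag_real: "g z $ i $ i = of_real (Re (g z $ i $ i))"
  using herm[of z i i] by (metis Reals_cnj_iff complex_is_Real_iff of_real_Re)

lemma g_diag_pos: "Re (g z $ i $ i) > 0"
  using pos[of "axis i 1" z] by (simp add: riem_of_axis axis_eq_0_iff)

lemma pullback_diagonal:
  assumes "\<And>i. cmod (d i) = 1"
  shows "g (\<chi> i. d i * z $ i) $ i $ j * (d i * cnj (d j)) = g z $ i $ j"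
proof -
  let ?U = "(\<chi> i j. if i = j then d i else 0) :: complex^'n^'n"
  have "?U *v z = (\<chi> i. d i * z $ i)"
    by (simp add: matrix_vector_mult_def vec_eq_iff if_distrib[of "\<lambda>x. x * _"] cong: if_cong)
  moreover have "g z $ i $ j = pullback ?U g z $ i $ j"
    by (simp add: pullback_g unitary_diagonal assms)
  ultimately show ?thesis
    unfolding pullback_nth
    by (simp add: if_distrib[of "\<lambda>x. x * _"] if_distrib[of "\<lambda>x. _ * x"] if_distrib[of cnj] sum_if_zero mult_ac cong: if_cong)
qed

lemma g_line_offdiag:
  assumes "i \<noteq> j"
  shows "g (e \<zeta>) $ i $ j = 0"
proof -
  \<comment> \<open>One of the two indices that differs from \<open>m\<close>: the reflection in it
    fixes the axis and changes the sign of the entry (i, j).\<close>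
  define l where "l = (if i = m then j else i)"
  define d where "d k = (if k = l then -1 else 1 :: complex)" for k
  have "(\<chi> i. d i * e \<zeta> $ i) = e \<zeta>"
    using assms by (auto simp: vec_eq_iff axis_def d_def l_def)
  moreover have "d i * cnj (d j) = -1"
    using assms by (auto simp: d_def l_def)
  ultimately have "g (e \<zeta>) $ i $ j * (-1) = g (e \<zeta>) $ i $ j"
    using pullback_diagonal[of d "e \<zeta>" i j] by (simp add: d_def)
  then show ?thesis by simp
qed

lemma g_line_radial: "g (e \<zeta>) $ i $ i = g (e (of_real (cmod \<zeta>))) $ i $ i"
proof (cases "\<zeta> = 0")
  case False
  define d where "d k = (if k = m then \<zeta> / of_real (cmod \<zeta>) else 1 :: complex)" for k
  have d: "cmod (d k) = 1" for k
    using False by (simp add: d_def norm_divide)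
  have "(\<chi> i. d i * e (of_real (cmod \<zeta>)) $ i) = e \<zeta>"
    using False by (auto simp: vec_eq_iff axis_def d_def)
  moreover have "d i * cnj (d i) = 1"
    using d[of i] complex_norm_square[of "d i"] by simp
  ultimately show ?thesis
    using pullback_diagonal[of d "e (of_real (cmod \<zeta>))" i i] d by simp
qed simp

lemma g_line_mm: "g (e \<zeta>) $ m $ m = of_real (b (cmod \<zeta>))"
  unfolding b_def by (subst g_line_radial) (rule g_diag_real)

text \<open>Exchanging the coordinates k and l is unitary and fixes the axis.\<close>

lemma g_line_equal:
  assumes "k \<noteq> m" "l \<noteq> m"
  shows "g (e \<zeta>) $ k $ k = g (e \<zeta>) $ l $ l"
proof -
  let ?\<sigma> = "Transposition.transpose k l"
  let ?U = "(\<chi> i j. if i = ?\<sigma> j then 1 else 0) :: complex^'n^'n"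
  have "bij ?\<sigma>" by simp
  have "?U *v e \<zeta> = e \<zeta>"
    using assms unfolding vec_eq_iff matrix_vector_axis by (auto simp: axis_def Transposition.transpose_def)
  moreover have "g (e \<zeta>) $ l $ l = pullback ?U g (e \<zeta>) $ l $ l"
    by (simp add: pullback_g unitary_permutation)
  ultimately show ?thesis
    unfolding pullback_nth
    by (simp add: if_distrib[of "\<lambda>x. x * _"] if_distrib[of "\<lambda>x. _ * x"] if_distrib[of cnj] sum_if_zero cong: if_cong)
qed

text \<open>Both sides are diagonal and equal on the axis, both are invariant, and a unitary map
  carries the axis point to z. Constant profiles suffice since only the sphere of z is concerned. In
  dimension one \<open>a\<close> may be chosen freely, which \<open>radial_potential\<close>
  exploits.\<close>

lemma g_radial_form:
  assumes "z \<noteq> 0" "\<And>k. k \<noteq> m \<Longrightarrow> a = Re (g (e (of_real (norm z))) $ k $ k)"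
  shows "g z = radial_herm (\<lambda>_. a) (\<lambda>_. (b (norm z) - a) / (norm z)\<^sup>2) z"
proof -
  let ?h = "radial_herm (\<lambda>_. a) (\<lambda>_. (b (norm z) - a) / (norm z)\<^sup>2)"
  let ?e = "e (of_real (norm z))"
  obtain U where U: "unitary U" "U *v ?e = z"
    by (rule unitary_transitive)
  have "g ?e $ i $ j = ?h ?e $ i $ j" for i j
  proof (cases "i = j")
    case True
    show ?thesis
    proof (cases "i = m")
      case m: True
      have "b (norm z) = a + (b (norm z) - a) / (norm z)\<^sup>2 * (norm z * norm z)"
        using assms(1) by (simp add: power2_eq_square)
      then have "complex_of_real (b (norm z)) = of_real a + of_real ((b (norm z) - a) / (norm z)\<^sup>2) * (of_real (norm z) * of_real (norm z))"
        by (simp only: of_real_mult[symmetric] of_real_add[symmetric])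
      moreover have "g ?e $ m $ m = of_real (b (norm z))"
        using g_line_mm[of "of_real (norm z)"] by simp
      ultimately show ?thesis
        unfolding m True[symmetric] radial_herm_nth norm_axis_complex by (simp add: axis_def mult.assoc del: of_real_divide)
    next
      case False
      then show ?thesis
        using True assms(2)[OF False] g_diag_real[of ?e i] by (simp add: radial_herm_nth axis_def)
    qed
  next
    case False
    then have e_zero: "?e $ i = 0 \<or> ?e $ j = 0"
      by (auto simp: axis_def)
    with False show ?thesis
      by (auto simp: g_line_offdiag[OF False] radial_herm_nth)
  qed
  then have "pullback U g ?e = pullback U ?h ?e"
    by (simp add: pullback_g[OF U(1)] pullback_radial[OF U(1)] vec_eq_iff)
  from pullback_cancel[OF U(1) this] show ?thesis
    by (simp add: U(2))
qed

text \<open>Closedness of the Kaehler form, evaluated on the vectors \<open>e\<^sub>m\<close>, \<open>e\<^sub>k\<close>, \<open>i e\<^sub>k\<close>.\<close>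

lemma kaehler_relation:
  assumes k: "k \<noteq> m" and r: "r > 0"
  defines "a \<equiv> \<lambda>r. Re (g (e (of_real r)) $ k $ k)"
  shows "(a has_real_derivative 2 * (b r - a r) / r) (at r)"
proof -
  let ?z = "e (of_real r)"
  have diff: "(\<lambda>p. Re (g p $ i $ j)) differentiable (at z)" "(\<lambda>p. Im (g p $ i $ j)) differentiable (at z)" for i j z
    using differentiable_g_nth[of i j z] unfolding differentiable_def
    by (auto intro: has_derivative_Re has_derivative_Im)
  have off: "g p $ i $ j = of_real ((b r - a r) / r\<^sup>2) * cnj (p $ i) * p $ j" if "norm p = r" "i \<noteq> j" for p i j
  proof -
    have "p \<noteq> 0" using that r by auto
    then have "g p = radial_herm (\<lambda>_. a r) (\<lambda>_. (b (norm p) - a r) / (norm p)\<^sup>2) p"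
    proof (rule g_radial_form)
      show "a r = Re (g (e (complex_of_real (norm p))) $ l $ l)" if "l \<noteq> m" for l
        using g_line_equal[OF k that, of "of_real r"] \<open>norm p = r\<close> by (simp add: a_def)
    qed
    then show ?thesis
      using that by (simp add: radial_herm_nth)
  qed
  \<comment> \<open>For unimodular \<open>w\<close>, a great circle leaving \<open>?z\<close> in the
    direction \<open>w\<close> times the k-th unit vector. On its sphere the off-diagonal entries
    are known by \<open>off\<close>, so they can be differentiated along it without differentiating
    \<open>a\<close> or \<open>b\<close>.\<close>
  define c where "c w t = e (of_real (r * cos t)) + axis k (w * of_real (r * sin t))" for w :: complex and t :: real
  have c_norm: "norm (c w t) = r" if "cmod w = 1" for w t
  proof -
    have "cdot (c w t) (c w t) = of_real ((r * cos t)\<^sup>2 + (r * sin t)\<^sup>2) "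
    proof -
      have "w * cnj w = 1" using that complex_norm_square[of w] by simp
      then have "cdot (axis k (w * of_real (r * sin t))) (axis k (w * of_real (r * sin t))) = of_real ((r * sin t)\<^sup>2)"
        by (simp add: cdot_def axis_def if_distrib[of "\<lambda>x. x * _"] power2_eq_square algebra_simps cong: if_cong)
      moreover have "cdot (e (of_real (r * cos t))) (e (of_real (r * cos t))) = of_real ((r * cos t)\<^sup>2)"
        by (simp add: cdot_def axis_def if_distrib[of "\<lambda>x. x * _"] power2_eq_square cong: if_cong)
      moreover have "cdot (e x) (axis k y) = 0" "cdot (axis k y) (e x) = 0" for x y
        using k by (auto simp: cdot_def axis_def if_distrib[of "\<lambda>x. x * _"] cong: if_cong)
      ultimately show ?thesis
        by (simp add: c_def cdot_simps)
    qed
    also have "(r * cos t)\<^sup>2 + (r * sin t)\<^sup>2 = r\<^sup>2"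
      by (simp add: power_mult_distrib distrib_left[symmetric])
    finally show ?thesis
      using r by (simp add: cdot_self del: of_real_power)
  qed
  have c_deriv: "(c w has_vector_derivative axis k (w * of_real r)) (at 0)" for w
  proof -
    have "((\<lambda>t. axis m (complex_of_real (r * cos t)) + axis k (w * complex_of_real (r * sin t))) has_vector_derivative
       axis m (complex_of_real (r * - sin 0)) + axis k (w * complex_of_real (r * cos 0))) (at 0)"
      by (intro has_vector_derivative_add bounded_linear.has_vector_derivative[OF bounded_linear_axis]
          bounded_linear.has_vector_derivative[OF bounded_linear_compose[OF bounded_linear_mult_right bounded_linear_of_real], unfolded o_def]
          bounded_linear.has_vector_derivative[OF bounded_linear_of_real])
        (auto intro!: derivative_eq_intros simp flip: has_real_derivative_iff_has_vector_derivative)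
    moreover have "e 0 = 0"
      by (simp add: vec_eq_iff axis_def)
    ultimately show ?thesis
      by (simp add: c_def[abs_def])
  qed
  have sc: "((\<lambda>t. (b r - a r) * (sin t * cos t)) has_vector_derivative (b r - a r)) (at 0)"
    by (auto intro!: derivative_eq_intros simp flip: has_real_derivative_iff_has_vector_derivative)
  have c0: "c w 0 = ?z" for w
    by (simp add: c_def vec_eq_iff axis_def)
  have lin: "dir_deriv F ?z (axis k (w * of_real r)) = r * dir_deriv F ?z (axis k w)"
    if "F differentiable (at ?z)" for F :: "complex^'n \<Rightarrow> real" and w
  proof -
    have "axis k (w * of_real r) = r *\<^sub>R axis k w"
      by (simp add: vec_eq_iff axis_def scaleR_conv_of_real[where 'a = complex])
    then show ?thesis
      using linear_cmul[OF has_derivative_linear[OF has_derivative_dir_deriv[OF that]]] by simp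
  qed
  have "((\<lambda>t. Re (g (c 1 t) $ k $ m)) has_vector_derivative dir_deriv (\<lambda>p. Re (g p $ k $ m)) ?z (axis k (1 * of_real r))) (at 0)"
    using dir_deriv_along_curve[OF _ c_deriv[of 1], of "\<lambda>p. Re (g p $ k $ m)"] diff by (simp add: c0)
  moreover have "(\<lambda>t. Re (g (c 1 t) $ k $ m)) = (\<lambda>t. (b r - a r) * (sin t * cos t))"
    using k r by (simp add: fun_eq_iff off c_norm) (simp add: c_def axis_def power2_eq_square)
  ultimately have D1: "r * dir_deriv (\<lambda>p. Re (g p $ k $ m)) ?z (axis k 1) = b r - a r"
    using vector_derivative_unique_at[OF _ sc] lin[OF diff(1), where w = 1] by simp
  have "((\<lambda>t. Im (g (c \<i> t) $ m $ k)) has_vector_derivative dir_deriv (\<lambda>p. Im (g p $ m $ k)) ?z (axis k (\<i> * of_real r))) (at 0)"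
    using dir_deriv_along_curve[OF _ c_deriv[of \<i>], of "\<lambda>p. Im (g p $ m $ k)"] diff by (simp add: c0)
  moreover have "(\<lambda>t. Im (g (c \<i> t) $ m $ k)) = (\<lambda>t. (b r - a r) * (sin t * cos t))"
    using k r by (simp add: fun_eq_iff off c_norm) (simp add: c_def axis_def power2_eq_square)
  ultimately have D2: "r * dir_deriv (\<lambda>p. Im (g p $ m $ k)) ?z (axis k \<i>) = b r - a r"
    using vector_derivative_unique_at[OF _ sc] lin[OF diff(2), where w = "\<i>"] by simp
  have sm: "\<i> *s axis l w = axis l (\<i> * w)" for l :: 'n and w
    by (simp add: vec_eq_iff axis_def)
  have "dir_deriv (\<lambda>p. kaehler_form g p (axis k 1) (axis k \<i>)) ?z (e 1)
       + dir_deriv (\<lambda>p. kaehler_form g p (axis k \<i>) (e 1)) ?z (axis k 1)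
       + dir_deriv (\<lambda>p. kaehler_form g p (e 1) (axis k 1)) ?z (axis k \<i>) = 0"
    using kaehler unfolding kaehler_metric_def by blast
  then have "dir_deriv (\<lambda>p. Re (g p $ k $ k)) ?z (e 1)
      + dir_deriv (\<lambda>p. - Re (g p $ k $ m)) ?z (axis k 1)
      + dir_deriv (\<lambda>p. - Im (g p $ m $ k)) ?z (axis k \<i>) = 0"
    by (simp add: kaehler_form_def sm riem_of_axis)
  then have "dir_deriv (\<lambda>p. Re (g p $ k $ k)) ?z (e 1) = dir_deriv (\<lambda>p. Re (g p $ k $ m)) ?z (axis k 1)
      + dir_deriv (\<lambda>p. Im (g p $ m $ k)) ?z (axis k \<i>)"
    by (simp add: dir_deriv_uminus diff)
  then have D: "dir_deriv (\<lambda>p. Re (g p $ k $ k)) ?z (e 1) = 2 * (b r - a r) / r"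
    using D1 D2 r by (simp add: field_simps)
  have "((\<lambda>t. axis m (complex_of_real t)) has_vector_derivative e 1) (at r)"
    using bounded_linear.has_vector_derivative[OF bounded_linear_axis
        bounded_linear.has_vector_derivative[OF bounded_linear_of_real has_vector_derivative_id]] by simp
  from dir_deriv_along_curve[OF diff(1)[of k k] this, unfolded D] show ?thesis
    unfolding has_real_derivative_iff_has_vector_derivative by (simp add: a_def)
qed

end

lemma eq_at_isCont:
  fixes F G :: "'a::{perfect_space,t2_space} \<Rightarrow> 'b::t2_space"
  assumes "isCont F x" "isCont G x" "\<And>y. y \<noteq> x \<Longrightarrow> F y = G y"
  shows "F x = G x"
proof -
  have "(F \<longlongrightarrow> G x) (at x)"
    using assms(2,3) unfolding isCont_def by (simp add: tendsto_cong[of F G] eventually_at_filter)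
  then show ?thesis
    using assms(1) unfolding isCont_def by (rule tendsto_unique[OF at_neq_bot, rotated])
qed

lemma C_k_det:
  fixes M :: "'a::euclidean_space \<Rightarrow> complex^'n^'n"
  assumes "\<And>i j. C_k k (\<lambda>x. M x $ i $ j)"
  shows "C_k k (\<lambda>x. det (M x))"
  unfolding det_def by (intro C_k_sum C_k_mult C_k_const C_k_prod assms)

section \<open>Determinant, gradient field and potential on the axis\<close>

context rot_sym_soliton
begin

lemma continuous_line: "continuous_on UNIV (\<lambda>r. Re (g (e (of_real r)) $ i $ j))"
proof -
  have "continuous_on UNIV (\<lambda>z. g z $ i $ j)"
    using differentiable_g_nth by (simp add: continuous_at_imp_continuous_on differentiable_imp_continuous_within)
  moreover have "continuous_on UNIV (\<lambda>r. e (complex_of_real r))"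
    by (rule linear_continuous_on[OF bounded_linear_compose[OF bounded_linear_axis bounded_linear_of_real]])
  ultimately show ?thesis
    by (intro continuous_on_Re) (rule continuous_on_compose2[where t = UNIV], auto)
qed

lemma b_pos: "b r > 0"
  unfolding b_def by (rule g_diag_pos)

text \<open>From dimension two on, \<open>a\<close> is a tangential eigenvalue and the derivative of
  \<open>\<phi>\<close> is closedness of the Kaehler form. In dimension one there is no tangential
  direction: \<open>\<phi>\<close> is the primitive of \<open>2 * r * b r\<close>, and
  \<open>a\<close> is read off from it.\<close>

lemma radial_potential:
  obtains a \<phi> :: "real \<Rightarrow> real" where "continuous_on {0..} \<phi>" "\<phi> 0 = 0"
    "\<And>r. r > 0 \<Longrightarrow> \<phi> r = r\<^sup>2 * a r"
    "\<And>r. r > 0 \<Longrightarrow> (\<phi> has_real_derivative 2 * r * b r) (at r)"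
    "\<And>r. r > 0 \<Longrightarrow> a r > 0"
    "\<And>z. z \<noteq> 0 \<Longrightarrow> g z = radial_herm (\<lambda>_. a (norm z)) (\<lambda>_. (b (norm z) - a (norm z)) / (norm z)\<^sup>2) z"
proof (cases "\<exists>k. k \<noteq> m")
  case True
  then obtain k where k: "k \<noteq> m" by blast
  define a where "a r = Re (g (e (of_real r)) $ k $ k)" for r
  have a_cont: "continuous_on UNIV a"
    unfolding a_def[abs_def] by (rule continuous_line)
  show ?thesis
  proof
    show "continuous_on {0..} (\<lambda>r. r\<^sup>2 * a r)"
      by (intro continuous_intros continuous_on_subset[OF a_cont]) auto
    show "((\<lambda>r. r\<^sup>2 * a r) has_real_derivative 2 * r * b r) (at r)" if "r > 0" for r
    proof -
      have "((\<lambda>r. r\<^sup>2 * a r) has_real_derivative 2 * r * a r + r\<^sup>2 * (2 * (b r - a r) / r)) (at r)"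
        using kaehler_relation[OF k that, folded a_def] by (auto intro!: derivative_eq_intros)
      moreover have "2 * r * a r + r\<^sup>2 * (2 * (b r - a r) / r) = 2 * r * b r"
        using that by (simp add: field_simps power2_eq_square)
      ultimately show ?thesis by simp
    qed
    show "a r > 0" for r
      unfolding a_def by (rule g_diag_pos)
    show "g z = radial_herm (\<lambda>_. a (norm z)) (\<lambda>_. (b (norm z) - a (norm z)) / (norm z)\<^sup>2) z" if "z \<noteq> 0" for z
    proof (rule g_radial_form[OF that])
      show "a (norm z) = Re (g (e (of_real (norm z))) $ l $ l)" if "l \<noteq> m" for l
        using g_line_equal[OF k that, of "of_real (norm z)"] by (simp add: a_def)
    qed
  qed simp_all
next
  case False
  define \<phi> where "\<phi> r = integral {0..r} (\<lambda>s. 2 * s * b s)" for r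
  have "continuous_on A b" for A
    unfolding b_def[abs_def] by (rule continuous_on_subset[OF continuous_line]) simp
  then have b_cont: "continuous_on A (\<lambda>s. 2 * s * b s)" for A
    by (simp add: continuous_intros)
  have der: "(\<phi> has_real_derivative 2 * r * b r) (at r within {0..R})" if "0 \<le> r" "r \<le> R" for r R
    unfolding \<phi>_def using integral_has_real_derivative[OF b_cont] that by simp
  have der': "(\<phi> has_real_derivative 2 * r * b r) (at r)" if "r > 0" for r
    using der[of r "r + 1"] that by (simp add: at_within_Icc_at)
  have \<phi>0: "\<phi> 0 = 0"
    by (simp add: \<phi>_def)
  have \<phi>_cont: "continuous_on {0..} \<phi>"
    unfolding continuous_on_eq_continuous_within
  proof
    fix x :: real assume x: "x \<in> {0..}"
    have "at x within {0..} = at x within {0..x + 1}"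
      by (rule at_within_nhd[of x "{..<x + 1}"]) auto
    then show "continuous (at x within {0..}) \<phi>"
      using der[of x "x + 1"] x by (auto intro: DERIV_continuous)
  qed
  have \<phi>_pos: "\<phi> r > 0" if r: "r > 0" for r
  proof -
    have "\<phi> 0 < \<phi> r"
    proof (rule DERIV_pos_imp_increasing_open[OF r])
      show "\<exists>y. (\<phi> has_real_derivative y) (at x) \<and> y > 0" if "0 < x" for x
        using der'[OF that] b_pos[of x] that by (intro exI[of _ "2 * x * b x"]) simp
      show "continuous_on {0..r} \<phi>"
        by (rule continuous_on_subset[OF \<phi>_cont]) auto
    qed
    then show ?thesis by (simp add: \<phi>0)
  qed
  show ?thesis
  proof
    show "\<phi> r = r\<^sup>2 * (\<phi> r / r\<^sup>2)" if "r > 0" for r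
      using that by simp
    show "\<phi> r / r\<^sup>2 > 0" if "r > 0" for r
      using \<phi>_pos[OF that] that by simp
    show "g z = radial_herm (\<lambda>_. \<phi> (norm z) / (norm z)\<^sup>2) (\<lambda>_. (b (norm z) - \<phi> (norm z) / (norm z)\<^sup>2) / (norm z)\<^sup>2) z" if "z \<noteq> 0" for z
      by (rule g_radial_form[OF that]) (use False in blast)
  qed (simp_all add: \<phi>0 \<phi>_cont der')
qed

text \<open>The determinant as a real function: by \<open>det_g_eq\<close> it is real and positive,
  which reduces the complex logarithm in \<open>ricci\<close> to the real one.\<close>

definition \<delta> :: "complex^'n \<Rightarrow> real" where "\<delta> z = Re (det (g z))"

lemma det_g_radial: "det (g z) = det (g (e (of_real (norm z))))"
proof -
  obtain U where U: "unitary U" "U *v e (of_real (norm z)) = z"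
    by (rule unitary_transitive)
  show ?thesis
    using det_pullback_unitary[OF U(1), of g "e (of_real (norm z))"] by (simp add: U pullback_g)
qed

lemma det_g_eq: "det (g z) = of_real (\<delta> z)" and \<delta>_pos: "\<delta> z > 0"
proof -
  let ?e = "e (of_real (norm z))"
  have "det (g z) = (\<Prod>i\<in>UNIV. g ?e $ i $ i)"
    unfolding det_g_radial[of z] by (rule det_diagonal) (simp add: g_line_offdiag)
  also have "\<dots> = of_real (\<Prod>i\<in>UNIV. Re (g ?e $ i $ i))"
    unfolding of_real_prod by (intro prod.cong refl g_diag_real)
  finally have eq: "det (g z) = of_real (\<Prod>i\<in>UNIV. Re (g ?e $ i $ i))" .
  then have \<delta>: "\<delta> z = (\<Prod>i\<in>UNIV. Re (g ?e $ i $ i))"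
    by (simp only: \<delta>_def Re_complex_of_real)
  show "det (g z) = of_real (\<delta> z)"
    unfolding \<delta> by (rule eq)
  show "\<delta> z > 0"
    unfolding \<delta> by (intro prod_pos ballI g_diag_pos)
qed

lemma \<delta>_radial: "\<delta> (e \<zeta>) = \<delta> (e (of_real (cmod \<zeta>)))"
  unfolding \<delta>_def using det_g_radial[of "e \<zeta>"] by (simp add: norm_axis_complex)

lemma smooth_\<delta>: "smooth \<delta>"
  unfolding smooth_def \<delta>_def[abs_def]
  using smooth_entry[OF smooth_g] by (auto simp: smooth_def intro!: C_k_compose_linear[OF bounded_linear_Re] C_k_det)

abbreviation F :: "complex^'n \<Rightarrow> complex" where "F \<equiv> \<lambda>z. of_real (f z)"
abbreviation \<Phi> :: "complex^'n \<Rightarrow> complex" where "\<Phi> \<equiv> wirt m F"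
abbreviation W :: "complex^'n \<Rightarrow> complex" where "W \<equiv> wirt_bar m (\<lambda>p. ln (det (g p)))"

lemma dir_deriv_F: "dir_deriv F z v = of_real (dir_deriv f z v)"
  by (rule dir_deriv_eq[OF has_derivative_of_real[OF has_derivative_dir_deriv[OF smooth_differentiable[OF smooth_f]]]])

lemma wirt_bar_F: "wirt_bar m F z = cnj (\<Phi> z)"
  by (simp add: wirt_def wirt_bar_def dir_deriv_F)

lemma \<Phi>_differentiable: "\<Phi> differentiable (at z)"
  by (rule smooth_differentiable[OF smooth_wirt[OF smooth_of_real[OF smooth_f]]])

lemma ln_det_deriv:
  "((\<lambda>p. ln (det (g p))) has_derivative (\<lambda>v. of_real (dir_deriv \<delta> z v / \<delta> z))) (at z)"
proof -
  have "(\<lambda>p. ln (det (g p))) = (\<lambda>p. complex_of_real (ln (\<delta> p)))"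
    by (simp add: fun_eq_iff det_g_eq Ln_of_real \<delta>_pos)
  moreover have "((\<lambda>p. ln (\<delta> p)) has_derivative (\<lambda>v. dir_deriv \<delta> z v / \<delta> z)) (at z)"
    using has_derivative_ln[OF \<delta>_pos has_derivative_dir_deriv[OF smooth_differentiable[OF smooth_\<delta>]], of z]
    by (simp add: divide_inverse)
  ultimately show ?thesis
    using has_derivative_of_real by metis
qed

lemma W_eq: "W z = (of_real (dir_deriv \<delta> z (e 1) / \<delta> z) + \<i> * of_real (dir_deriv \<delta> z (e \<i>) / \<delta> z)) / 2"
  unfolding wirt_bar_def dir_deriv_eq[OF ln_det_deriv] ..

lemma W_differentiable: "W differentiable (at z)"
proof -
  have "(\<lambda>z. complex_of_real (dir_deriv \<delta> z v / \<delta> z)) differentiable (at z)" for v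
  proof -
    have "(\<lambda>z. dir_deriv \<delta> z v / \<delta> z) differentiable (at z)"
      using \<delta>_pos[of z] by (intro differentiable_divide smooth_differentiable smooth_dir_deriv smooth_\<delta>) auto
    then show ?thesis
      unfolding differentiable_def using has_derivative_of_real by blast
  qed
  then have "(\<lambda>z. (of_real (dir_deriv \<delta> z (e 1) / \<delta> z) + \<i> * of_real (dir_deriv \<delta> z (e \<i>) / \<delta> z)) / 2) differentiable (at z)"
    by (intro differentiable_divide differentiable_add differentiable_mult) auto
  then show ?thesis
    unfolding W_eq[abs_def] .
qed

text \<open>Since g is diagonal on the axis, the Christoffel sum collapses to one term. The result
  is the numerator of the quotient rule for \<open>\<Phi>\<close> divided by the (m, m) entry of
  g.\<close>

lemma hess_20_line: "wirt m \<Phi> (e \<zeta>) * g (e \<zeta>) $ m $ m = wirt m (\<lambda>z. g z $ m $ m) (e \<zeta>) * \<Phi> (e \<zeta>)"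
proof -
  let ?z = "e \<zeta>" and ?inv = "matrix_inv (g (e \<zeta>))"
  let ?w = "wirt m (\<lambda>z. g z $ m $ m) (e \<zeta>)"
  \<comment> \<open>These entries vanish along the whole axis, hence so do their derivatives in its
    direction.\<close>
  have zero: "wirt m (\<lambda>z. g z $ m $ l) ?z = 0" if "l \<noteq> m" for l
  proof -
    have "((\<lambda>\<zeta>. g (e \<zeta>) $ m $ l) has_derivative (\<lambda>h. dir_deriv (\<lambda>z. g z $ m $ l) ?z (e h))) (at \<zeta>)"
      by (rule line_has_derivative[OF differentiable_g_nth])
    moreover have "((\<lambda>\<zeta>. g (e \<zeta>) $ m $ l) has_derivative (\<lambda>h. 0)) (at \<zeta>)"
      using that by (simp add: g_line_offdiag)
    ultimately have "(\<lambda>h. dir_deriv (\<lambda>z. g z $ m $ l) ?z (e h)) = (\<lambda>h. 0)"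
      by (rule has_derivative_unique)
    then show ?thesis
      unfolding wirt_def by (simp add: fun_eq_iff)
  qed
  have "det (g ?z) \<noteq> 0"
    using \<delta>_pos[of ?z] by (simp add: det_g_eq)
  then have "g ?z ** ?inv = mat 1"
    unfolding invertible_det_nz[symmetric] invertible_def matrix_inv_def
    by (rule someI2_ex) simp
  then have "(\<Sum>l\<in>UNIV. g ?z $ m $ l * ?inv $ l $ k) = (if m = k then 1 else 0)" for k
    by (simp add: vec_eq_iff matrix_matrix_mult_def mat_def)
  moreover have "(\<Sum>l\<in>UNIV. g ?z $ m $ l * ?inv $ l $ k) = g ?z $ m $ m * ?inv $ m $ k" for k
    by (subst sum.remove[of UNIV m]) (auto simp: g_line_offdiag intro!: sum.neutral)
  ultimately have inv: "g ?z $ m $ m * ?inv $ m $ k = (if m = k then 1 else 0)" for k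
    by simp
  have chris: "christoffel g ?z k m m = ?inv $ m $ k * ?w" for k
    unfolding christoffel_def by (subst sum.remove[of UNIV m]) (auto simp: zero intro!: sum.neutral)
  have "wirt m \<Phi> ?z = (\<Sum>k\<in>UNIV. ?inv $ m $ k * ?w * wirt k F ?z)"
    using hess_20_eq[of ?z m m] by (simp add: hess_20_def chris)
  then have "wirt m \<Phi> ?z * g ?z $ m $ m = (\<Sum>k\<in>UNIV. (g ?z $ m $ m * ?inv $ m $ k) * (?w * wirt k F ?z))"
    by (simp add: sum_distrib_left mult_ac)
  then show ?thesis
    unfolding inv by (simp add: if_distrib[of "\<lambda>x. x * _"] cong: if_cong)
qed

text \<open>The \<open>m\<close>-th component of the gradient field of \<open>f\<close> is holomorphic on the \<open>m\<close>-th coordinate axis, since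
  \<open>g\<close> is diagonal there.\<close>

lemma gradient_holomorphic: "(\<lambda>\<zeta>. cnj (\<Phi> (e \<zeta>) / g (e \<zeta>) $ m $ m)) holomorphic_on UNIV"
proof -
  have nz: "g z $ m $ m \<noteq> 0" for z
    using g_diag_pos[of z m] by auto
  have der: "((\<lambda>z. \<Phi> z / g z $ m $ m) has_derivative (\<lambda>v. (dir_deriv \<Phi> z v * g z $ m $ m
      - \<Phi> z * dir_deriv (\<lambda>z. g z $ m $ m) z v) / (g z $ m $ m * g z $ m $ m))) (at z)" for z
    by (intro has_derivative_divide' has_derivative_dir_deriv \<Phi>_differentiable differentiable_g_nth nz)
  have "wirt m (\<lambda>z. \<Phi> z / g z $ m $ m) z = (wirt m \<Phi> z * g z $ m $ m
      - \<Phi> z * wirt m (\<lambda>z. g z $ m $ m) z) / (g z $ m $ m * g z $ m $ m)" for z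
    unfolding wirt_def[of m \<Phi>] wirt_def[of m "\<lambda>z. g z $ m $ m"] wirt_def[of m "\<lambda>z. \<Phi> z / g z $ m $ m"] dir_deriv_eq[OF der]
    using nz[of z] by (simp add: field_simps)
  then have "wirt m (\<lambda>z. \<Phi> z / g z $ m $ m) (e \<zeta>) = 0" for \<zeta>
    by (simp add: hess_20_line)
  then show ?thesis
    using der by (intro cnj_line_holomorphic[of "\<lambda>z. \<Phi> z / g z $ m $ m"]) (auto simp: differentiable_def)
qed

text \<open>The (m, m) component of the Ricci equation says that the m-th Wirtinger derivative
  annihilates the m-th conjugate derivative of log det g + f.\<close>

lemma potential_holomorphic: "(\<lambda>\<zeta>. cnj (W (e \<zeta>) + cnj (\<Phi> (e \<zeta>)))) holomorphic_on UNIV"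
proof -
  have d: "wirt_bar m F differentiable (at z)" for z
    by (rule smooth_differentiable[OF smooth_wirt_bar[OF smooth_of_real[OF smooth_f]]])
  have der: "((\<lambda>z. W z + wirt_bar m F z) has_derivative (\<lambda>v. dir_deriv W z v + dir_deriv (wirt_bar m F) z v)) (at z)" for z
    by (intro has_derivative_add has_derivative_dir_deriv W_differentiable d)
  have "wirt m (\<lambda>z. W z + wirt_bar m F z) z = wirt m W z + wirt m (wirt_bar m F) z" for z
    unfolding wirt_def[of m W] wirt_def[of m "wirt_bar m F"] wirt_def[of m "\<lambda>z. W z + wirt_bar m F z"] dir_deriv_eq[OF der]
    by (simp add: field_simps)
  moreover have "wirt m W z + wirt m (wirt_bar m F) z = 0" for z
    using ricci_eq[of z m m] unfolding ricci_def hess_11_def by (metis add.right_inverse)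
  ultimately have "(\<lambda>\<zeta>. cnj (W (e \<zeta>) + wirt_bar m F (e \<zeta>))) holomorphic_on UNIV"
    using der by (intro cnj_line_holomorphic[of "\<lambda>z. W z + wirt_bar m F z"]) (auto simp: differentiable_def)
  then show ?thesis
    by (simp add: wirt_bar_F)
qed

text \<open>On the circle of radius r, invariance makes \<open>W\<close> equal to
  \<open>l / (2 * r)\<close> times \<zeta> and the (m, m) entry of g equal to \<open>b r\<close>, so
  \<open>circle_average\<close> gives l / (2 r) + b V'(0) = 0. The number V'(0) is the same for all
  radii; its real part is \<open>v\<close>.\<close>

lemma ln_det_line_deriv:
  obtains v where "\<And>r. r > 0 \<Longrightarrow> ((\<lambda>r. ln (\<delta> (e (of_real r)))) has_real_derivative - (v * (2 * r * b r))) (at r)"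
proof
  let ?V = "\<lambda>\<zeta>. cnj (\<Phi> (e \<zeta>) / g (e \<zeta>) $ m $ m)"
  define v where "v = Re (deriv ?V 0)"
  fix r :: real assume r: "r > 0"
  have dL: "((\<lambda>\<zeta>. ln (\<delta> (e \<zeta>))) has_derivative (\<lambda>h. dir_deriv \<delta> (e \<zeta>) (e h) / \<delta> (e \<zeta>))) (at \<zeta>)" for \<zeta>
    using has_derivative_ln[OF \<delta>_pos line_has_derivative[OF smooth_differentiable[OF smooth_\<delta>]]]
    by (simp add: divide_inverse)
  define l where "l = dir_deriv \<delta> (e (of_real r)) (e 1) / \<delta> (e (of_real r))"
  have l_deriv: "((\<lambda>r. ln (\<delta> (e (of_real r)))) has_real_derivative l) (at r)"
  proof -
    have lin: "linear (\<lambda>h. dir_deriv \<delta> (e (of_real r)) (e h) / \<delta> (e (of_real r)))"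
      by (rule has_derivative_linear[OF dL])
    have "((\<lambda>r. ln (\<delta> (e (of_real r)))) has_derivative (\<lambda>h. dir_deriv \<delta> (e (of_real r)) (e (of_real h)) / \<delta> (e (of_real r)))) (at r)"
      using has_derivative_compose[OF bounded_linear_imp_has_derivative[OF bounded_linear_of_real] dL] .
    moreover have "dir_deriv \<delta> (e (of_real r)) (e (of_real h)) / \<delta> (e (of_real r)) = l * h" for h
      using linear_cmul[OF lin, of h 1] by (simp add: l_def scaleR_conv_of_real mult.commute)
    ultimately show ?thesis
      unfolding has_field_derivative_def by (simp add: mult_commute_abs)
  qed
  have W_line: "W (e \<zeta>) = of_real (l / (2 * r)) * \<zeta>" if "cmod \<zeta> = r" for \<zeta>
  proof -
    have \<zeta>: "\<zeta> \<noteq> 0" using that r by auto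
    have "((\<lambda>\<zeta>. ln (\<delta> (e (of_real (cmod \<zeta>))))) has_derivative (\<lambda>h. l * (h \<bullet> sgn \<zeta>))) (at \<zeta>)"
      using has_derivative_compose[OF has_derivative_norm[OF \<zeta>], of "\<lambda>r. ln (\<delta> (e (of_real r)))" "(*) l"] l_deriv that
      by (simp add: has_field_derivative_def)
    then have "((\<lambda>\<zeta>. ln (\<delta> (e \<zeta>))) has_derivative (\<lambda>h. l * (h \<bullet> sgn \<zeta>))) (at \<zeta>)"
      by (simp add: \<delta>_radial[symmetric])
    from has_derivative_unique[OF dL this]
    have "dir_deriv \<delta> (e \<zeta>) (e h) / \<delta> (e \<zeta>) = l * (h \<bullet> sgn \<zeta>)" for h
      by metis
    then have "W (e \<zeta>) = (of_real (l * (1 \<bullet> sgn \<zeta>)) + \<i> * of_real (l * (\<i> \<bullet> sgn \<zeta>))) / 2"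
      by (simp only: W_eq)
    then show ?thesis
      using that r by (simp add: complex_eq_iff inner_complex_def sgn_div_norm field_simps)
  qed
  have "of_real (l / (2 * r)) + of_real (b r) * deriv ?V 0 = 0"
  proof (rule circle_average[OF gradient_holomorphic potential_holomorphic r])
    fix \<zeta> assume \<zeta>: "cmod \<zeta> = r"
    have "b r \<noteq> 0" using b_pos[of r] by simp
    then show "of_real (l / (2 * r)) * \<zeta> + of_real (b r) * ?V \<zeta> = cnj (cnj (W (e \<zeta>) + cnj (\<Phi> (e \<zeta>))))"
      using \<zeta> by (simp add: W_line g_line_mm)
  qed
  then have "Re (of_real (l / (2 * r)) + of_real (b r) * deriv ?V 0) = 0"
    by simp
  then have "l = - (v * (2 * r * b r))"
    using r by (simp add: v_def field_simps)
  with l_deriv show "((\<lambda>r. ln (\<delta> (e (of_real r)))) has_real_derivative - (v * (2 * r * b r))) (at r)"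
    by simp
qed

lemma exists_soliton_profile:
  obtains v C a \<phi> where "soliton_profile CARD('n) v C a b \<phi>"
    "\<And>z. z \<noteq> 0 \<Longrightarrow> g z = radial_herm (\<lambda>_. a (norm z)) (\<lambda>_. (b (norm z) - a (norm z)) / (norm z)\<^sup>2) z"
proof -
  obtain a \<phi> :: "real \<Rightarrow> real" where \<phi>: "continuous_on {0..} \<phi>" "\<phi> 0 = 0"
    "\<And>r. r > 0 \<Longrightarrow> \<phi> r = r\<^sup>2 * a r"
    "\<And>r. r > 0 \<Longrightarrow> (\<phi> has_real_derivative 2 * r * b r) (at r)"
    "\<And>r. r > 0 \<Longrightarrow> a r > 0"
    and g: "\<And>z. z \<noteq> 0 \<Longrightarrow> g z = radial_herm (\<lambda>_. a (norm z)) (\<lambda>_. (b (norm z) - a (norm z)) / (norm z)\<^sup>2) z"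
    using radial_potential by metis
  obtain v where v: "\<And>r. r > 0 \<Longrightarrow> ((\<lambda>r. ln (\<delta> (e (of_real r)))) has_real_derivative - (v * (2 * r * b r))) (at r)"
    using ln_det_line_deriv by metis
  let ?G = "\<lambda>r. ln (\<delta> (e (of_real r))) + v * \<phi> r"
  have \<delta>_eq: "\<delta> (e (of_real r)) = b r * a r ^ (CARD('n) - 1)" if r: "r > 0" for r
  proof -
    let ?e = "e (of_real r)"
    have ne: "?e \<noteq> 0" and norm: "norm ?e = r"
      using r by (simp_all add: axis_eq_0_iff norm_axis_complex)
    have "det (g ?e) = of_real ((a r + r\<^sup>2 * ((b r - a r) / r\<^sup>2)) * a r ^ (CARD('n) - 1))"
      unfolding g[OF ne] det_radial norm ..
    also have "a r + r\<^sup>2 * ((b r - a r) / r\<^sup>2) = b r"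
      using r by simp
    finally show ?thesis
      by (simp only: det_g_eq of_real_eq_iff)
  qed
  have "continuous_on {0..} ?G"
  proof -
    have "continuous_on UNIV \<delta>"
      using smooth_differentiable[OF smooth_\<delta>]
      by (simp add: continuous_at_imp_continuous_on differentiable_imp_continuous_within)
    moreover have "continuous_on {0..} (\<lambda>r. e (complex_of_real r))"
      by (rule linear_continuous_on[OF bounded_linear_compose[OF bounded_linear_axis bounded_linear_of_real]])
    ultimately have "continuous_on {0..} (\<lambda>r. \<delta> (e (of_real r)))"
      by (rule continuous_on_compose2) auto
    then show ?thesis
      using \<delta>_pos by (intro continuous_intros \<phi>(1)) (auto simp: less_imp_neq[symmetric])
  qed
  moreover have "(?G has_real_derivative 0) (at r)" if "r > 0" for r
    using DERIV_add[OF v[OF that] DERIV_cmult[OF \<phi>(4)[OF that], of v]] by simp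
  ultimately have G: "?G r = ln (\<delta> (e 0))" if "r > 0" for r
    using const_from_zero_deriv[of ?G r] that \<phi>(2) by simp
  have "soliton_profile CARD('n) v (\<delta> (e 0)) a b \<phi>"
  proof
    fix r :: real assume r: "r > 0"
    have "b r * a r ^ (CARD('n) - 1) * exp (v * \<phi> r) = exp (?G r)"
      unfolding \<delta>_eq[OF r, symmetric] exp_add using \<delta>_pos by simp
    also have "\<dots> = \<delta> (e 0)"
      unfolding G[OF r] using \<delta>_pos by simp
    finally show "b r * a r ^ (CARD('n) - 1) * exp (v * \<phi> r) = \<delta> (e 0)" .
  qed (use \<phi> b_pos \<delta>_pos in auto)
  then show ?thesis
    using that g by blast
qed

end

section \<open>Uniqueness\<close>

context rot_sym_soliton
begin

lemma isCont_g: "isCont g z"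
  by (rule differentiable_imp_continuous_within[OF smooth_differentiable[OF smooth_g]])

text \<open>All curvature coefficients vanish for p = q = 0. The real plane spanned by
  \<open>e 1\<close> and \<open>e \<i>\<close> is a witness in every dimension, including
  one.\<close>

lemma flat_not_positive:
  assumes "a > 0" "\<And>z. g z = radial_herm (\<lambda>_. a) (\<lambda>_. 0) z"
  shows "\<not> positive_sectional_curv (riem_of g)"
proof
  assume pos: "positive_sectional_curv (riem_of g)"
  interpret flat: radial_metric "\<lambda>_. a" "\<lambda>_. 0" "\<lambda>_. 0" "\<lambda>_. 0" "\<lambda>_. 0"
    by standard (use assms(1) in auto)
  have g: "g = flat.g"
    using assms(2) by (simp add: fun_eq_iff flat.g_def)
  have "e 1 \<noteq> e \<i>"
    by (simp add: axis_eq_axis complex_eq_iff)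
  moreover have "independent {e 1, e \<i>}"
  proof (rule pairwise_orthogonal_independent)
    show "pairwise orthogonal {e 1, e \<i>}"
      by (simp add: pairwise_insert orthogonal_def inner_axis_axis inner_complex_def)
    show "0 \<notin> {e 1, e \<i>}"
      by (auto simp: axis_eq_0_iff dest!: sym[of 0])
  qed
  ultimately have "sectional_curv (riem_of g) 0 (e 1) (e \<i>) > 0"
    using pos unfolding positive_sectional_curv_def by blast
  moreover have "riem_of g 0 (riemann_curv (riem_of g) 0 (e 1) (e \<i>) (e \<i>)) (e 1) = 0"
    unfolding g flat.curvature_numerator by (simp add: flat.k0_def flat.k1_def flat.k2_def)
  ultimately show False
    by (simp add: sectional_curv_def)
qed

lemma homothetic_to_cao_metric:
  assumes pos: "positive_sectional_curv (riem_of g)"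
  obtains s \<beta> where "s > 0" "\<beta> > 0" "\<And>z. g z = s *\<^sub>R cao_metric CARD('n) (\<beta> *\<^sub>R z)"
proof -
  obtain v C a \<phi> where "soliton_profile CARD('n) v C a b \<phi>"
    and g: "\<And>z. z \<noteq> 0 \<Longrightarrow> g z = radial_herm (\<lambda>_. a (norm z)) (\<lambda>_. (b (norm z) - a (norm z)) / (norm z)\<^sup>2) z"
    using exists_soliton_profile by metis
  then interpret soliton_profile "CARD('n)" v C a b \<phi>
    by simp
  have "v \<noteq> 0"
  proof
    assume v: "v = 0"
    have a: "a r = a 1" if "r > 0" for r
      using flat_case(1)[OF v that] flat_case(1)[OF v zero_less_one] a_pos[OF that] a_pos[OF zero_less_one]
        power_eq_imp_eq_base[of "a r" "CARD('n)" "a 1"] by simp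
    have g': "g z = radial_herm (\<lambda>_. a 1) (\<lambda>_. 0) z" if "z \<noteq> 0" for z
      using g[OF that] flat_case(2)[OF v, of "norm z"] a[of "norm z"] that by simp
    moreover have "radial_herm (\<lambda>_. a 1) (\<lambda>_. 0) = (\<lambda>z. radial_herm (\<lambda>_. a 1) (\<lambda>_. 0) (0 :: complex^'n))"
      by (simp add: fun_eq_iff vec_eq_iff radial_herm_nth)
    then have "isCont (radial_herm (\<lambda>_. a 1) (\<lambda>_. 0)) (0 :: complex^'n)"
      by (metis continuous_const)
    ultimately have "g z = radial_herm (\<lambda>_. a 1) (\<lambda>_. 0) z" for z
      using eq_at_isCont[OF isCont_g, where G = "radial_herm (\<lambda>_. a 1) (\<lambda>_. 0)" and x = 0] by (cases "z = 0") auto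
    then show False
      using flat_not_positive[of "a 1"] a_pos[of 1] pos by auto
  qed
  then have v: "v > 0"
    using v_nonneg by simp
  obtain \<kappa> where \<kappa>: "\<kappa> > 0" "\<And>r. r > 0 \<Longrightarrow> a r = \<kappa> / v * prof_coeff CARD('n) (\<kappa> * r\<^sup>2)"
    "\<And>r. r > 0 \<Longrightarrow> b r = \<kappa> / v * (prof_coeff CARD('n) (\<kappa> * r\<^sup>2) * mom_quot CARD('n) (prof CARD('n) (\<kappa> * r\<^sup>2)))"
    using profile_unique[OF v] by metis
  \<comment> \<open>The profiles are evaluated at \<open>\<kappa> * r\<^sup>2\<close>, the squared
    norm of \<open>sqrt \<kappa> *\<^sub>R z\<close>; the common factor \<open>\<kappa> / v\<close>
    becomes the scaling.\<close>
  let ?h = "\<lambda>z :: complex^'n. (\<kappa> / v) *\<^sub>R cao_metric CARD('n) (sqrt \<kappa> *\<^sub>R z)"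
  have eq: "g z = ?h z" if "z \<noteq> 0" for z
  proof -
    let ?r = "norm z" and ?x = "\<kappa> * (norm z)\<^sup>2"
    let ?A = "prof_coeff CARD('n) ?x" and ?c = "mom 0 CARD('n) (prof CARD('n) ?x)"
    have r: "?r > 0" using that by simp
    have mq: "mom_quot CARD('n) (prof CARD('n) ?x) = 1 - ?x * (?A * ?c)"
      using prof_coeff_1_minus[of "CARD('n)" ?x] \<kappa>(1) by simp
    have ba: "(b ?r - a ?r) / ?r\<^sup>2 = \<kappa> / v * (- (?A\<^sup>2 * ?c)) * \<kappa>"
      unfolding \<kappa>(2,3)[OF r] mq using r v by (simp add: field_simps power2_eq_square)
    have sq: "(norm (sqrt \<kappa> *\<^sub>R z))\<^sup>2 = ?x"
      using \<kappa>(1) by (simp add: power_mult_distrib)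
    have sk: "complex_of_real (sqrt \<kappa>) * complex_of_real (sqrt \<kappa>) = complex_of_real \<kappa>"
      using \<kappa>(1) by (simp flip: of_real_mult)
    have "g z $ i $ j = ?h z $ i $ j" for i j
    proof -
      have "g z $ i $ j = (if i = j then of_real (\<kappa> / v * ?A) else 0)
          + of_real (\<kappa> / v * (- (?A\<^sup>2 * ?c)) * \<kappa>) * cnj (z $ i) * z $ j"
        unfolding g[OF that] radial_herm_nth ba unfolding \<kappa>(2)[OF r] ..
      also have "\<dots> = of_real (\<kappa> / v) * ((if i = j then of_real ?A else 0)
          + of_real (- (?A\<^sup>2 * ?c)) * (of_real (sqrt \<kappa>) * of_real (sqrt \<kappa>)) * cnj (z $ i) * z $ j)"
        unfolding sk by (simp add: algebra_simps)
      also have "\<dots> = ?h z $ i $ j"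
        unfolding cao_metric_def[OF zero_less_card_finite] vector_scaleR_component radial_herm_nth sq scaleR_conv_of_real[where 'a = complex]
        by (simp add: mult_ac)
      finally show ?thesis .
    qed
    then show ?thesis by (simp add: vec_eq_iff)
  qed
  \<comment> \<open>The profile equations say nothing at the origin; there the two metrics agree by
    continuity.\<close>
  have "isCont ?h 0"
  proof -
    have "smooth (cao_metric CARD('n) :: 'n herm_field)"
      using complete_rot_sym_positive_soliton_cao_metric[where 'n = 'n, OF zero_less_card_finite refl]
      by (simp add: complete_rot_sym_positive_soliton_def gradient_kr_soliton_def kaehler_metric_def)
    then have "isCont (cao_metric CARD('n) :: 'n herm_field) (sqrt \<kappa> *\<^sub>R 0)"
      by (intro differentiable_imp_continuous_within smooth_differentiable)
    note cont = this
    have "isCont (\<lambda>z :: complex^'n. sqrt \<kappa> *\<^sub>R z) 0"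
      by (simp add: continuous_intros)
    from isCont_o2[OF this cont] show ?thesis
      by (rule continuous_scaleR[OF continuous_const])
  qed
  then have "g 0 = ?h 0"
    by (rule eq_at_isCont[OF isCont_g _ eq])
  with eq have "g z = ?h z" for z
    by (cases "z = 0") auto
  then show ?thesis
    using that[of "\<kappa> / v" "sqrt \<kappa>"] \<kappa>(1) v by simp
qed

end

lemma complete_rot_sym_positive_soliton_homothetic:
  fixes g :: "'n::finite herm_field"
  assumes "complete_rot_sym_positive_soliton g"
  obtains s \<beta> where "s > 0" "\<beta> > 0" "\<And>z. g z = s *\<^sub>R cao_metric CARD('n) (\<beta> *\<^sub>R z)"
proof -
  obtain f where "rot_sym_soliton g f"
    using assms unfolding complete_rot_sym_positive_soliton_def gradient_kr_soliton_def rot_sym_soliton_def by metis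
  moreover have "positive_sectional_curv (riem_of g)"
    using assms by (simp add: complete_rot_sym_positive_soliton_def)
  ultimately show ?thesis
    using that by (rule rot_sym_soliton.homothetic_to_cao_metric)
qed

lemma pullback_real_dilation:
  "pullback (mat (complex_of_real b)) g z = b\<^sup>2 *\<^sub>R g (b *\<^sub>R z)"
proof -
  have mv: "mat (complex_of_real b) *v z = b *\<^sub>R z"
    by (simp add: vec_eq_iff matrix_vector_mult_def mat_def if_distrib[of "\<lambda>x. x * _"] scaleR_conv_of_real[where 'a = complex] cong: if_cong)
  show ?thesis
    unfolding vec_eq_iff pullback_nth mv
    by (simp add: mat_def if_distrib[of "\<lambda>x. x * _"] if_distrib[of "\<lambda>x. _ * x"] if_distrib[of cnj] sum_if_zero
        scaleR_conv_of_real[where 'a = complex] power2_eq_square mult_ac cong: if_cong)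
qed

theorem theorem1:
  shows "(\<exists>g :: 'n::finite herm_field. complete_rot_sym_positive_soliton g) \<and>
    (\<forall>g g' :: 'n herm_field.
       complete_rot_sym_positive_soliton g \<and> complete_rot_sym_positive_soliton g' \<longrightarrow>
       (\<exists>c > (0::real). \<exists>b > (0::real). \<forall>z.
          g' z = c *\<^sub>R pullback (mat (complex_of_real b)) g z))"
proof (intro conjI allI impI)
  show "\<exists>g :: 'n herm_field. complete_rot_sym_positive_soliton g"
    using complete_rot_sym_positive_soliton_cao_metric[where 'n = 'n, OF zero_less_card_finite refl] by blast
  fix g g' :: "'n herm_field"
  assume gg': "complete_rot_sym_positive_soliton g \<and> complete_rot_sym_positive_soliton g'"
  obtain s \<beta> where g: "s > 0" "\<beta> > 0" "\<And>z. g z = s *\<^sub>R cao_metric CARD('n) (\<beta> *\<^sub>R z)"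
    using gg' complete_rot_sym_positive_soliton_homothetic by blast
  obtain s' \<beta>' where g': "s' > 0" "\<beta>' > 0" "\<And>z. g' z = s' *\<^sub>R cao_metric CARD('n) (\<beta>' *\<^sub>R z)"
    using gg' complete_rot_sym_positive_soliton_homothetic by blast
  show "\<exists>c > (0::real). \<exists>b > (0::real). \<forall>z. g' z = c *\<^sub>R pullback (mat (complex_of_real b)) g z"
  proof (intro exI conjI allI)
    \<comment> \<open>The pullback by the dilation already multiplies the metric by
      \<open>(\<beta>' / \<beta>)\<^sup>2\<close>, so this factor is divided out of the scaling
      constant.\<close>
    show "s' / s / (\<beta>' / \<beta>)\<^sup>2 > 0" "\<beta>' / \<beta> > 0"
      using g(1,2) g'(1,2) by simp_all
    show "g' z = (s' / s / (\<beta>' / \<beta>)\<^sup>2) *\<^sub>R pullback (mat (complex_of_real (\<beta>' / \<beta>))) g z" for z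
      unfolding pullback_real_dilation g(3) g'(3) using g(1,2) g'(1,2) by simp
  qed
qed

end
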